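(* Let $K_1, K_2$ be infinite compact Hausdorff spaces and let $E$ be a Banach space such that $\mathcal{C}(K_1)$ is isomorphic to a subspace of $\mathcal{C}(K_2,E)$. Then for each ordinal $\alpha$ the following hold. (i) If $E$ has nontrivial cotype, then $$\min_{\beta<\omega^{\alpha}}c_{\text{pb}}(K_1^{(\beta)},K_1)\le\min_{\beta<\omega^{\alpha}}c_{\text{pb}}(K_2^{(\beta)},K_2).$$ In particular, $c(K_1)\le c(K_2)$ and $c_{\text{pb}}(K_1^{(\infty)},K_1)\le c_{\text{pb}}(K_2^{(\infty)},K_2)$. (ii) If $E$ does not contain an isomorphic copy of $c_0$, then $$\min_{\beta<\omega^{\alpha}}c_{\text{pb}}(K_1^{(\beta)},K_1)\le\min_{\beta<\omega^{\alpha}}c_{\text{pf}}(K_2^{(\beta)},K_2).$$ In particular, $c(K_1)\le c(K_2)$ and $c_{\text{pb}}(K_1^{(\infty)},K_1)\le c_{\text{pf}}(K_2^{(\infty)},K_2)$.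
   Context: All topological spaces are Hausdorff. For a compact space $K$ and a Banach space $E$, $\mathcal{C}(K,E)$ is the Banach space of continuous functions $K\to E$ with the sup-norm, and $\mathcal{C}(K)=\mathcal{C}(K,\mathbb{R})$. Isomorphic means linearly homeomorphic. Cantor-Bendixson derivatives: $X^{(0)}=X$, $X^{(1)}$ is the set of accumulation points of $X$, $X^{(\beta+1)}=(X^{(\beta)})^{(1)}$, and $X^{(\alpha)}=\bigcap_{\beta<\alpha}X^{(\beta)}$ for limit ordinals $\alpha$. The perfect kernel $X^{(\infty)}$ is the eventual value $X^{(\alpha)}$, where $\alpha$ is such that $X^{(\alpha)}=X^{(\beta)}$ for all $\beta>\alpha$. Powers $\omega^\alpha$ are ordinal powers. A family $\mathcal{U}$ of nonempty subsets of a topological space $X$ has order $k\in\mathbb{N}$ if every $x\in X$ lies in at most $k$ sets from $\mathcal{U}$; it is point-bounded if it has order $k$ for some $k\in\mathbb{N}$; it is point-finite if every $x\in X$ lies in only finitely many sets from $\mathcal{U}$. The family $\mathcal{U}$ is meeting $A\subseteq X$ if $A\cap U\ne\emptyset$ for each $U\in\mathcal{U}$. For $A\subseteq X$, $c_{\text{pb}}(A,X)$ (resp. $c_{\text{pf}}(A,X)$) is the supremum of the cardinalities $|\mathcal{U}|$ over all point-bounded (resp. point-finite) families $\mathcal{U}$ of nonempty open subsets of $X$ that are meeting $A$. The cellularity $c(X)$ is the supremum of the cardinalities of families of pairwise disjoint nonempty open subsets of $X$. A Banach space $E$ has nontrivial cotype if there are a real number $q\ge 2$ and a constant $C>0$ such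 that for all $n\in\mathbb{N}$ and $e_1,\dots,e_n\in E$, $\left(\sum_{i=1}^n\|e_i\|^q\right)^{1/q}\le C\left(\int_0^1\left\|\sum_{i=1}^n r_i(t)e_i\right\|^2dt\right)^{1/2}$, where $r_i(t)=\operatorname{sign}(\sin(2^i\pi t))$ are the Rademacher functions. *)

theory Defs
  imports "HOL-Analysis.Analysis"
begin

unbundle cardinal_syntax

section \<open>Cardinals and ordinals\<close>

text \<open>
  Cardinals and ordinals are represented, as in the library, by well-order relations that are
  compared with \<open>\<le>o\<close> and \<open><o\<close>; \<open>card_min\<close> and \<open>card_sup\<close> are determined up to \<open>=o\<close>.
  \<open>card_sup F\<close> is the least upper bound of the cardinalities of the members of \<open>F\<close>; it exists on
  the type \<open>'a\<close> because the cardinality of \<open>UNIV :: 'a set\<close> is an upper bound.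
\<close>

definition card_min :: "'a rel set \<Rightarrow> 'a rel" where
  "card_min R = (SOME r. r \<in> R \<and> (\<forall>r'\<in>R. r \<le>o r'))"

definition card_sup :: "'a set set \<Rightarrow> 'a rel" where
  "card_sup F = card_min {r. Card_order r \<and> (\<forall>A\<in>F. |A| \<le>o r)}"

text \<open>
  The ordinal power \<open>\<omega>\<^sup>r\<close>: the functions of finite support from \<open>Field r\<close> to the natural numbers,
  compared at the largest argument at which they differ. This is the Cantor normal form
  description that HOL-Cardinals also uses for ordinal exponentiation (where it is \<open>natLeq ^o r\<close>,
  with functions that are undefined rather than 0 outside \<open>Field r\<close>).
\<close>

definition omega_pow :: "'o rel \<Rightarrow> ('o \<Rightarrow> nat) rel" where
  "omega_pow r =
     (let F = {f. finite {x. f x \<noteq> 0} \<and> {x. f x \<noteq> 0} \<subseteq> Field r}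
      in {(f, g). f \<in> F \<and> g \<in> F \<and>
            (f = g \<or> (\<exists>z\<in>Field r. f z < g z \<and> (\<forall>y. (z, y) \<in> r \<and> y \<noteq> z \<longrightarrow> f y = g y)))})"


section \<open>Cantor-Bendixson derivatives\<close>

definition derived_set :: "'a::topological_space set \<Rightarrow> 'a set" where
  "derived_set A = {x \<in> A. x islimpt A}"

definition is_last :: "'o rel \<Rightarrow> 'o \<Rightarrow> bool" where
  "is_last r m \<longleftrightarrow> m \<in> Field r \<and> (\<forall>x\<in>Field r. (x, m) \<in> r)"

text \<open>
  \<open>cb_derivative X r\<close> is \<open>X\<^sup>(\<^sup>\<alpha>\<^sup>)\<close> for the order type \<open>\<alpha>\<close> of the well-order \<open>r\<close>. If \<open>r\<close> has a last
  element \<open>m\<close>, then \<open>\<alpha>\<close> is a successor and the restriction of \<open>r\<close> to the elements strictly below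
  \<open>m\<close> represents its predecessor. In the limit case every ordinal below \<open>\<alpha>\<close> is represented by an
  initial segment of \<open>r\<close>, so that nothing is lost by letting \<open>s\<close> range over the same type.
\<close>

function cb_derivative :: "'a::topological_space set \<Rightarrow> 'o rel \<Rightarrow> 'a set" where
  "cb_derivative X r =
     (if \<not> Well_order r then undefined
      else if Field r = {} then X
      else if \<exists>m. is_last r m
        then derived_set (cb_derivative X (Restr r (underS r (THE m. is_last r m))))
      else (\<Inter>s\<in>{s. s <o r}. cb_derivative X s))"
  by pat_completeness auto
termination
proof (relation "inv_image (ordLess :: 'o rel rel) (snd :: 'a set \<times> 'o rel \<Rightarrow> 'o rel)")
  show "wf (inv_image (ordLess :: 'o rel rel) (snd :: 'a set \<times> 'o rel \<Rightarrow> 'o rel))"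
    by (intro wf_inv_image wf_ordLess)
qed (auto simp: underS_Restr_ordLess)

declare cb_derivative.simps [simp del]

text \<open>
  The eventual value of the derivatives. The ordinals represented on the type \<open>'a set\<close> suffice:
  the strictly decreasing part of the sequence has at most \<open>|X|\<close> steps.
\<close>

definition perfect_kernel :: "'a::topological_space set \<Rightarrow> 'a set" where
  "perfect_kernel X =
     (THE S. \<exists>r :: 'a set rel. Well_order r \<and> cb_derivative X r = S \<and>
        (\<forall>s :: 'a set rel. r <o s \<longrightarrow> cb_derivative X s = S))"


section \<open>Families of open sets\<close>

definition has_order :: "'a set set \<Rightarrow> nat \<Rightarrow> bool" where
  "has_order \<U> k \<longleftrightarrow> (\<forall>x. finite {U \<in> \<U>. x \<in> U} \<and> card {U \<in> \<U>. x \<in> U} \<le> k)"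

definition point_bounded :: "'a set set \<Rightarrow> bool" where
  "point_bounded \<U> \<longleftrightarrow> (\<exists>k. has_order \<U> k)"

definition point_finite :: "'a set set \<Rightarrow> bool" where
  "point_finite \<U> \<longleftrightarrow> (\<forall>x. finite {U \<in> \<U>. x \<in> U})"

definition meeting :: "'a set set \<Rightarrow> 'a set \<Rightarrow> bool" where
  "meeting \<U> A \<longleftrightarrow> (\<forall>U\<in>\<U>. A \<inter> U \<noteq> {})"

text \<open>The ambient space \<open>X\<close> of \<open>c\<^sub>p\<^sub>b(A, X)\<close>, \<open>c\<^sub>p\<^sub>f(A, X)\<close> and \<open>c(X)\<close> is the whole type.\<close>

definition open_family :: "'a::topological_space set set \<Rightarrow> bool" where
  "open_family \<U> \<longleftrightarrow> (\<forall>U\<in>\<U>. open U \<and> U \<noteq> {})"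

definition c_pb :: "'a::topological_space set \<Rightarrow> 'a set rel" where
  "c_pb A = card_sup {\<U>. open_family \<U> \<and> point_bounded \<U> \<and> meeting \<U> A}"

definition c_pf :: "'a::topological_space set \<Rightarrow> 'a set rel" where
  "c_pf A = card_sup {\<U>. open_family \<U> \<and> point_finite \<U> \<and> meeting \<U> A}"

definition cellularity :: "'a::topological_space itself \<Rightarrow> 'a set rel" where
  "cellularity _ = card_sup {\<U> :: 'a set set. open_family \<U> \<and> disjoint \<U>}"


section \<open>Banach spaces\<close>

text \<open>For compact \<open>'k\<close>, the library type \<open>'k \<Rightarrow>\<^sub>C 'e\<close> of bounded continuous functions with the
  sup-norm is \<open>\<C>(K, E)\<close>. In \<open>linearly_homeomorphic\<close>, \<open>S\<close> and \<open>T\<close> are linear subspaces.\<close>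

definition linearly_homeomorphic ::
    "'x::real_normed_vector set \<Rightarrow> 'y::real_normed_vector set \<Rightarrow> bool" where
  "linearly_homeomorphic S T \<longleftrightarrow>
     (\<exists>f g. (\<forall>x\<in>S. \<forall>y\<in>S. f (x + y) = f x + f y) \<and> (\<forall>c. \<forall>x\<in>S. f (c *\<^sub>R x) = c *\<^sub>R f x) \<and>
            homeomorphism S T f g)"

definition isomorphic_to_subspace_of ::
    "'x::real_normed_vector set \<Rightarrow> 'y::real_normed_vector itself \<Rightarrow> bool" where
  "isomorphic_to_subspace_of S _ \<longleftrightarrow> (\<exists>T :: 'y set. subspace T \<and> linearly_homeomorphic S T)"

text \<open>\<open>c\<^sub>0\<close> as a subspace of \<open>\<ell>\<^sub>\<infinity>\<close>; the topology of \<open>nat\<close> is discrete.\<close>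

definition c0 :: "(nat \<Rightarrow>\<^sub>C real) set" where
  "c0 = {x. apply_bcontfun x \<longlonglongrightarrow> 0}"

definition rademacher :: "nat \<Rightarrow> real \<Rightarrow> real" where
  "rademacher i t = sgn (sin (2 ^ i * pi * t))"

definition nontrivial_cotype :: "'e::real_normed_vector itself \<Rightarrow> bool" where
  "nontrivial_cotype _ \<longleftrightarrow>
     (\<exists>q C :: real. q \<ge> 2 \<and> C > 0 \<and>
        (\<forall>(n::nat) (e :: nat \<Rightarrow> 'e).
           (\<Sum>i=1..n. norm (e i) powr q) powr (1 / q)
             \<le> C * sqrt (integral {0..1} (\<lambda>t. (norm (\<Sum>i=1..n. rademacher i t *\<^sub>R e i))\<^sup>2))))"

end

theory Submission
  imports Defs "HOL-Library.Multiset"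
begin

text \<open>
  Let \<open>T\<close> embed \<open>\<C>(K\<^sub>1)\<close> into \<open>\<C>(K\<^sub>2, E)\<close>, and let \<open>D\<^sub>z\<close> be the Cantor-Bendixson derivative of order
  \<open>\<omega>\<^sup>z\<close>. Functions whose supports overlap at most \<open>k\<close> times have images that form, at each point of
  \<open>K\<^sub>2\<close>, a weakly unconditionally Cauchy sequence in \<open>E\<close>. If \<open>E\<close> does not contain \<open>c\<^sub>0\<close>, only finitely many terms are large, and if \<open>E\<close>
  has nontrivial cotype, their number is bounded. Hence a point-bounded family of open sets \<open>U\<close> in
  \<open>K\<^sub>1\<close> yields a point-finite (point-bounded) family of sets \<open>{\<parallel>T f\<^sub>U\<parallel> > c/4}\<close> in \<open>K\<^sub>2\<close>, provided that
  some \<open>f\<^sub>U\<close> supported in \<open>U\<close> has an image that is large on the given derivative of \<open>K\<^sub>2\<close>.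

  To find such an \<open>f\<^sub>U\<close> when \<open>U\<close> meets \<open>D\<^sub>z\<^sup>m(K\<^sub>1)\<close> for large \<open>m\<close>, one stacks plateau functions: each
  new one lives on the plateau of its predecessors and is small where their images are large. At
  each point at most one image is large, so the sum of \<open>N\<close> functions has norm \<open>N\<close> although its image
  has norm about \<open>\<parallel>T\<parallel>\<close> plus \<open>N\<close> times a small error. The new function is found by the same
  averaging argument, by induction on the height of the compact set on which it has to be small.
\<close>

text \<open>Powers of \<omega> enter because heights get multiplied. Being small on a closed set of
  height \<open>n\<close>, in units of \<omega>^z, costs \<open>m\<close> such units in K1; one more
  unit multiplies this cost by the number \<open>N\<close> of stacked functions, which depends on
  \<epsilon>. So \<omega>^z * n is answered by \<omega>^z * m with no control over \<open>m\<close>,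
  and only bounds closed under finite multiples can be compared. Passing to a larger exponent is
  cheap: by compactness, a closed set whose derivative of order \<omega>^z is empty (z not least)
  already has an empty derivative of some order \<omega>^w * k with w below z. Although w and k vary
  with the set, one derivative of order \<omega>^z in K1 is contained in those of all orders
  \<omega>^w * m.

  The passage from open sets in K1 to open sets in K2 is only finite-to-one, which is harmless
  because the cardinals on the side of K2 are infinite. Perfect kernels are reached by running
  through so many exponents that the derivatives of K2 stop shrinking.\<close>

no_notation elt_set_eq (infix "=o" 50)

section \<open>Minima and suprema of cardinals\<close>

lemma card_min_props:
  assumes "R \<noteq> {}" and "\<forall>r\<in>R. Well_order r"
  shows "card_min R \<in> R" and "r \<in> R \<Longrightarrow> card_min R \<le>o r"
proof -
  have "\<exists>r. r \<in> R \<and> (\<forall>r'\<in>R. r \<le>o r')"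
    using exists_minim_Well_order[OF assms] by blast
  from someI_ex[OF this] show "card_min R \<in> R" and "r \<in> R \<Longrightarrow> card_min R \<le>o r"
    by (auto simp: card_min_def)
qed

lemma card_sup_set:
  fixes F :: "'a set set"
  shows "{r :: 'a rel. Card_order r \<and> (\<forall>A\<in>F. |A| \<le>o r)} \<noteq> {}"
proof -
  have "|UNIV :: 'a set| \<in> {r :: 'a rel. Card_order r \<and> (\<forall>A\<in>F. |A| \<le>o r)}"
    by (simp add: card_of_Card_order card_of_mono1)
  then show ?thesis by blast
qed

lemma card_sup_Card_order: "Card_order (card_sup F)"
  and card_sup_upper: "A \<in> F \<Longrightarrow> |A| \<le>o card_sup F"
  using card_min_props(1)[OF card_sup_set[of F]] card_order_on_well_order_on by (auto simp: card_sup_def)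

text \<open>The bound \<open>r\<close> may live on another type than the candidates of
  \<open>card_sup F\<close>. If it is at most \<open>|UNIV|\<close>, a copy of it on an injective
  image of its field is a candidate; otherwise the candidate \<open>|UNIV|\<close> is already below
  \<open>r\<close>.\<close>

lemma card_sup_least:
  fixes F :: "'a set set" and r :: "'b rel"
  assumes r: "Card_order r" and up: "\<And>A. A \<in> F \<Longrightarrow> |A| \<le>o r"
  shows "card_sup F \<le>o r"
proof (cases "r \<le>o |UNIV :: 'a set|")
  case True
  have rF: "|Field r| =o r"
    using r by (rule card_of_Field_ordIso)
  obtain h :: "'b \<Rightarrow> 'a" where h: "inj_on h (Field r)"
    using ordIso_ordLeq_trans[OF rF True] unfolding card_of_ordLeq[symmetric] by blast
  have "|Field r| =o |h ` Field r|"
    using inj_on_imp_bij_betw[OF h] card_of_ordIso by blast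
  then have hr: "|h ` Field r| =o r"
    using rF by (blast intro: ordIso_transitive[OF ordIso_symmetric])
  have "|A| \<le>o |h ` Field r|" if "A \<in> F" for A
    by (rule ordLeq_ordIso_trans[OF up[OF that] ordIso_symmetric[OF hr]])
  then have "card_sup F \<le>o |h ` Field r|"
    unfolding card_sup_def using card_sup_set[of F] card_order_on_well_order_on
    by (intro card_min_props(2)) (auto simp: card_of_Card_order)
  then show ?thesis
    using hr by (rule ordLeq_ordIso_trans)
next
  case False
  then have UNIV_le: "|UNIV :: 'a set| \<le>o r"
    using ordLeq_total[of r "|UNIV :: 'a set|"] card_order_on_well_order_on[OF r] card_of_Well_order
    by blast
  have "card_sup F \<le>o |UNIV :: 'a set|"
    unfolding card_sup_def using card_sup_set[of F] card_order_on_well_order_on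
    by (intro card_min_props(2)) (auto simp: card_of_Card_order card_of_mono1)
  then show ?thesis
    using UNIV_le by (rule ordLeq_transitive)
qed

lemma infinite_Field_if_large_finite:
  assumes "Card_order r" and "\<And>n. \<exists>A :: 'a set. finite A \<and> card A = n \<and> ( |A| \<le>o r)"
  shows "\<not> finite (Field r)"
proof
  assume fin: "finite (Field r)"
  obtain A :: "'a set" where A: "finite A" "card A = Suc (card (Field r))" "|A| \<le>o r"
    using assms(2)[of "Suc (card (Field r))"] by (elim exE conjE) (rule that, assumption+)
  have "|A| \<le>o |Field r|"
    by (rule ordLeq_ordIso_trans[OF A(3) ordIso_symmetric[OF card_of_Field_ordIso[OF assms(1)]]])
  then obtain f where "inj_on f A" "f ` A \<subseteq> Field r"
    unfolding card_of_ordLeq[symmetric] by blast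
  from card_inj_on_le[OF this fin] show False
    using A(2) by simp
qed

text \<open>An infinite cardinal absorbs finite fibres. This allows \<open>F\<close> in
  \<open>transfer_family\<close> to send several open sets to the same one.\<close>

lemma card_of_finite_to_one:
  assumes r: "Card_order r" "\<not> finite (Field r)"
    and B: "|B| \<le>o r" and f: "f ` A \<subseteq> B" and fin: "\<And>b. b \<in> B \<Longrightarrow> finite {a \<in> A. f a = b}"
  shows "|A| \<le>o r"
proof -
  have "A = (\<Union>b\<in>B. {a \<in> A. f a = b})"
    using f by auto
  moreover have "|\<Union>b\<in>B. {a \<in> A. f a = b}| \<le>o r"
  proof (rule card_of_UNION_ordLeq_infinite_Field[OF r(2,1) B], safe)
    fix b assume "b \<in> B"
    then have "|{a \<in> A. f a = b}| <o |Field r|"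
      using finite_ordLess_infinite[OF card_of_Well_order card_of_Well_order, of "{a \<in> A. f a = b}" "Field r"] fin r(2)
      by (simp add: Field_card_of)
    then show "|{a \<in> A. f a = b}| \<le>o r"
      by (rule ordLeq_ordIso_trans[OF ordLess_imp_ordLeq card_of_Field_ordIso[OF r(1)]])
  qed
  ultimately show ?thesis by simp
qed

section \<open>Smaller ordinals as initial segments\<close>

abbreviation seg :: "'o rel \<Rightarrow> 'o \<Rightarrow> 'o rel" where
  "seg r a \<equiv> Restr r (underS r a)"

lemma seg_less: "Well_order r \<Longrightarrow> a \<in> Field r \<Longrightarrow> seg r a <o r"
  by (rule underS_Restr_ordLess) auto

lemma seg_less_seg:
  assumes r: "Well_order r" and ab: "(a, b) \<in> r" "a \<noteq> b"
  shows "seg r a <o seg r b"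
proof -
  have wo: "wo_rel r" using r by (simp add: wo_rel_def)
  have "underS r a \<subseteq> underS r b" "a \<in> underS r b" "a \<notin> underS r a"
    using ab wo_rel.TRANS[OF wo] wo_rel.ANTISYM[OF wo]
    by (auto simp: underS_def trans_def antisym_def)
  then have "underS r a \<subset> underS r b" by blast
  then show ?thesis
    using ofilter_subset_ordLess[OF r] wo_rel.underS_ofilter[OF wo] by blast
qed

lemma ordLess_seg_cases:
  assumes "s <o r"
  obtains a where "a \<in> Field r" "s =o seg r a"
proof -
  have "Well_order r" "Well_order s"
    using assms by (auto simp: ordLess_def)
  then show thesis
    using assms ordLess_iff_ordIso_Restr that by blast
qed

lemma ordLess_seg_seg_cases:
  assumes r: "Well_order r" and a: "a \<in> Field r" and s: "s <o seg r a"
  obtains b where "(b, a) \<in> r" "b \<noteq> a" "s =o seg r b"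
proof -
  have "s <o r" using s seg_less[OF r a] by (rule ordLess_transitive)
  then obtain b where b: "b \<in> Field r" "s =o seg r b" by (rule ordLess_seg_cases)
  have "(b, a) \<in> r \<and> b \<noteq> a"
  proof (rule ccontr)
    assume "\<not> ((b, a) \<in> r \<and> b \<noteq> a)"
    moreover have "Total r" "Refl r"
      using r by (auto simp: order_on_defs)
    ultimately consider "a = b" | "(a, b) \<in> r" "a \<noteq> b"
      using a b(1) by (auto simp: total_on_def)
    then have "seg r a \<le>o seg r b"
    proof cases
      case 1
      then show ?thesis
        using Well_order_Restr[OF r] ordLeq_reflexive by auto
    next
      case 2
      then show ?thesis by (intro ordLess_imp_ordLeq seg_less_seg[OF r])
    qed
    then have "s <o seg r b" by (rule ordLess_ordLeq_trans[OF s])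
    then show False using b(2) not_ordLess_ordIso by blast
  qed
  then show thesis using b(2) that by blast
qed

section \<open>Cantor-Bendixson derivatives\<close>

lemma derived_set_mono: "A \<subseteq> B \<Longrightarrow> derived_set A \<subseteq> derived_set B"
  by (auto simp: derived_set_def intro: islimpt_subset)

lemma derived_set_subset: "derived_set A \<subseteq> A"
  by (auto simp: derived_set_def)

lemma closed_derived_set: "closed A \<Longrightarrow> closed (derived_set (A :: 'a::t1_space set))"
  unfolding closed_limpt[of "derived_set A"]
proof (intro allI impI)
  assume A: "closed A"
  fix x assume x: "x islimpt derived_set A"
  have "x islimpt A"
  proof (rule islimptI)
    fix T assume T: "x \<in> T" "open T"
    then obtain y where y: "y \<in> derived_set A" "y \<in> T" "y \<noteq> x"
      by (rule islimptE[OF x])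
    have "y \<in> T - {x}" "open (T - {x})"
      using T y by auto
    moreover have "y islimpt A"
      using y(1) by (simp add: derived_set_def)
    ultimately obtain z where "z \<in> A" "z \<in> T - {x}" "z \<noteq> y"
      by (meson islimptE)
    then show "\<exists>z\<in>A. z \<in> T \<and> z \<noteq> x" by blast
  qed
  then show "x \<in> derived_set A"
    using A by (auto simp: derived_set_def closed_limpt)
qed

lemma derived_set_Un:
  assumes "closed A" "closed B"
  shows "derived_set (A \<union> B) \<subseteq> derived_set A \<union> derived_set B"
  using assms by (auto simp: derived_set_def islimpt_Un closed_limpt)

text \<open>A single recursion equation that covers zero, successors and limits at once.\<close>

lemma cb_derivative_rec:
  fixes r :: "'o rel"
  assumes "Well_order r"
  shows "cb_derivative X r = {x \<in> X. \<forall>s :: 'o rel. s <o r \<longrightarrow> x \<in> derived_set (cb_derivative X s)}"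
  using assms
proof (induction r rule: wf_induct_rule[OF wf_ordLess])
  case (1 r)
  let ?R = "\<lambda>r. {x \<in> X. \<forall>s :: 'o rel. s <o r \<longrightarrow> x \<in> derived_set (cb_derivative X s)}"
  note r = 1(2)
  have IH: "cb_derivative X s = ?R s" if "s <o r" for s :: "'o rel"
    using 1(1)[OF that] that by (auto simp: ordLess_def)
  have wo: "wo_rel r" using r by (simp add: wo_rel_def)
  consider "Field r = {}" | m where "Field r \<noteq> {}" "is_last r m"
    | "Field r \<noteq> {}" "\<nexists>m. is_last r m" by blast
  then show ?case
  proof cases
    case 1
    then have "\<not> s <o r" for s :: "'o rel"
      by (metis empty_iff ordLess_seg_cases)
    then show ?thesis using 1 r by (simp add: cb_derivative.simps[of X r])
  next
    case (2 m)
    have the: "(THE m. is_last r m) = m"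
      using 2(2) wo_rel.ANTISYM[OF wo] by (intro the_equality) (auto simp: is_last_def antisym_def)
    have m: "m \<in> Field r" using 2(2) by (simp add: is_last_def)
    have cb: "cb_derivative X r = derived_set (cb_derivative X (seg r m))"
      using 2 r the by (subst cb_derivative.simps) auto
    \<comment> \<open>Each \<open>s\<close> below \<open>r\<close> is at most the predecessor
      \<open>seg r m\<close>, so its recursion imposes fewer conditions. Hence the condition at
      \<open>seg r m\<close> implies all the others.\<close>
    have "cb_derivative X (seg r m) \<subseteq> cb_derivative X s" if s: "s <o r" for s :: "'o rel"
    proof -
      obtain a where a: "a \<in> Field r" "s =o seg r a" using s by (rule ordLess_seg_cases)
      have "s \<le>o seg r m"
      proof (cases "a = m")
        case True
        then show ?thesis using a(2) ordIso_imp_ordLeq by blast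
      next
        case False
        then have "seg r a <o seg r m"
          using a(1) 2(2) by (intro seg_less_seg[OF r]) (auto simp: is_last_def)
        then show ?thesis
          using a(2) ordIso_ordLess_trans ordLess_imp_ordLeq by blast
      qed
      then have "t <o seg r m" if "t <o s" for t :: "'o rel"
        using that ordLess_ordLeq_trans by blast
      then show ?thesis
        unfolding IH[OF s] IH[OF seg_less[OF r m]] by blast
    qed
    then have "derived_set (cb_derivative X (seg r m)) \<subseteq> derived_set (cb_derivative X s)"
      if "s <o r" for s :: "'o rel"
      using that by (intro derived_set_mono)
    moreover have "cb_derivative X (seg r m) \<subseteq> X"
      using IH[OF seg_less[OF r m]] by auto
    ultimately show ?thesis
      unfolding cb using seg_less[OF r m] derived_set_subset by blast
  next
    case 3
    have cb: "cb_derivative X r = (\<Inter>s\<in>{s :: 'o rel. s <o r}. cb_derivative X s)"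
      using 3 r by (subst cb_derivative.simps) auto
    obtain a where a: "a \<in> Field r" using 3 by blast
    have sub: "cb_derivative X r \<subseteq> X"
      unfolding cb using IH[OF seg_less[OF r a]] seg_less[OF r a] by blast
    have "cb_derivative X r \<subseteq> derived_set (cb_derivative X s)" if s: "s <o r" for s :: "'o rel"
    proof -
      obtain a where a: "a \<in> Field r" "s =o seg r a" using s by (rule ordLess_seg_cases)
      \<comment> \<open>Without a last element there is room for a segment strictly between
        \<open>s\<close> and \<open>r\<close>. Its derivative occurs in the intersection and, by the
        recursion, lies in the derived set required at \<open>s\<close>.\<close>
      obtain b where b: "b \<in> Field r" "(b, a) \<notin> r"
        using 3(2) a(1) by (auto simp: is_last_def)
      have "(a, b) \<in> r" "a \<noteq> b"
        using a(1) b wo_rel.TOTAL[OF wo] wo_rel.REFL[OF wo]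
        unfolding total_on_def refl_on_def by metis+
      from seg_less_seg[OF r this] have "s <o seg r b"
        using a(2) ordIso_ordLess_trans by blast
      then show ?thesis
        unfolding cb using IH[OF seg_less[OF r b(1)]] seg_less[OF r b(1)] by blast
    qed
    moreover have "?R r \<subseteq> cb_derivative X r"
      unfolding cb using derived_set_subset by blast
    ultimately show ?thesis using sub by blast
  qed
qed

lemma cb_derivative_subset: "Well_order r \<Longrightarrow> cb_derivative X r \<subseteq> X"
  by (subst cb_derivative_rec) auto

lemma cb_derivative_anti:
  fixes r s :: "'o rel"
  assumes "s \<le>o r"
  shows "cb_derivative X r \<subseteq> cb_derivative X s"
proof -
  have wo: "Well_order r" "Well_order s"
    using assms by (auto simp: ordLeq_def)
  have "t <o r" if "t <o s" for t :: "'o rel"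
    using that assms by (rule ordLess_ordLeq_trans)
  then show ?thesis
    unfolding cb_derivative_rec[OF wo(1)] cb_derivative_rec[OF wo(2)] by blast
qed

lemma cb_derivative_cong:
  fixes r s :: "'o rel"
  assumes "s =o r"
  shows "cb_derivative X s = cb_derivative X r"
  using cb_derivative_anti[OF ordIso_imp_ordLeq[OF assms]]
    cb_derivative_anti[OF ordIso_imp_ordLeq[OF ordIso_symmetric[OF assms]]] by (rule equalityI[rotated])

lemma cb_derivative_less:
  fixes r s :: "'o rel"
  assumes "s <o r"
  shows "cb_derivative X r \<subseteq> derived_set (cb_derivative X s)"
  using assms by (subst cb_derivative_rec) (auto simp: ordLess_def)

text \<open>Turns the quantifier over relations into one over elements of \<open>r\<close>, so that
  the recursion can be read off an explicit order such as \<open>omega_pow r\<close>.\<close>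

lemma cb_derivative_seg:
  fixes r :: "'o rel"
  assumes r: "Well_order r" and a: "a \<in> Field r"
  shows "cb_derivative X (seg r a) =
    {x \<in> X. \<forall>b. (b, a) \<in> r \<and> b \<noteq> a \<longrightarrow> x \<in> derived_set (cb_derivative X (seg r b))}"
proof -
  have "(\<forall>s :: 'o rel. s <o seg r a \<longrightarrow> x \<in> derived_set (cb_derivative X s)) \<longleftrightarrow>
      (\<forall>b. (b, a) \<in> r \<and> b \<noteq> a \<longrightarrow> x \<in> derived_set (cb_derivative X (seg r b)))" (is "?L \<longleftrightarrow> ?R") for x
  proof
    show ?R if ?L
    proof (intro allI impI)
      fix b assume "(b, a) \<in> r \<and> b \<noteq> a"
      then show "x \<in> derived_set (cb_derivative X (seg r b))"
        using that seg_less_seg[OF r, of b a] by simp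
    qed
    show ?L if R: ?R
    proof (intro allI impI)
      fix s :: "'o rel" assume "s <o seg r a"
      then obtain b where b: "(b, a) \<in> r" "b \<noteq> a" "s =o seg r b"
        by (rule ordLess_seg_seg_cases[OF r a])
      then show "x \<in> derived_set (cb_derivative X s)"
        using R cb_derivative_cong[OF b(3)] by metis
    qed
  qed
  then show ?thesis
    by (subst cb_derivative_rec[OF Well_order_Restr[OF r]]) simp
qed

lemma cb_derivative_mono:
  fixes r :: "'o rel"
  assumes "Well_order r" "X \<subseteq> Y"
  shows "cb_derivative X r \<subseteq> cb_derivative Y r"
  using assms(1)
proof (induction r rule: wf_induct_rule[OF wf_ordLess])
  case (1 r)
  have "derived_set (cb_derivative X s) \<subseteq> derived_set (cb_derivative Y s)" if "s <o r" for s :: "'o rel"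
    using that 1(1)[OF that] by (intro derived_set_mono) (auto simp: ordLess_def)
  then show ?case
    unfolding cb_derivative_rec[OF 1(2)] using assms(2) by blast
qed

lemma closed_cb_derivative:
  fixes X :: "'a::t1_space set" and r :: "'o rel"
  assumes "Well_order r" "closed X"
  shows "closed (cb_derivative X r)"
  using assms(1)
proof (induction r rule: wf_induct_rule[OF wf_ordLess])
  case (1 r)
  have "cb_derivative X r = X \<inter> (\<Inter>s\<in>{s :: 'o rel. s <o r}. derived_set (cb_derivative X s))"
    by (subst cb_derivative_rec[OF 1(2)]) auto
  also have "closed \<dots>"
    using 1(1) assms(2) by (intro closed_Int closed_INT ballI closed_derived_set) (auto simp: ordLess_def)
  finally show ?case .
qed

text \<open>A point of \<open>X \<inter> Y\<close> outside both derivatives violates the recursion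
  for \<open>X\<close> at some \<open>s\<close> and for \<open>Y\<close> at some \<open>t\<close>.
  At the larger of the two it violates both, against the induction hypothesis and
  \<open>derived_set_Un\<close>.\<close>

lemma cb_derivative_Un:
  fixes X Y :: "'a::t1_space set" and r :: "'o rel"
  assumes "Well_order r" "closed X" "closed Y"
  shows "cb_derivative (X \<union> Y) r \<subseteq> cb_derivative X r \<union> cb_derivative Y r"
  using assms(1)
proof (induction r rule: wf_induct_rule[OF wf_ordLess])
  case (1 r)
  have *: "derived_set (cb_derivative (X \<union> Y) s) \<subseteq>
      derived_set (cb_derivative X s) \<union> derived_set (cb_derivative Y s)" if "s <o r" for s :: "'o rel"
  proof -
    have s: "Well_order s" using that by (auto simp: ordLess_def)
    have "derived_set (cb_derivative (X \<union> Y) s) \<subseteq>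
        derived_set (cb_derivative X s \<union> cb_derivative Y s)"
      by (rule derived_set_mono[OF 1(1)[OF that s]])
    also have "\<dots> \<subseteq> derived_set (cb_derivative X s) \<union> derived_set (cb_derivative Y s)"
      by (intro derived_set_Un closed_cb_derivative s assms)
    finally show ?thesis .
  qed
  show ?case
  proof
    fix x assume x: "x \<in> cb_derivative (X \<union> Y) r"
    show "x \<in> cb_derivative X r \<union> cb_derivative Y r"
    proof (rule ccontr)
      assume nx: "x \<notin> cb_derivative X r \<union> cb_derivative Y r"
      have xs: "x \<in> derived_set (cb_derivative X s) \<union> derived_set (cb_derivative Y s)" if "s <o r" for s :: "'o rel"
        using cb_derivative_less[OF that] x *[OF that] by blast
      have Xs: "derived_set (cb_derivative Z s) \<subseteq> Z" if "s <o r" for s :: "'o rel" and Z :: "'a set"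
        using derived_set_subset cb_derivative_subset[of s Z] that by (auto simp: ordLess_def)
      have xXY: "x \<in> X \<union> Y" using cb_derivative_subset[OF 1(2)] x by blast
      obtain s :: "'o rel" where s: "x \<in> X \<Longrightarrow> s <o r \<and> x \<notin> derived_set (cb_derivative X s)"
        using nx by (subst (asm) cb_derivative_rec[OF 1(2)]) blast
      obtain t :: "'o rel" where t: "x \<in> Y \<Longrightarrow> t <o r \<and> x \<notin> derived_set (cb_derivative Y t)"
        using nx by (subst (asm) (2) cb_derivative_rec[OF 1(2)]) blast
      show False
      proof (cases "x \<in> X \<and> x \<in> Y")
        case False
        then show False using xXY s t xs Xs by blast
      next
        case True
        then have s': "s <o r" "x \<notin> derived_set (cb_derivative X s)"
          and t': "t <o r" "x \<notin> derived_set (cb_derivative Y t)" using s t by auto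
        have wo: "Well_order s" "Well_order t" using s' t' by (auto simp: ordLess_def)
        from ordLeq_total[OF wo] show False
        proof
          assume "s \<le>o t"
          then show False
            using derived_set_mono[OF cb_derivative_anti[of s t X]] xs[OF t'(1)] s' t' by blast
        next
          assume "t \<le>o s"
          then show False
            using derived_set_mono[OF cb_derivative_anti[of t s Y]] xs[OF s'(1)] s' t' by blast
        qed
      qed
    qed
  qed
qed

lemma perfect_subset_cb_derivative:
  fixes r :: "'o rel"
  assumes "Well_order r" "S \<subseteq> derived_set S" "S \<subseteq> X"
  shows "S \<subseteq> cb_derivative X r"
  using assms(1)
proof (induction r rule: wf_induct_rule[OF wf_ordLess])
  case (1 r)
  have "S \<subseteq> derived_set (cb_derivative X s)" if "s <o r" for s :: "'o rel"
  proof -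
    have "Well_order s" using that by (auto simp: ordLess_def)
    from derived_set_mono[OF 1(1)[OF that this]] show ?thesis
      using assms(2) by (rule order_trans[rotated])
  qed
  then show ?case
    unfolding cb_derivative_rec[OF 1(2)] using assms(3) by blast
qed

section \<open>The ordinal power\<close>

lemma finite_has_maximum:
  assumes "Total r" "Refl r" "trans r" "finite J" "J \<noteq> {}" "J \<subseteq> Field r"
  obtains m where "m \<in> J" "\<And>x. x \<in> J \<Longrightarrow> (x, m) \<in> r"
proof -
  have "\<exists>m\<in>J. \<forall>x\<in>J. (x, m) \<in> r"
    using assms(4-6)
  proof (induction J rule: finite_ne_induct)
    case (singleton x)
    then show ?case using assms(2) by (auto simp: refl_on_def)
  next
    case (insert x J)
    then obtain m where m: "m \<in> J" "\<forall>x\<in>J. (x, m) \<in> r" by auto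
    have F: "m \<in> Field r" "x \<in> Field r" using m(1) insert.prems by auto
    have mx: "(x, x) \<in> r"
      using assms(2) F by (auto simp: refl_on_def)
    have "(x, m) \<in> r \<or> (m, x) \<in> r"
      using assms(1) F mx by (cases "x = m") (auto simp: total_on_def)
    then show ?case
    proof (elim disjE)
      assume "(x, m) \<in> r"
      then show ?thesis using m by auto
    next
      assume "(m, x) \<in> r"
      then have "\<forall>y\<in>insert x J. (y, x) \<in> r"
        using m(2) mx assms(3) by (auto dest: transD)
      then show ?thesis by auto
    qed
  qed
  then show thesis using that by blast
qed

definition fin_supp :: "'o rel \<Rightarrow> ('o \<Rightarrow> nat) \<Rightarrow> bool" where
  "fin_supp r f \<longleftrightarrow> finite {x. f x \<noteq> 0} \<and> {x. f x \<noteq> 0} \<subseteq> Field r"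

definition lex_less :: "'o rel \<Rightarrow> ('o \<Rightarrow> nat) \<Rightarrow> ('o \<Rightarrow> nat) \<Rightarrow> bool" where
  "lex_less r f g \<longleftrightarrow> (\<exists>z\<in>Field r. f z < g z \<and> (\<forall>y. (z, y) \<in> r \<and> y \<noteq> z \<longrightarrow> f y = g y))"

lemma omega_pow_iff:
  "(f, g) \<in> omega_pow r \<longleftrightarrow> fin_supp r f \<and> fin_supp r g \<and> (f = g \<or> lex_less r f g)"
  by (auto simp: omega_pow_def fin_supp_def lex_less_def Let_def)

lemma Field_omega_pow: "Field (omega_pow r) = Collect (fin_supp r)"
  by (auto simp: Field_def omega_pow_iff)

lemma lex_less_irrefl: "\<not> lex_less r f f"
  by (auto simp: lex_less_def)

context
  fixes r :: "'o rel"
  assumes wo: "Well_order r"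
begin

lemma linear_facts: "Total r" "Refl r" "trans r" "antisym r" "wf (r - Id)"
  using wo by (auto simp: order_on_defs well_order_on_def)

lemma linear_cases:
  assumes "x \<in> Field r" "y \<in> Field r"
  obtains "x = y" | "(x, y) \<in> r" "x \<noteq> y" | "(y, x) \<in> r" "x \<noteq> y"
  using linear_facts(1) assms by (auto simp: total_on_def)

lemma strict_trans: "(x, y) \<in> r \<Longrightarrow> (y, z) \<in> r \<Longrightarrow> x \<noteq> y \<Longrightarrow> x \<noteq> z"
  using linear_facts(4) by (auto simp: antisym_def)

lemma lex_less_trans:
  assumes "lex_less r f g" "lex_less r g h"
  shows "lex_less r f h"
proof -
  obtain z where z: "z \<in> Field r" "f z < g z" "\<And>y. (z, y) \<in> r \<Longrightarrow> y \<noteq> z \<Longrightarrow> f y = g y"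
    using assms(1) by (auto simp: lex_less_def)
  obtain w where w: "w \<in> Field r" "g w < h w" "\<And>y. (w, y) \<in> r \<Longrightarrow> y \<noteq> w \<Longrightarrow> g y = h y"
    using assms(2) by (auto simp: lex_less_def)
  from z(1) w(1) show ?thesis
  proof (cases rule: linear_cases)
    case 1
    then show ?thesis
      using z w unfolding lex_less_def by (intro bexI[of _ z]) auto
  next
    case 2
    have "f y = h y" if "(w, y) \<in> r" "y \<noteq> w" for y
      using that 2 z(3)[of y] w(3)[of y] linear_facts(3) strict_trans[of z w y] by (auto dest: transD)
    moreover have "f w < h w" using z(3)[of w] w(2) 2 by simp
    ultimately show ?thesis
      using w(1) unfolding lex_less_def by (intro bexI[of _ w]) auto
  next
    case 3
    have "f y = h y" if "(z, y) \<in> r" "y \<noteq> z" for y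
      using that 3 z(3)[of y] w(3)[of y] linear_facts(3) strict_trans[of w z y] by (auto dest: transD)
    moreover have "f z < h z" using w(3)[of z] z(2) 3 by simp
    ultimately show ?thesis
      using z(1) unfolding lex_less_def by (intro bexI[of _ z]) auto
  qed
qed

lemma lex_less_total:
  assumes "fin_supp r f" "fin_supp r g" "f \<noteq> g"
  shows "lex_less r f g \<or> lex_less r g f"
proof -
  let ?D = "{x. f x \<noteq> g x}"
  have "?D \<subseteq> {x. f x \<noteq> 0} \<union> {x. g x \<noteq> 0}" by auto
  then have D: "finite ?D" "?D \<subseteq> Field r" "?D \<noteq> {}"
    using assms by (auto simp: fin_supp_def intro: finite_subset)
  obtain z where z: "z \<in> ?D" "\<And>x. x \<in> ?D \<Longrightarrow> (x, z) \<in> r"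
    by (rule finite_has_maximum[OF linear_facts(1-3) D(1,3,2)]) blast
  have "f y = g y" if "(z, y) \<in> r" "y \<noteq> z" for y
    using z(2)[of y] that linear_facts(4) by (auto simp: antisym_def)
  moreover have "z \<in> Field r" using z D by blast
  moreover have "f z < g z \<or> g z < f z" using z(1) by auto
  ultimately show ?thesis
    unfolding lex_less_def by metis
qed

text \<open>Functions of finite support are multisets, and the order at the largest difference is the
  multiset order.\<close>

lemma wf_omega_pow: "wf (omega_pow r - Id)"
proof (rule wf_subset)
  show "wf (inv_image (mult (r - Id)) Abs_multiset)"
    by (intro wf_inv_image wf_mult linear_facts)
  show "omega_pow r - Id \<subseteq> inv_image (mult (r - Id)) Abs_multiset"
  proof (rule subrelI)
    fix f g assume "(f, g) \<in> omega_pow r - Id"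
    then have fg: "fin_supp r f" "fin_supp r g" "lex_less r f g"
      by (auto simp: omega_pow_iff)
    obtain z where z: "z \<in> Field r" "f z < g z" "\<And>y. (z, y) \<in> r \<Longrightarrow> y \<noteq> z \<Longrightarrow> f y = g y"
      using fg(3) by (auto simp: lex_less_def)
    let ?f = "Abs_multiset f" and ?g = "Abs_multiset g"
    have cnt: "count ?f = f" "count ?g = g"
      using fg(1,2) by (auto simp: fin_supp_def Abs_multiset_inverse)
    have zJ: "z \<in># ?g - ?f"
      using z(2) cnt by (simp add: in_diff_count)
    have "(?f \<inter># ?g + (?f - ?g), ?f \<inter># ?g + (?g - ?f)) \<in> mult (r - Id)"
    proof (rule one_step_implies_mult)
      show "?g - ?f \<noteq> {#}" using zJ by auto
      show "\<forall>k\<in>#?f - ?g. \<exists>j\<in>#?g - ?f. (k, j) \<in> r - Id"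
      proof (intro ballI bexI[OF _ zJ])
        fix k assume "k \<in># ?f - ?g"
        then have k: "g k < f k" using cnt by (simp add: in_diff_count)
        then have "k \<in> Field r" using fg(1) by (auto simp: fin_supp_def)
        from this z(1) show "(k, z) \<in> r - Id"
          by (cases rule: linear_cases) (use k z in auto)
      qed
    qed
    moreover have "?f \<inter># ?g + (?f - ?g) = ?f" "?f \<inter># ?g + (?g - ?f) = ?g"
      by (auto simp: multiset_eq_iff)
    ultimately show "(f, g) \<in> inv_image (mult (r - Id)) Abs_multiset" by auto
  qed
qed

lemma Well_order_omega_pow: "Well_order (omega_pow r)"
  unfolding well_order_on_def linear_order_on_def partial_order_on_def preorder_on_def
proof (intro conjI wf_omega_pow)
  show "omega_pow r \<subseteq> Field (omega_pow r) \<times> Field (omega_pow r)"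
    by (auto simp: Field_def)
  show "Refl (omega_pow r)"
    by (auto simp: refl_on_def Field_omega_pow omega_pow_iff)
  show "trans (omega_pow r)"
    by (auto simp: trans_def omega_pow_iff intro: lex_less_trans)
  show "antisym (omega_pow r)"
    unfolding antisym_def omega_pow_iff by (metis lex_less_trans lex_less_irrefl)
  show "Total (omega_pow r)"
    using lex_less_total by (auto simp: total_on_def Field_omega_pow omega_pow_iff)
qed

text \<open>\<open>f\<close> is read as the Cantor normal form of the ordinal with coefficient
  \<open>f x\<close> at \<omega>^x, which is the order type of the functions below
  \<open>f\<close>.\<close>

definition cb_at :: "'a::topological_space set \<Rightarrow> ('o \<Rightarrow> nat) \<Rightarrow> 'a set" where
  "cb_at X f = cb_derivative X (seg (omega_pow r) f)"

lemma cb_at_rec: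
  assumes "fin_supp r f"
  shows "cb_at X f = {x \<in> X. \<forall>g. fin_supp r g \<and> lex_less r g f \<longrightarrow> x \<in> derived_set (cb_at X g)}"
proof -
  have "f \<in> Field (omega_pow r)" using assms by (simp add: Field_omega_pow)
  from cb_derivative_seg[OF Well_order_omega_pow this, of X] show ?thesis
    using assms lex_less_irrefl by (auto simp: cb_at_def omega_pow_iff)
qed

lemma cb_at_subset: "cb_at X f \<subseteq> X"
  unfolding cb_at_def by (intro cb_derivative_subset Well_order_Restr Well_order_omega_pow)

lemma cb_at_anti:
  assumes "fin_supp r f" "fin_supp r g" "lex_less r g f"
  shows "cb_at X f \<subseteq> cb_at X g"
  using assms derived_set_subset by (subst cb_at_rec) auto

text \<open>Exponents in \<open>f\<close> are at least \<open>z\<close> and exponents in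
  \<open>g\<close> at most \<open>z\<close>, so no term is absorbed and the ordinal sum of the two
  normal forms is their pointwise sum.\<close>

lemma cb_at_add:
  assumes z: "\<And>y. f y \<noteq> 0 \<Longrightarrow> (z, y) \<in> r" "\<And>y. g y \<noteq> 0 \<Longrightarrow> (y, z) \<in> r" "z \<in> Field r"
    and fg: "fin_supp r f" "fin_supp r g"
  shows "cb_at X (\<lambda>x. f x + g x) = cb_at (cb_at X f) g"
  using z(2) fg(2)
proof (induction g rule: wf_induct_rule[OF wf_omega_pow])
  case (1 g)
  note g = 1(2,3)
  have add: "fin_supp r (\<lambda>x. f x + h x)" if "fin_supp r h" for h
  proof -
    have "{x. f x + h x \<noteq> 0} = {x. f x \<noteq> 0} \<union> {x. h x \<noteq> 0}" by auto
    then show ?thesis using that fg(1) by (auto simp: fin_supp_def)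
  qed
  have below: "(y, z) \<in> r" if h: "lex_less r h g" "fin_supp r h" "h y \<noteq> 0" for h y
  proof -
    obtain w where w: "w \<in> Field r" "h w < g w" "\<And>y. (w, y) \<in> r \<Longrightarrow> y \<noteq> w \<Longrightarrow> h y = g y"
      using h(1) by (auto simp: lex_less_def)
    have wz: "(w, z) \<in> r" using g(1)[of w] w(2) by simp
    have "y \<in> Field r" using h by (auto simp: fin_supp_def)
    from this w(1) show ?thesis
    proof (cases rule: linear_cases)
      case 1
      then show ?thesis using wz by simp
    next
      case 2
      then show ?thesis using wz linear_facts(3) by (auto dest: transD)
    next
      case 3
      then have "h y = g y" using w(3) by auto
      then show ?thesis using g(1)[of y] h(3) by simp
    qed
  qed
  have IH: "cb_at X (\<lambda>x. f x + h x) = cb_at (cb_at X f) h" if h: "lex_less r h g" "fin_supp r h" for h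
    using h g(2) below[OF h] lex_less_irrefl by (intro 1(1)) (auto simp: omega_pow_iff)
  show ?case
  proof (intro equalityI subsetI)
    fix x assume x: "x \<in> cb_at X (\<lambda>x. f x + g x)"
    have "cb_at X (\<lambda>x. f x + g x) \<subseteq> cb_at X f"
    proof (cases "\<forall>x. g x = 0")
      case False
      then have "g \<noteq> (\<lambda>x. 0)" by auto
      moreover have "fin_supp r (\<lambda>x. 0)" by (simp add: fin_supp_def)
      ultimately have "lex_less r (\<lambda>x. 0) g"
        using lex_less_total[OF g(2), of "\<lambda>x. 0"] by (auto simp: lex_less_def)
      then have "lex_less r f (\<lambda>x. f x + g x)"
        by (auto simp: lex_less_def)
      then show ?thesis by (intro cb_at_anti fg add g)
    qed auto
    then have "x \<in> cb_at X f" using x by blast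
    moreover have "x \<in> derived_set (cb_at (cb_at X f) h)" if h: "fin_supp r h" "lex_less r h g" for h
    proof -
      have "lex_less r (\<lambda>x. f x + h x) (\<lambda>x. f x + g x)"
        using h(2) by (auto simp: lex_less_def)
      then show ?thesis
        using x add[OF h(1)] unfolding cb_at_rec[OF add[OF g(2)]] IH[OF h(2,1), symmetric] by blast
    qed
    ultimately show "x \<in> cb_at (cb_at X f) g"
      unfolding cb_at_rec[OF g(2)] by blast
  next
    fix x assume x: "x \<in> cb_at (cb_at X f) g"
    then have xf: "x \<in> cb_at X f" using cb_at_subset by blast
    \<comment> \<open>If \<open>h\<close> is below \<open>f\<close>, membership in
      \<open>cb_at X f\<close> suffices. Otherwise \<open>h\<close> splits as \<open>f\<close> plus
      a remainder below \<open>g\<close>, to which the induction hypothesis applies.\<close>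
    have "x \<in> derived_set (cb_at X h)" if h: "fin_supp r h" "lex_less r h (\<lambda>x. f x + g x)" for h
    proof (cases "lex_less r h f")
      case True
      then show ?thesis using xf h(1) unfolding cb_at_rec[OF fg(1)] by blast
    next
      case False
      obtain p where p: "p \<in> Field r" "h p < f p + g p"
          "\<And>y. (p, y) \<in> r \<Longrightarrow> y \<noteq> p \<Longrightarrow> h y = f y + g y"
        using h(2) by (auto simp: lex_less_def)
      have ge: "\<not> h y < f y" if "\<And>v. (y, v) \<in> r \<Longrightarrow> v \<noteq> y \<Longrightarrow> h v \<le> f v" for y
      proof
        assume hy: "h y < f y"
        consider "f = h" | "lex_less r f h"
          using False lex_less_total[OF fg(1) h(1)] by blast
        then show False
        proof cases
          case 2
          then obtain q where q: "q \<in> Field r" "f q < h q"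
              "\<And>y. (q, y) \<in> r \<Longrightarrow> y \<noteq> q \<Longrightarrow> f y = h y"
            by (auto simp: lex_less_def)
          have "y \<in> Field r" using hy fg(1) by (auto simp: fin_supp_def)
          from this q(1) show False
            by (cases rule: linear_cases) (use q(2) q(3)[of y] that[of q] hy in auto)
        qed (use hy in auto)
      qed
      have g0: "g y = 0" if "(z, y) \<in> r" "y \<noteq> z" for y
        using g(1)[of y] that linear_facts(4) by (auto simp: antisym_def)
      have f0: "f y = 0" if "(y, z) \<in> r" "y \<noteq> z" for y
        using z(1)[of y] that linear_facts(4) by (auto simp: antisym_def)
      \<comment> \<open>Above \<open>z\<close> the function \<open>g\<close> vanishes, so a decisive
        difference there would put \<open>h\<close> below \<open>f\<close>.\<close>
      have pz: "(p, z) \<in> r"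
      proof (rule ccontr)
        assume "(p, z) \<notin> r"
        then have zp: "(z, p) \<in> r" "p \<noteq> z"
          using linear_cases[OF z(3) p(1)] linear_facts(2) p(1) by (auto simp: refl_on_def)
        have "h p < f p" using p(2) g0[OF zp] by simp
        moreover have "h v \<le> f v" if v: "(p, v) \<in> r" "v \<noteq> p" for v
        proof -
          have "(z, v) \<in> r" using zp v linear_facts(3) by (auto dest: transD)
          moreover have "v \<noteq> z" using strict_trans[OF zp(1) v(1)] zp(2) by auto
          ultimately show ?thesis using p(3)[OF v] g0 by simp
        qed
        ultimately show False using ge by blast
      qed
      have above: "h y = f y" if "(z, y) \<in> r" "y \<noteq> z" for y
      proof -
        have "(p, y) \<in> r" "y \<noteq> p"
          using that pz linear_facts(3,4) by (auto dest: transD simp: antisym_def)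
        then show ?thesis using p(3) g0[OF that] by simp
      qed
      \<comment> \<open>Truncated subtraction recovers \<open>h\<close> from \<open>f\<close> and
        \<open>?g\<close> only under this inequality. Below \<open>z\<close> it holds because
        \<open>f\<close> vanishes, above \<open>z\<close> because \<open>h\<close> and
        \<open>f\<close> agree, and at \<open>z\<close> by \<open>ge\<close>.\<close>
      have le: "f y \<le> h y" for y
      proof (cases "f y = 0")
        case False
        then have zy: "(z, y) \<in> r" using z(1) by blast
        show ?thesis
        proof (cases "y = z")
          case True
          then show ?thesis using ge[of z] above by fastforce
        qed (use above zy in auto)
      qed simp
      let ?g = "\<lambda>x. h x - f x"
      have "{x. h x - f x \<noteq> 0} \<subseteq> {x. h x \<noteq> 0}" by auto
      then have sg: "fin_supp r ?g"
        using h(1) unfolding fin_supp_def by (meson finite_subset order_trans)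
      have lg: "lex_less r ?g g"
        unfolding lex_less_def using p le by (intro bexI[of _ p]) (auto simp: less_diff_conv2)
      have "(\<lambda>x. f x + ?g x) = h" using le by auto
      then have eq: "cb_at X h = cb_at (cb_at X f) ?g" using IH[OF lg sg] by simp
      show ?thesis
        unfolding eq using x sg lg cb_at_rec[OF g(2), of "cb_at X f"] by blast
    qed
    moreover have "x \<in> X" using xf cb_at_subset by blast
    ultimately show "x \<in> cb_at X (\<lambda>x. f x + g x)"
      unfolding cb_at_rec[OF add[OF g(2)]] by blast
  qed
qed

section \<open>Derivatives of order \<omega>^z * n\<close>

definition unit_at :: "'o \<Rightarrow> nat \<Rightarrow> 'o \<Rightarrow> nat" where
  "unit_at z n = (\<lambda>x. if x = z then n else 0)"

definition omega_derivative :: "'o \<Rightarrow> 'a::topological_space set \<Rightarrow> 'a set" where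
  "omega_derivative z X = cb_at X (unit_at z 1)"

lemma fin_supp_unit_at: "z \<in> Field r \<Longrightarrow> fin_supp r (unit_at z n)"
  by (auto simp: fin_supp_def unit_at_def)

lemma fin_supp_zero: "fin_supp r (\<lambda>x. 0)"
  by (simp add: fin_supp_def)

lemma cb_at_zero: "cb_at X (\<lambda>x. 0) = X"
  by (subst cb_at_rec[OF fin_supp_zero]) (auto simp: lex_less_def)

lemma omega_derivative_funpow:
  assumes "z \<in> Field r"
  shows "(omega_derivative z ^^ n) X = cb_at X (unit_at z n)"
proof (induction n)
  case 0
  then show ?case by (simp add: unit_at_def cb_at_zero)
next
  case (Suc n)
  have "(z, z) \<in> r" using assms linear_facts(2) by (auto simp: refl_on_def)
  then have "cb_at X (\<lambda>x. unit_at z n x + unit_at z 1 x) = cb_at (cb_at X (unit_at z n)) (unit_at z 1)"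
    using assms by (intro cb_at_add[of _ z] fin_supp_unit_at) (auto simp: unit_at_def split: if_splits)
  moreover have "(\<lambda>x. unit_at z n x + unit_at z 1 x) = unit_at z (Suc n)"
    by (auto simp: unit_at_def)
  ultimately show ?case
    using Suc by (simp add: omega_derivative_def)
qed

text \<open>With \<open>z\<close> the leading exponent, raising its coefficient by one exceeds all
  of \<open>f\<close>. So every nonzero order is dominated by a multiple of some \<omega>^z.\<close>

lemma lex_less_leading:
  assumes "fin_supp r f" "f \<noteq> (\<lambda>x. 0)"
  obtains z where "z \<in> Field r" "f z \<noteq> 0" "lex_less r f (unit_at z (Suc (f z)))"
proof -
  let ?D = "{x. f x \<noteq> 0}"
  have D: "finite ?D" "?D \<noteq> {}" "?D \<subseteq> Field r"
    using assms by (auto simp: fin_supp_def)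
  obtain z where z: "z \<in> ?D" "\<And>x. x \<in> ?D \<Longrightarrow> (x, z) \<in> r"
    by (rule finite_has_maximum[OF linear_facts(1-3) D]) blast
  have "f y = 0" if "(z, y) \<in> r" "y \<noteq> z" for y
    using z(2)[of y] that linear_facts(4) by (auto simp: antisym_def)
  then have "lex_less r f (unit_at z (Suc (f z)))"
    unfolding lex_less_def using z D by (intro bexI[of _ z]) (auto simp: unit_at_def)
  then show thesis using that z(1) D(3) by auto
qed

lemma lex_less_unit_at_unit_at:
  assumes "z \<in> Field r" "(w, z) \<in> r" "w \<noteq> z"
  shows "lex_less r (unit_at w k) (unit_at z 1)"
  unfolding lex_less_def using assms linear_facts(4)
  by (intro bexI[of _ z]) (auto simp: unit_at_def antisym_def)

lemma omega_derivative_subset_funpow: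
  assumes "z \<in> Field r" "(w, z) \<in> r" "w \<noteq> z"
  shows "omega_derivative z X \<subseteq> (omega_derivative w ^^ k) X"
proof -
  have w: "w \<in> Field r" using assms by (auto simp: Field_def)
  show ?thesis
    unfolding omega_derivative_funpow[OF w] omega_derivative_def
    by (intro cb_at_anti fin_supp_unit_at lex_less_unit_at_unit_at assms w)
qed

lemma lex_less_unit_at_top:
  assumes f: "fin_supp r f" "lex_less r f (unit_at z 1)" and fy: "f y \<noteq> 0"
  shows "(y, z) \<in> r \<and> y \<noteq> z"
proof -
  obtain p where p: "p \<in> Field r" "f p < unit_at z 1 p"
      "\<And>v. (p, v) \<in> r \<Longrightarrow> v \<noteq> p \<Longrightarrow> f v = unit_at z 1 v"
    using f(2) by (auto simp: lex_less_def)
  then have pz: "p = z" "f z = 0" by (auto simp: unit_at_def split: if_splits)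
  have "y \<in> Field r" using f(1) fy by (auto simp: fin_supp_def)
  from this p(1) show ?thesis
    by (cases rule: linear_cases) (use pz p(3)[of y] fy in \<open>auto simp: unit_at_def\<close>)
qed

text \<open>The least \<open>z\<close> is the exponent 0, and \<omega>^0 = 1: only the zero function
  lies below \<open>unit_at z 1\<close>.\<close>

lemma omega_derivative_least:
  assumes z: "z \<in> Field r" and least: "\<And>w. (w, z) \<in> r \<Longrightarrow> w = z"
  shows "omega_derivative z X = derived_set X"
proof -
  have "fin_supp r f \<and> lex_less r f (unit_at z 1) \<longleftrightarrow> f = (\<lambda>x. 0)" for f
  proof
    assume f: "fin_supp r f \<and> lex_less r f (unit_at z 1)"
    show "f = (\<lambda>x. 0)"
      using lex_less_unit_at_top[of f z] f least by blast
  next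
    assume "f = (\<lambda>x. 0)"
    moreover have "lex_less r (\<lambda>x. 0) (unit_at z 1)"
      unfolding lex_less_def using z linear_facts(4)
      by (intro bexI[of _ z]) (auto simp: unit_at_def)
    ultimately show "fin_supp r f \<and> lex_less r f (unit_at z 1)"
      using fin_supp_zero by simp
  qed
  then show ?thesis
    unfolding omega_derivative_def cb_at_rec[OF fin_supp_unit_at[OF z]]
    using derived_set_subset[of X] by (auto simp: cb_at_zero)
qed

lemma omega_derivative_subset_derived:
  assumes z: "z \<in> Field r"
  shows "omega_derivative z X \<subseteq> derived_set X"
proof -
  have "lex_less r (\<lambda>x. 0) (unit_at z 1)"
    unfolding lex_less_def using z linear_facts(4)
    by (intro bexI[of _ z]) (auto simp: unit_at_def)
  then show ?thesis
    unfolding omega_derivative_def cb_at_rec[OF fin_supp_unit_at[OF z]]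
    using fin_supp_zero cb_at_zero[of X] by auto
qed

lemma cb_at_closed: "closed X \<Longrightarrow> closed (cb_at (X :: 'a::t1_space set) f)"
  unfolding cb_at_def by (intro closed_cb_derivative Well_order_Restr Well_order_omega_pow)

text \<open>The element \<open>w0\<close> makes the exponent nonzero, so \<omega>^z is the limit of
  the \<omega>^w * k with w below z. The derivative of order \<omega>^z is then the intersection of
  a decreasing chain of closed subsets of a compact set, which is empty only if some member
  is.\<close>

lemma omega_derivative_empty_compact:
  fixes A :: "'a::t2_space set"
  assumes A: "compact A" and z: "z \<in> Field r" and w0: "(w0, z) \<in> r" "w0 \<noteq> z"
    and empty: "omega_derivative z A = {}"
  shows "\<exists>w k. (w, z) \<in> r \<and> w \<noteq> z \<and> (omega_derivative w ^^ k) A = {}"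
proof (rule ccontr)
  assume neg: "\<not> ?thesis"
  let ?I = "{f. fin_supp r f \<and> lex_less r f (unit_at z 1)}"
  \<comment> \<open>Cofinality of the \<omega>^w * k. The zero function has no leading exponent, so
    \<open>w0\<close> provides its bound.\<close>
  have below: "\<exists>w k. (w, z) \<in> r \<and> w \<noteq> z \<and> lex_less r f (unit_at w k)" if f: "f \<in> ?I" for f
  proof (cases "f = (\<lambda>x. 0)")
    case True
    have "lex_less r f (unit_at w0 1)"
      unfolding lex_less_def True using w0(1) by (intro bexI[of _ w0]) (auto simp: unit_at_def Field_def)
    then show ?thesis using w0 by blast
  next
    case False
    obtain w where w: "w \<in> Field r" "f w \<noteq> 0" "lex_less r f (unit_at w (Suc (f w)))"
      by (rule lex_less_leading[OF _ False]) (use f in auto)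
    then show ?thesis using lex_less_unit_at_top[of f z w] f by blast
  qed
  have ne: "cb_at A f \<noteq> {}" if f: "f \<in> ?I" for f
  proof -
    obtain w k where w: "(w, z) \<in> r" "w \<noteq> z" "lex_less r f (unit_at w k)"
      using below[OF f] by blast
    have wF: "w \<in> Field r" using w by (auto simp: Field_def)
    have "cb_at A (unit_at w k) \<subseteq> cb_at A f"
      using f w by (intro cb_at_anti fin_supp_unit_at wF) auto
    moreover have "cb_at A (unit_at w k) \<noteq> {}"
      using neg w(1,2) unfolding omega_derivative_funpow[OF wF, symmetric] by blast
    ultimately show ?thesis by blast
  qed
  have zero: "(\<lambda>x. 0) \<in> ?I"
    using z fin_supp_zero by (auto simp: lex_less_def unit_at_def)
  have "A \<inter> \<Inter>(cb_at A ` ?I) \<noteq> {}"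
  proof (rule compact_imp_fip[OF A])
    show "closed T" if "T \<in> cb_at A ` ?I" for T
      using that cb_at_closed[OF compact_imp_closed[OF A]] by auto
    fix F assume F: "finite F" "F \<subseteq> cb_at A ` ?I"
    then obtain J where J: "J \<subseteq> ?I" "finite J" "F = cb_at A ` J"
      by (meson finite_subset_image)
    show "A \<inter> \<Inter>F \<noteq> {}"
    proof (cases "J = {}")
      case True
      then show ?thesis using ne[OF zero] J by (simp add: cb_at_zero)
    next
      case False
      have wo': "Total (omega_pow r)" "Refl (omega_pow r)" "trans (omega_pow r)"
        using Well_order_omega_pow by (auto simp: order_on_defs well_order_on_def)
      obtain m where m: "m \<in> J" "\<And>x. x \<in> J \<Longrightarrow> (x, m) \<in> omega_pow r"
        by (rule finite_has_maximum[OF wo' J(2) False]) (use J(1) in \<open>auto simp: Field_omega_pow\<close>)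
      have "cb_at A m \<subseteq> cb_at A x" if "x \<in> J" for x
        using m(2)[OF that] by (auto simp: omega_pow_iff dest: cb_at_anti)
      then have "cb_at A m \<subseteq> A \<inter> \<Inter>F"
        using cb_at_subset J(3) by blast
      then show ?thesis using ne m(1) J(1) by blast
    qed
  qed
  then obtain x where x: "x \<in> A" "\<And>f. f \<in> ?I \<Longrightarrow> x \<in> cb_at A f" by blast
  \<comment> \<open>Some index of the chain lies beyond \<open>f\<close>, and membership there
    includes membership in the derived set at \<open>f\<close>.\<close>
  have "x \<in> derived_set (cb_at A f)" if f: "f \<in> ?I" for f
  proof -
    obtain w k where w: "(w, z) \<in> r" "w \<noteq> z" "lex_less r f (unit_at w k)"
      using below[OF f] by blast
    have wF: "w \<in> Field r" using w by (auto simp: Field_def)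
    have "x \<in> cb_at A (unit_at w k)"
      using lex_less_unit_at_unit_at[OF z w(1,2)] fin_supp_unit_at[OF wF] by (intro x) auto
    then show ?thesis
      using f w(3) by (subst (asm) cb_at_rec[OF fin_supp_unit_at[OF wF]]) auto
  qed
  then have "x \<in> omega_derivative z A"
    using x(1) unfolding omega_derivative_def cb_at_rec[OF fin_supp_unit_at[OF z]] by blast
  then show False using empty by blast
qed

lemma omega_derivative_funpow_subset: "(omega_derivative z ^^ n) X \<subseteq> X"
proof (induction n)
  case (Suc n)
  then show ?case
    using order_trans[OF cb_at_subset Suc] by (simp add: omega_derivative_def)
qed simp

lemma omega_derivative_mono: "X \<subseteq> Y \<Longrightarrow> omega_derivative z X \<subseteq> omega_derivative z Y"
  unfolding omega_derivative_def cb_at_def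
  by (intro cb_derivative_mono Well_order_Restr Well_order_omega_pow)

lemma omega_derivative_funpow_mono:
  "X \<subseteq> Y \<Longrightarrow> (omega_derivative z ^^ n) X \<subseteq> (omega_derivative z ^^ n) Y"
  by (induction n) (auto dest: omega_derivative_mono)

lemma closed_omega_derivative_funpow:
  "closed X \<Longrightarrow> closed ((omega_derivative z ^^ n) (X :: 'a::t1_space set))"
  by (induction n) (auto simp: omega_derivative_def intro: cb_at_closed)

lemma omega_derivative_Un:
  fixes X Y :: "'a::t1_space set"
  assumes "closed X" "closed Y"
  shows "omega_derivative z (X \<union> Y) \<subseteq> omega_derivative z X \<union> omega_derivative z Y"
  unfolding omega_derivative_def cb_at_def
  by (intro cb_derivative_Un Well_order_Restr Well_order_omega_pow assms)

lemma omega_derivative_funpow_Un: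
  fixes X Y :: "'a::t1_space set"
  assumes "closed X" "closed Y"
  shows "(omega_derivative z ^^ n) (X \<union> Y) \<subseteq> (omega_derivative z ^^ n) X \<union> (omega_derivative z ^^ n) Y"
proof (induction n)
  case (Suc n)
  have "omega_derivative z ((omega_derivative z ^^ n) (X \<union> Y)) \<subseteq>
      omega_derivative z ((omega_derivative z ^^ n) X \<union> (omega_derivative z ^^ n) Y)"
    by (intro omega_derivative_mono Suc)
  also have "\<dots> \<subseteq> omega_derivative z ((omega_derivative z ^^ n) X) \<union>
      omega_derivative z ((omega_derivative z ^^ n) Y)"
    by (intro omega_derivative_Un closed_omega_derivative_funpow assms)
  finally show ?case by simp
qed simp

lemma perfect_subset_omega_derivative:
  assumes "S \<subseteq> derived_set S" "S \<subseteq> X"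
  shows "S \<subseteq> (omega_derivative z ^^ n) X"
proof (induction n)
  case (Suc n)
  then show ?case
    using perfect_subset_cb_derivative[OF Well_order_Restr[OF Well_order_omega_pow] assms(1)]
    by (simp add: omega_derivative_def cb_at_def)
qed (use assms in simp)

text \<open>Reduces arbitrary orders to multiples of \<omega>^z. Order 0 is a separate alternative,
  because an empty \<open>r\<close>, for which the power is 1, offers no exponent
  \<open>z\<close>.\<close>

lemma cb_derivative_below_omega_pow:
  assumes "\<beta> <o omega_pow r"
  obtains "\<And>X :: 'a::topological_space set. cb_derivative X (\<beta> :: ('o \<Rightarrow> nat) rel) = X"
  | z n where "z \<in> Field r"
      "\<And>X :: 'a set. (omega_derivative z ^^ n) X \<subseteq> cb_derivative X \<beta>"
proof -
  obtain f where f: "f \<in> Field (omega_pow r)" "\<beta> =o seg (omega_pow r) f"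
    using assms by (rule ordLess_seg_cases)
  have cb: "cb_derivative X \<beta> = cb_at X f" for X :: "'a set"
    unfolding cb_at_def by (rule cb_derivative_cong[OF f(2)])
  have F: "fin_supp r f" using f(1) by (simp add: Field_omega_pow)
  show thesis
  proof (cases "f = (\<lambda>x. 0)")
    case True
    then show thesis using that(1) cb cb_at_zero by metis
  next
    case False
    obtain z where z: "z \<in> Field r" "lex_less r f (unit_at z (Suc (f z)))"
      by (rule lex_less_leading[OF F False])
    show thesis
    proof (rule that(2)[OF z(1)])
      show "(omega_derivative z ^^ Suc (f z)) X \<subseteq> cb_derivative X \<beta>" for X :: "'a set"
        unfolding cb omega_derivative_funpow[OF z(1)]
        by (intro cb_at_anti F fin_supp_unit_at z)
    qed
  qed
qed

lemma cb_derivative_zero_below_omega_pow: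
  obtains \<beta> :: "('o \<Rightarrow> nat) rel" where "\<beta> <o omega_pow r"
    "\<And>X :: 'a::topological_space set. cb_derivative X \<beta> = X"
proof
  show "seg (omega_pow r) (\<lambda>x. 0) <o omega_pow r"
    using fin_supp_zero by (intro seg_less Well_order_omega_pow) (simp add: Field_omega_pow)
  show "cb_derivative X (seg (omega_pow r) (\<lambda>x. 0)) = X" for X :: "'a set"
    using cb_at_zero[of X] unfolding cb_at_def .
qed

lemma omega_derivative_funpow_eq_cb_derivative:
  assumes "z \<in> Field r"
  obtains \<beta> :: "('o \<Rightarrow> nat) rel" where "\<beta> <o omega_pow r"
    "\<And>X :: 'a::topological_space set. cb_derivative X \<beta> = (omega_derivative z ^^ n) X"
proof
  show "seg (omega_pow r) (unit_at z n) <o omega_pow r"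
    using fin_supp_unit_at[OF assms] by (intro seg_less Well_order_omega_pow) (simp add: Field_omega_pow)
  show "cb_derivative X (seg (omega_pow r) (unit_at z n)) = (omega_derivative z ^^ n) X" for X :: "'a set"
    unfolding omega_derivative_funpow[OF assms] cb_at_def ..
qed

end

section \<open>Weakly unconditionally Cauchy sequences\<close>

text \<open>The finite-sum form of weak unconditional Cauchyness. The constant is explicit because
  the bound obtained from cotype depends on it.\<close>

definition bounded_multiples :: "real \<Rightarrow> ('i \<Rightarrow> 'e::real_normed_vector) \<Rightarrow> bool" where
  "bounded_multiples C e \<longleftrightarrow>
     (\<forall>a F. finite F \<longrightarrow> (\<forall>i\<in>F. \<bar>a i\<bar> \<le> 1) \<longrightarrow> norm (\<Sum>i\<in>F. a i *\<^sub>R e i) \<le> C)"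

lemma bounded_multiplesD:
  "bounded_multiples C e \<Longrightarrow> finite F \<Longrightarrow> (\<And>i. i \<in> F \<Longrightarrow> \<bar>a i\<bar> \<le> 1) \<Longrightarrow> norm (\<Sum>i\<in>F. a i *\<^sub>R e i) \<le> C"
  by (auto simp: bounded_multiples_def)

lemma bounded_multiples_nonneg: "bounded_multiples C e \<Longrightarrow> 0 \<le> C"
  using bounded_multiplesD[of C e "{}"] by simp

lemma bounded_multiples_comp:
  fixes e :: "'i \<Rightarrow> 'e::real_normed_vector" and h :: "'j \<Rightarrow> 'i"
  assumes "bounded_multiples C e" "inj h"
  shows "bounded_multiples C (e \<circ> h)"
  unfolding bounded_multiples_def
proof (intro allI impI)
  fix a :: "'j \<Rightarrow> real" and F assume F: "finite F" "\<forall>i\<in>F. \<bar>a i\<bar> \<le> 1"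
  have "(\<Sum>i\<in>F. a i *\<^sub>R (e \<circ> h) i) = (\<Sum>i\<in>h ` F. a (inv h i) *\<^sub>R e i)"
    using inj_on_subset[OF assms(2)] by (subst sum.reindex) (auto simp: inv_f_f[OF assms(2)])
  also have "norm \<dots> \<le> C"
    using F by (intro bounded_multiplesD[OF assms(1)]) (auto simp: inv_f_f[OF assms(2)])
  finally show "norm (\<Sum>i\<in>F. a i *\<^sub>R (e \<circ> h) i) \<le> C" .
qed

text \<open>Averaging many disjoint blocks that are all almost \<open>-z\<close> kills the blocks.\<close>

lemma bounded_multiples_block_average:
  fixes e :: "nat \<Rightarrow> 'e::real_normed_vector"
  assumes e: "bounded_multiples C e"
    and z: "\<And>N. \<exists>F a. finite F \<and> F \<subseteq> {N..} \<and> (\<forall>i\<in>F. \<bar>a i\<bar> \<le> 1) \<and> norm (z + (\<Sum>i\<in>F. a i *\<^sub>R e i)) \<le> \<eta>"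
  shows "norm z \<le> \<eta>"
proof -
  have blocks: "\<exists>F a. finite F \<and> (\<forall>i\<in>F. \<bar>a i\<bar> \<le> 1) \<and> norm (real m *\<^sub>R z + (\<Sum>i\<in>F. a i *\<^sub>R e i)) \<le> real m * \<eta>" for m
  proof (induction m)
    case 0
    show ?case by (intro exI[of _ "{}"]) auto
  next
    case (Suc m)
    then obtain F a where F: "finite F" "\<forall>i\<in>F. \<bar>a i\<bar> \<le> 1"
        "norm (real m *\<^sub>R z + (\<Sum>i\<in>F. a i *\<^sub>R e i)) \<le> real m * \<eta>" by blast
    \<comment> \<open>Starting after \<open>Max F\<close> makes the new block disjoint from
      \<open>F\<close>; for empty \<open>F\<close> disjointness is trivial, whatever
      \<open>Max\<close> returns.\<close>
    obtain G b where G: "finite G" "G \<subseteq> {Suc (Max F)..}" "\<forall>i\<in>G. \<bar>b i\<bar> \<le> 1"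
        "norm (z + (\<Sum>i\<in>G. b i *\<^sub>R e i)) \<le> \<eta>" using z[of "Suc (Max F)"] by blast
    have disj: "F \<inter> G = {}" using G(2) Max_ge[OF F(1)] by fastforce
    let ?c = "\<lambda>i. if i \<in> F then a i else b i"
    have "(\<Sum>i\<in>F \<union> G. ?c i *\<^sub>R e i) = (\<Sum>i\<in>F. a i *\<^sub>R e i) + (\<Sum>i\<in>G. b i *\<^sub>R e i)"
      using disj by (subst sum.union_disjoint[OF F(1) G(1) disj]) (auto intro!: arg_cong2[of _ _ _ _ "(+)"] sum.cong)
    then have eq: "real (Suc m) *\<^sub>R z + (\<Sum>i\<in>F \<union> G. ?c i *\<^sub>R e i) =
        (real m *\<^sub>R z + (\<Sum>i\<in>F. a i *\<^sub>R e i)) + (z + (\<Sum>i\<in>G. b i *\<^sub>R e i))"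
      by (simp add: algebra_simps)
    have "norm (real (Suc m) *\<^sub>R z + (\<Sum>i\<in>F \<union> G. ?c i *\<^sub>R e i)) \<le> real m * \<eta> + \<eta>"
      unfolding eq using F(3) G(4) by (intro norm_triangle_le) linarith
    then show ?case
      using F(1,2) G(1,3) by (intro exI[of _ "F \<union> G"] exI[of _ ?c]) (auto simp: algebra_simps)
  qed
  \<comment> \<open>The blocks together form one admissible combination of norm at most
    \<open>C\<close>, whereas the multiple of \<open>z\<close> grows with \<open>m\<close>.\<close>
  have "real m * (norm z - \<eta>) \<le> C" for m
  proof -
    obtain F a where F: "finite F" "\<forall>i\<in>F. \<bar>a i\<bar> \<le> 1"
        "norm (real m *\<^sub>R z + (\<Sum>i\<in>F. a i *\<^sub>R e i)) \<le> real m * \<eta>" using blocks by blast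
    have "norm (real m *\<^sub>R z) - norm (\<Sum>i\<in>F. a i *\<^sub>R e i) \<le> real m * \<eta>"
      using F(3) norm_diff_ineq order_trans by blast
    moreover have "norm (\<Sum>i\<in>F. a i *\<^sub>R e i) \<le> C"
      using F by (intro bounded_multiplesD[OF e]) auto
    ultimately show ?thesis by (simp add: algebra_simps)
  qed
  then show ?thesis
    by (metis reals_Archimedean3 diff_gt_0_iff_gt not_le)
qed

lemma compact_multiples:
  fixes e :: "nat \<Rightarrow> 'e::real_normed_vector"
  assumes "finite Z"
  shows "compact {\<Sum>i\<in>Z. a i *\<^sub>R e i | a. \<forall>i\<in>Z. \<bar>a i\<bar> \<le> 1}"
  using assms
proof (induction Z)
  case empty
  then show ?case by simp
next
  case (insert j Z)
  let ?K = "{\<Sum>i\<in>Z. a i *\<^sub>R e i | a. \<forall>i\<in>Z. \<bar>a i\<bar> \<le> 1}"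
  let ?L = "(\<lambda>t. t *\<^sub>R e j) ` {-1..1}"
  have "compact ?L"
    by (intro compact_continuous_image continuous_intros compact_Icc)
  then have "compact {x + y | x y. x \<in> ?L \<and> y \<in> ?K}"
    using insert by (intro compact_sums)
  also have "{x + y | x y. x \<in> ?L \<and> y \<in> ?K} =
      {\<Sum>i\<in>insert j Z. a i *\<^sub>R e i | a. \<forall>i\<in>insert j Z. \<bar>a i\<bar> \<le> 1}" (is "_ = ?R")
  proof safe
    fix t :: real and a :: "nat \<Rightarrow> real" assume t: "t \<in> {-1..1}" "\<forall>i\<in>Z. \<bar>a i\<bar> \<le> 1"
    have "(\<Sum>i\<in>Z. (a(j := t)) i *\<^sub>R e i) = (\<Sum>i\<in>Z. a i *\<^sub>R e i)"
      using insert(2) by (intro sum.cong) auto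
    then show "\<exists>a'. t *\<^sub>R e j + (\<Sum>i\<in>Z. a i *\<^sub>R e i) = (\<Sum>i\<in>insert j Z. a' i *\<^sub>R e i) \<and>
        (\<forall>i\<in>insert j Z. \<bar>a' i\<bar> \<le> 1)"
      using t insert(1,2) by (intro exI[of _ "a(j := t)"]) auto
  next
    fix a :: "nat \<Rightarrow> real" assume a: "\<forall>i\<in>insert j Z. \<bar>a i\<bar> \<le> 1"
    show "\<exists>x y. (\<Sum>i\<in>insert j Z. a i *\<^sub>R e i) = x + y \<and> x \<in> ?L \<and> y \<in> ?K"
      using a insert(1,2)
      by (intro exI[of _ "a j *\<^sub>R e j"] exI[of _ "\<Sum>i\<in>Z. a i *\<^sub>R e i"]) (auto simp: abs_le_iff)
  qed
  finally show ?case .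
qed

text \<open>If this failed, combinations over \<open>Z\<close> would nearly cancel
  \<open>e j\<close> plus a tail for arbitrarily large \<open>j\<close>. By compactness they have a
  limit \<open>l\<close>, which is nearly cancelled by blocks arbitrarily far out, so averaging
  makes \<open>l\<close> small. But \<open>e j\<close> plus a far tail is not small.\<close>

lemma bounded_multiples_separated_from_finite:
  fixes e :: "nat \<Rightarrow> 'e::real_normed_vector"
  assumes e: "bounded_multiples C e" and \<epsilon>: "\<epsilon> > 0" "\<And>i. norm (e i) \<ge> \<epsilon>" and Z: "finite Z"
  shows "\<exists>j0. \<forall>j\<ge>j0. \<exists>N>j. \<forall>F a. finite F \<longrightarrow> F \<subseteq> {N..} \<longrightarrow> (\<forall>i\<in>Z \<union> F. \<bar>a i\<bar> \<le> 1) \<longrightarrow>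
           norm ((\<Sum>i\<in>Z. a i *\<^sub>R e i) + (e j + (\<Sum>i\<in>F. a i *\<^sub>R e i))) \<ge> \<epsilon> / 16"
proof (rule ccontr)
  assume "\<not> ?thesis"
  then have neg: "\<exists>j\<ge>n. \<forall>N>j. \<exists>F a. finite F \<and> F \<subseteq> {N..} \<and> (\<forall>i\<in>Z \<union> F. \<bar>a i\<bar> \<le> 1) \<and>
      norm ((\<Sum>i\<in>Z. a i *\<^sub>R e i) + (e j + (\<Sum>i\<in>F. a i *\<^sub>R e i))) < \<epsilon> / 16" for n
    by (meson not_le)
  \<comment> \<open>Averaging applied to \<open>e j\<close> itself: far tails cannot cancel half of
    a vector of norm at least \<open>\<epsilon>\<close>.\<close>
  have tail: "\<exists>N>j. \<forall>F a. finite F \<longrightarrow> F \<subseteq> {N..} \<longrightarrow> (\<forall>i\<in>F. \<bar>a i\<bar> \<le> 1) \<longrightarrow>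
      norm (e j + (\<Sum>i\<in>F. a i *\<^sub>R e i)) > \<epsilon> / 2" for j
  proof (rule ccontr)
    assume ne: "\<not> ?thesis"
    have "norm (e j) \<le> \<epsilon> / 2"
    proof (rule bounded_multiples_block_average[OF e])
      fix N
      have "Suc (max N j) > j" by simp
      then obtain F a where "finite F" "F \<subseteq> {Suc (max N j)..}" "\<forall>i\<in>F. \<bar>a i\<bar> \<le> 1"
          "norm (e j + (\<Sum>i\<in>F. a i *\<^sub>R e i)) \<le> \<epsilon> / 2"
        using ne by (meson not_le)
      then show "\<exists>F a. finite F \<and> F \<subseteq> {N..} \<and> (\<forall>i\<in>F. \<bar>a i\<bar> \<le> 1) \<and>
          norm (e j + (\<Sum>i\<in>F. a i *\<^sub>R e i)) \<le> \<epsilon> / 2"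
        by (intro exI[of _ F] exI[of _ a]) auto
    qed
    then show False using \<epsilon>(1) \<epsilon>(2)[of j] by simp
  qed
  let ?K = "{\<Sum>i\<in>Z. a i *\<^sub>R e i | a. \<forall>i\<in>Z. \<bar>a i\<bar> \<le> 1}"
  define near where "near = (\<lambda>n z \<eta>. \<exists>j F a. j \<ge> n \<and> finite F \<and> F \<subseteq> {Suc j..} \<and> (\<forall>i\<in>F. \<bar>a i\<bar> \<le> 1) \<and>
      norm (e j + (\<Sum>i\<in>F. a i *\<^sub>R e i)) > \<epsilon> / 2 \<and>
      norm (z + (e j + (\<Sum>i\<in>F. a i *\<^sub>R e i))) \<le> \<eta>)"
  have "\<forall>n. \<exists>z. z \<in> ?K \<and> near n z (\<epsilon> / 16)"
  proof
    fix n
    obtain j where j: "j \<ge> n" "\<And>N. N > j \<Longrightarrow> \<exists>F a. finite F \<and> F \<subseteq> {N..} \<and> (\<forall>i\<in>Z \<union> F. \<bar>a i\<bar> \<le> 1) \<and>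
        norm ((\<Sum>i\<in>Z. a i *\<^sub>R e i) + (e j + (\<Sum>i\<in>F. a i *\<^sub>R e i))) < \<epsilon> / 16"
      using neg[of n] by blast
    obtain N where N: "N > j" "\<And>F a. finite F \<Longrightarrow> F \<subseteq> {N..} \<Longrightarrow> \<forall>i\<in>F. \<bar>a i\<bar> \<le> 1 \<Longrightarrow>
        norm (e j + (\<Sum>i\<in>F. a i *\<^sub>R e i)) > \<epsilon> / 2"
      using tail[of j] by blast
    obtain F a where F: "finite F" "F \<subseteq> {N..}" "\<forall>i\<in>Z \<union> F. \<bar>a i\<bar> \<le> 1"
        "norm ((\<Sum>i\<in>Z. a i *\<^sub>R e i) + (e j + (\<Sum>i\<in>F. a i *\<^sub>R e i))) < \<epsilon> / 16"
      using j(2)[OF N(1)] by blast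
    show "\<exists>z. z \<in> ?K \<and> near n z (\<epsilon> / 16)"
      unfolding near_def
    proof (intro exI conjI)
      show "(\<Sum>i\<in>Z. a i *\<^sub>R e i) \<in> ?K" using F(3) by blast
      show "norm (e j + (\<Sum>i\<in>F. a i *\<^sub>R e i)) > \<epsilon> / 2" using N(2) F by blast
      show "F \<subseteq> {Suc j..}" using F(2) N(1) by auto
    qed (use F j in auto)
  qed
  then obtain z where z: "\<And>n. z n \<in> ?K" "\<And>n. near n (z n) (\<epsilon> / 16)"
    unfolding choice_iff by blast
  obtain l s where l: "strict_mono (s :: nat \<Rightarrow> nat)" "(z \<circ> s) \<longlonglongrightarrow> l"
    using compact_multiples[OF Z, of e] z(1) unfolding compact_eq_seq_compact_metric seq_compact_def by meson
  obtain n0 where n0: "\<And>n. n \<ge> n0 \<Longrightarrow> norm (z (s n) - l) < \<epsilon> / 16"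
    using LIMSEQ_D[OF l(2), of "\<epsilon> / 16"] \<epsilon>(1) by auto
  have close: "near N l (\<epsilon> / 8)" for N
  proof -
    let ?n = "max n0 N"
    obtain j F a where j: "j \<ge> s ?n" "finite F" "F \<subseteq> {Suc j..}" "\<forall>i\<in>F. \<bar>a i\<bar> \<le> 1"
        "norm (e j + (\<Sum>i\<in>F. a i *\<^sub>R e i)) > \<epsilon> / 2"
        "norm (z (s ?n) + (e j + (\<Sum>i\<in>F. a i *\<^sub>R e i))) \<le> \<epsilon> / 16"
      using z(2)[of "s ?n"] unfolding near_def by blast
    let ?w = "e j + (\<Sum>i\<in>F. a i *\<^sub>R e i)"
    have "l + ?w = (z (s ?n) + ?w) - (z (s ?n) - l)" by simp
    then have "norm (l + ?w) \<le> norm (z (s ?n) + ?w) + norm (z (s ?n) - l)"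
      by (metis norm_triangle_ineq4)
    then have "norm (l + ?w) \<le> \<epsilon> / 8"
      using j(6) n0[of ?n] by simp
    moreover have "j \<ge> N"
      using j(1) seq_suble[OF l(1), of ?n] by linarith
    ultimately show ?thesis
      unfolding near_def using j by blast
  qed
  have "norm l \<le> \<epsilon> / 8"
  proof (rule bounded_multiples_block_average[OF e])
    fix N
    obtain j F a where j: "j \<ge> N" "finite F" "F \<subseteq> {Suc j..}" "\<forall>i\<in>F. \<bar>a i\<bar> \<le> 1"
        "norm (l + (e j + (\<Sum>i\<in>F. a i *\<^sub>R e i))) \<le> \<epsilon> / 8"
      using close[of N] unfolding near_def by blast
    have nF: "j \<notin> F" using j(3) by auto
    have "(\<Sum>i\<in>F. (a(j := 1)) i *\<^sub>R e i) = (\<Sum>i\<in>F. a i *\<^sub>R e i)"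
      using nF by (intro sum.cong) auto
    then have "(\<Sum>i\<in>insert j F. (a(j := 1)) i *\<^sub>R e i) = e j + (\<Sum>i\<in>F. a i *\<^sub>R e i)"
      using nF j(2) by simp
    moreover have "insert j F \<subseteq> {N..}"
      using j(1,3) by auto
    ultimately show "\<exists>F a. finite F \<and> F \<subseteq> {N..} \<and> (\<forall>i\<in>F. \<bar>a i\<bar> \<le> 1) \<and> norm (l + (\<Sum>i\<in>F. a i *\<^sub>R e i)) \<le> \<epsilon> / 8"
      using j(2,4,5) by (intro exI[of _ "insert j F"] exI[of _ "a(j := 1)"]) auto
  qed
  \<comment> \<open>The bound \<open>\<epsilon> / 8\<close> adds the cancellation error and the
    distance to the limit, \<open>\<epsilon> / 16\<close> each. Averaging passes it on to
    \<open>l\<close>, so \<open>w\<close> would have norm at most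
    \<open>\<epsilon> / 4\<close>.\<close>
  moreover obtain w where "norm w > \<epsilon> / 2" "norm (l + w) \<le> \<epsilon> / 8"
    using close[of 0] unfolding near_def by blast
  moreover have "norm w \<le> norm (l + w) + norm l"
    by (metis add_diff_cancel_left' norm_triangle_ineq4)
  ultimately show False using \<epsilon>(1) by linarith
qed

text \<open>Each new index is separated from all combinations of the earlier ones and of a far tail,
  and the later indices are taken from that tail. A coefficient 1 at \<open>k\<close> then survives
  whatever stands before and after it.\<close>

lemma bounded_multiples_c0_subsequence:
  fixes e :: "nat \<Rightarrow> 'e::real_normed_vector"
  assumes e: "bounded_multiples C e" and \<epsilon>: "\<epsilon> > 0" "\<And>i. norm (e i) \<ge> \<epsilon>"
  obtains j where "strict_mono (j :: nat \<Rightarrow> nat)"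
    "\<forall>a k F. finite F \<longrightarrow> k \<in> F \<longrightarrow> (\<forall>i\<in>F. \<bar>a i\<bar> \<le> 1) \<longrightarrow> a k = 1 \<longrightarrow>
       norm (\<Sum>i\<in>F. a i *\<^sub>R e (j i)) \<ge> \<epsilon> / 16"
proof -
  \<comment> \<open>A state consists of the indices \<open>Z\<close> already used, the new index
    \<open>j\<close>, and the threshold \<open>N\<close> from which later indices are taken.\<close>
  define P where "P = (\<lambda>(Z, j, N). finite Z \<and> j < N \<and>
      (\<forall>F a. finite F \<longrightarrow> F \<subseteq> {N..} \<longrightarrow> (\<forall>i\<in>Z \<union> F. \<bar>a i\<bar> \<le> 1) \<longrightarrow>
        norm ((\<Sum>i\<in>Z. a i *\<^sub>R e i) + (e j + (\<Sum>i\<in>F. a i *\<^sub>R e i))) \<ge> \<epsilon> / 16))"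
  define Q where "Q = (\<lambda>(Z :: nat set, j, N) (Z', j', N' :: nat). Z' = insert j Z \<and> N \<le> (j' :: nat))"
  have ex: "\<exists>j N. n \<le> j \<and> P (Z, j, N)" if Z: "finite Z" for Z n
  proof -
    obtain j0 where j0: "\<And>j. j \<ge> j0 \<Longrightarrow> \<exists>N>j. \<forall>F a. finite F \<longrightarrow> F \<subseteq> {N..} \<longrightarrow> (\<forall>i\<in>Z \<union> F. \<bar>a i\<bar> \<le> 1) \<longrightarrow>
           norm ((\<Sum>i\<in>Z. a i *\<^sub>R e i) + (e j + (\<Sum>i\<in>F. a i *\<^sub>R e i))) \<ge> \<epsilon> / 16"
      using bounded_multiples_separated_from_finite[OF e \<epsilon> Z] by blast
    from j0[of "max j0 n"] obtain N where "P (Z, max j0 n, N)"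
      unfolding P_def prod.case using Z by auto
    then show ?thesis by (intro exI[of _ "max j0 n"] exI[of _ N]) simp
  qed
  have "\<exists>f. f 0 \<in> {x. fst x = {}} \<and> (\<forall>n. P (f n)) \<and> (\<forall>n. Q (f n) (f (Suc n)))"
  proof -
    have "\<exists>f. \<forall>n. (P (f n) \<and> (n = 0 \<longrightarrow> fst (f n) = {})) \<and> Q (f n) (f (Suc n))"
    proof (rule dependent_nat_choice)
      show "\<exists>x. P x \<and> (0 = (0 :: nat) \<longrightarrow> fst x = {})"
        using ex[of "{}" 0] by auto
      fix x and n :: nat assume x: "P x \<and> (n = 0 \<longrightarrow> fst x = {})"
      obtain Z j N where xZ: "x = (Z, j, N)" by (cases x)
      then have "finite (insert j Z)" using x by (simp add: P_def)
      from ex[OF this, of N] obtain j' N' where "N \<le> j'" "P (insert j Z, j', N')" by blast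
      then show "\<exists>y. (P y \<and> (Suc n = 0 \<longrightarrow> fst y = {})) \<and> Q x y"
        unfolding xZ Q_def by (intro exI[of _ "(insert j Z, j', N')"]) simp
    qed
    then obtain f where "\<forall>n. (P (f n) \<and> (n = 0 \<longrightarrow> fst (f n) = {})) \<and> Q (f n) (f (Suc n))" ..
    then show ?thesis by (intro exI[of _ f]) auto
  qed
  then obtain f where f: "fst (f 0) = {}" "\<And>n. P (f n)" "\<And>n. Q (f n) (f (Suc n))" by auto
  define Z where "Z = (\<lambda>n. fst (f n))"
  define j where "j = (\<lambda>n. fst (snd (f n)))"
  define N where "N = (\<lambda>n. snd (snd (f n)))"
  have fn: "f n = (Z n, j n, N n)" for n by (simp add: Z_def j_def N_def)
  have jN: "j n < N n" and Zs: "Z (Suc n) = insert (j n) (Z n)" and Nj: "N n \<le> j (Suc n)" for n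
    using f(2)[of n] f(3)[of n] unfolding fn P_def Q_def by auto
  have sep: "norm ((\<Sum>i\<in>Z n. a i *\<^sub>R e i) + (e (j n) + (\<Sum>i\<in>F. a i *\<^sub>R e i))) \<ge> \<epsilon> / 16"
    if "finite F" "F \<subseteq> {N n..}" "\<forall>i\<in>Z n \<union> F. \<bar>a i\<bar> \<le> 1" for n F a
    using f(2)[of n] that unfolding fn P_def by auto
  have mono: "strict_mono j"
    unfolding strict_mono_Suc_iff using jN Nj less_le_trans by blast
  then have inj: "inj j" by (rule strict_mono_imp_inj_on)
  have Zn: "Z n = j ` {..<n}" for n
  proof (induction n)
    case 0
    then show ?case using f(1) by (simp add: Z_def)
  next
    case (Suc n)
    then show ?case by (simp add: Zs lessThan_Suc)
  qed
  have later: "N k \<le> j l" if "k < l" for k l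
    using Nj[of k] that mono by (meson Suc_leI order_trans strict_mono_less_eq)
  show thesis
  proof (rule that[OF mono], intro allI impI)
    fix a :: "nat \<Rightarrow> real" and k F
    assume F: "finite F" "k \<in> F" "\<forall>i\<in>F. \<bar>a i\<bar> \<le> 1" "a k = 1"
    \<comment> \<open>The coefficients are moved to the original indices and extended by 0, because
      \<open>sep\<close> sums over all of \<open>Z k\<close>, including indices that do not come
      from \<open>F\<close>.\<close>
    define b where "b = (\<lambda>m. if m \<in> j ` F then a (inv j m) else 0)"
    have b: "b (j i) = (if i \<in> F then a i else 0)" for i
      using inj by (auto simp: b_def inj_image_mem_iff inv_f_f)
    have "b m = 0 \<or> (\<exists>i\<in>F. b m = a i)" for m
      using inj by (auto simp: b_def inv_f_f)
    then have b1: "\<bar>b m\<bar> \<le> 1" for m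
      using F(3) by (metis abs_zero zero_le_one)
    let ?G = "{i\<in>F. k < i}"
    have 1: "(\<Sum>m\<in>Z k. b m *\<^sub>R e m) = (\<Sum>i\<in>F \<inter> {..<k}. a i *\<^sub>R e (j i))"
    proof -
      have "(\<Sum>m\<in>Z k. b m *\<^sub>R e m) = (\<Sum>i<k. b (j i) *\<^sub>R e (j i))"
        unfolding Zn by (subst sum.reindex[OF inj_on_subset[OF inj subset_UNIV]]) simp
      also have "\<dots> = (\<Sum>i\<in>F \<inter> {..<k}. b (j i) *\<^sub>R e (j i))"
        by (rule sum.mono_neutral_right) (auto simp: b)
      also have "\<dots> = (\<Sum>i\<in>F \<inter> {..<k}. a i *\<^sub>R e (j i))"
        by (rule sum.cong) (auto simp: b)
      finally show ?thesis .
    qed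
    have 2: "(\<Sum>m\<in>j ` ?G. b m *\<^sub>R e m) = (\<Sum>i\<in>?G. a i *\<^sub>R e (j i))"
      by (subst sum.reindex[OF inj_on_subset[OF inj subset_UNIV]]) (auto simp: b intro: sum.cong)
    have "F = (F \<inter> {..<k}) \<union> insert k ?G" using F(2) by auto
    then have "(\<Sum>i\<in>F. a i *\<^sub>R e (j i)) = (\<Sum>i\<in>(F \<inter> {..<k}) \<union> insert k ?G. a i *\<^sub>R e (j i))"
      by simp
    also have "\<dots> = (\<Sum>i\<in>F \<inter> {..<k}. a i *\<^sub>R e (j i)) + (\<Sum>i\<in>insert k ?G. a i *\<^sub>R e (j i))"
      using F(1) by (intro sum.union_disjoint) auto
    also have "(\<Sum>i\<in>insert k ?G. a i *\<^sub>R e (j i)) = e (j k) + (\<Sum>i\<in>?G. a i *\<^sub>R e (j i))"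
      using F by (subst sum.insert) auto
    finally have eq: "(\<Sum>i\<in>F. a i *\<^sub>R e (j i)) =
        (\<Sum>m\<in>Z k. b m *\<^sub>R e m) + (e (j k) + (\<Sum>m\<in>j ` ?G. b m *\<^sub>R e m))"
      unfolding 1 2 .
    show "\<epsilon> / 16 \<le> norm (\<Sum>i\<in>F. a i *\<^sub>R e (j i))"
      unfolding eq using F(1) later b1 by (intro sep) auto
  qed
qed

text \<open>Coefficients tending to 0 make the series converge in the Banach space.
  \<open>bounded_multiples\<close> bounds the map from above; \<open>low\<close> bounds it from
  below after division by the coefficient of largest modulus.\<close>

lemma c0_embeds_if_equivalent:
  fixes b :: "nat \<Rightarrow> 'e::banach"
  assumes b: "bounded_multiples C b" and \<delta>: "\<delta> > 0"
    and low: "\<And>a k F. finite F \<Longrightarrow> k \<in> F \<Longrightarrow> (\<And>i. i \<in> F \<Longrightarrow> \<bar>a i\<bar> \<le> 1) \<Longrightarrow> a k = 1 \<Longrightarrow>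
       norm (\<Sum>i\<in>F. a i *\<^sub>R b i) \<ge> \<delta>"
  shows "isomorphic_to_subspace_of c0 TYPE('e)"
proof -
  define f where "f = (\<lambda>x :: nat \<Rightarrow>\<^sub>C real. \<Sum>n. x n *\<^sub>R b n)"
  have C: "C \<ge> 0" using b by (rule bounded_multiples_nonneg)
  have upper: "norm (\<Sum>i\<in>F. x i *\<^sub>R b i) \<le> C * M" if F: "finite F" "\<And>i. i \<in> F \<Longrightarrow> \<bar>x i\<bar> \<le> M" "M > 0" for x F M
  proof -
    have "(\<Sum>i\<in>F. x i *\<^sub>R b i) = M *\<^sub>R (\<Sum>i\<in>F. (x i / M) *\<^sub>R b i)"
      using F(3) by (simp add: scaleR_sum_right)
    moreover have "norm (\<Sum>i\<in>F. (x i / M) *\<^sub>R b i) \<le> C"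
      using F by (intro bounded_multiplesD[OF b]) (auto simp: abs_divide divide_le_eq)
    ultimately show ?thesis
      using F(3) by (simp add: mult.commute)
  qed
  have lower: "\<delta> * \<bar>x k\<bar> \<le> norm (\<Sum>i\<in>F. x i *\<^sub>R b i)" if F: "finite F" "k \<in> F" for x k F
  proof -
    define M where "M = Max ((\<lambda>i. \<bar>x i\<bar>) ` F)"
    have "M \<in> (\<lambda>i. \<bar>x i\<bar>) ` F" using F unfolding M_def by (intro Max_in) auto
    then obtain m where m: "m \<in> F" "\<bar>x m\<bar> = M" by auto
    have le: "\<bar>x i\<bar> \<le> \<bar>x m\<bar>" if "i \<in> F" for i
      using that F unfolding m(2) M_def by (intro Max_ge) auto
    show ?thesis
    proof (cases "x m = 0")
      case True
      then show ?thesis using le[OF F(2)] by simp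
    next
      case False
      have "(\<Sum>i\<in>F. x i *\<^sub>R b i) = x m *\<^sub>R (\<Sum>i\<in>F. (x i / x m) *\<^sub>R b i)"
        using False by (simp add: scaleR_sum_right)
      moreover have "norm (\<Sum>i\<in>F. (x i / x m) *\<^sub>R b i) \<ge> \<delta>"
        using F m le False by (intro low[of F m]) (auto simp: abs_divide divide_le_eq)
      ultimately have "norm (\<Sum>i\<in>F. x i *\<^sub>R b i) \<ge> \<bar>x m\<bar> * \<delta>"
        by (simp add: mult_left_mono)
      moreover have "\<bar>x k\<bar> * \<delta> \<le> \<bar>x m\<bar> * \<delta>"
        using le[OF F(2)] \<delta> by (intro mult_right_mono) auto
      ultimately show ?thesis by (simp add: mult.commute)
    qed
  qed
  have summable: "summable (\<lambda>n. x n *\<^sub>R b n)" if x: "x \<in> c0" for x :: "nat \<Rightarrow>\<^sub>C real"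
    unfolding summable_Cauchy
  proof (intro allI impI)
    fix r :: real assume r: "r > 0"
    \<comment> \<open>The \<open>+ 1\<close> keeps the denominator positive when
      \<open>C = 0\<close>, and \<open>C * M < r\<close> still holds.\<close>
    define M where "M = r / (2 * (C + 1))"
    have M: "M > 0" using r C by (simp add: M_def)
    have "C * M < r"
      using r C by (simp add: M_def field_simps) (smt (verit) mult_nonneg_nonneg)
    obtain n0 where n0: "\<And>n. n \<ge> n0 \<Longrightarrow> \<bar>x n\<bar> < M"
      using x LIMSEQ_D[of "apply_bcontfun x" 0 M] M by (auto simp: c0_def)
    have "norm (\<Sum>i=m..<n. x i *\<^sub>R b i) < r" if "m \<ge> n0" for m n
    proof -
      have "norm (\<Sum>i=m..<n. x i *\<^sub>R b i) \<le> C * M"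
        using that n0 M by (intro upper) (auto simp: less_imp_le)
      then show ?thesis using \<open>C * M < r\<close> by linarith
    qed
    then show "\<exists>N. \<forall>m\<ge>N. \<forall>n. norm (\<Sum>i=m..<n. x i *\<^sub>R b i) < r" by blast
  qed
  have lim: "(\<lambda>n. norm (\<Sum>i<n. x i *\<^sub>R b i)) \<longlonglongrightarrow> norm (f x)" if "x \<in> c0" for x
    unfolding f_def by (intro tendsto_norm summable_LIMSEQ summable that)
  have f_upper: "norm (f x) \<le> C * norm x" if x: "x \<in> c0" for x
  proof (cases "norm x = 0")
    case True
    then show ?thesis by (simp add: f_def)
  next
    case False
    have "norm (\<Sum>i<n. x i *\<^sub>R b i) \<le> C * norm x" for n
      using False norm_bounded[of x] by (intro upper) auto
    then show ?thesis by (intro LIMSEQ_le_const2[OF lim[OF x]]) auto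
  qed
  have f_lower: "\<delta> * norm x \<le> norm (f x)" if x: "x \<in> c0" for x
  proof -
    have "norm (x k) \<le> norm (f x) / \<delta>" for k
    proof -
      have "\<delta> * \<bar>x k\<bar> \<le> norm (f x)"
        by (intro LIMSEQ_le_const[OF lim[OF x]] exI[of _ "Suc k"]) (auto intro!: lower)
      then show ?thesis using \<delta> by (simp add: field_simps)
    qed
    then have "norm x \<le> norm (f x) / \<delta>" by (rule norm_bound)
    then show ?thesis using \<delta> by (simp add: field_simps)
  qed
  have c0_add: "x + y \<in> c0" if "x \<in> c0" "y \<in> c0" for x y
    using that tendsto_add[of "apply_bcontfun x" 0 sequentially "apply_bcontfun y" 0]
    by (simp add: c0_def plus_bcontfun.rep_eq)
  have c0_scale: "c *\<^sub>R x \<in> c0" if "x \<in> c0" for x c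
    using that tendsto_mult_left[of "apply_bcontfun x" 0 sequentially c]
    by (simp add: c0_def scaleR_bcontfun.rep_eq)
  have c0_diff: "x - y \<in> c0" if "x \<in> c0" "y \<in> c0" for x y
    using c0_add[OF that(1) c0_scale[OF that(2), of "-1"]] by simp
  have f_add: "f (x + y) = f x + f y" if "x \<in> c0" "y \<in> c0" for x y
    using suminf_add[OF summable[OF that(1)] summable[OF that(2)]]
    by (simp add: f_def plus_bcontfun.rep_eq algebra_simps)
  have f_scale: "f (c *\<^sub>R x) = c *\<^sub>R f x" if "x \<in> c0" for x c
    using suminf_scaleR_right[OF summable[OF that], of c]
    by (simp add: f_def scaleR_bcontfun.rep_eq)
  have f_diff: "f (x - y) = f x - f y" if "x \<in> c0" "y \<in> c0" for x y
    using f_add[OF that(1) c0_scale[OF that(2), of "-1"]] f_scale[OF that(2), of "-1"] by simp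
  have zero: "0 \<in> c0" by (simp add: c0_def)
  have dist_low: "\<delta> * dist x y \<le> dist (f x) (f y)" if "x \<in> c0" "y \<in> c0" for x y
    using f_lower[OF c0_diff[OF that]] by (simp add: dist_norm f_diff[OF that])
  have inj: "inj_on f c0"
  proof (rule inj_onI)
    fix x y assume xy: "x \<in> c0" "y \<in> c0" "f x = f y"
    then have "dist x y \<le> 0" using dist_low[OF xy(1,2)] \<delta> by (simp add: mult_le_0_iff)
    then show "x = y" by simp
  qed
  define g where "g = the_inv_into c0 f"
  have gf: "g (f x) = x" if "x \<in> c0" for x
    unfolding g_def using inj that by (rule the_inv_into_f_f)
  have "C-lipschitz_on c0 f"
    using C f_upper[OF c0_diff] by (intro lipschitz_onI) (auto simp: dist_norm f_diff)
  then have cont_f: "continuous_on c0 f" by (rule lipschitz_on_continuous_on)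
  have "(1 / \<delta>)-lipschitz_on (f ` c0) g"
    using \<delta> dist_low by (intro lipschitz_onI) (auto simp: gf field_simps)
  then have cont_g: "continuous_on (f ` c0) g" by (rule lipschitz_on_continuous_on)
  have "homeomorphism c0 (f ` c0) f g"
    using cont_f cont_g gf by (intro homeomorphismI) auto
  then have "linearly_homeomorphic c0 (f ` c0)"
    unfolding linearly_homeomorphic_def using f_add f_scale by blast
  moreover have "subspace (f ` c0)"
    unfolding subspace_def
  proof (intro conjI ballI allI)
    show "0 \<in> f ` c0" using zero f_scale[OF zero, of 0] by force
    show "u + v \<in> f ` c0" if uv: "u \<in> f ` c0" "v \<in> f ` c0" for u v
    proof -
      obtain x y where xy: "x \<in> c0" "y \<in> c0" "u = f x" "v = f y" using uv by blast
      then have "u + v = f (x + y)" by (simp add: f_add)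
      then show ?thesis using c0_add[OF xy(1,2)] by blast
    qed
    show "c *\<^sub>R u \<in> f ` c0" if u: "u \<in> f ` c0" for c u
    proof -
      obtain x where x: "x \<in> c0" "u = f x" using u by blast
      then have "c *\<^sub>R u = f (c *\<^sub>R x)" by (simp add: f_scale)
      then show ?thesis using c0_scale[OF x(1)] by blast
    qed
  qed
  ultimately show ?thesis
    unfolding isomorphic_to_subspace_of_def by blast
qed

text \<open>This is due to Bessaga and Pelczynski. The block averages above replace the usual norming
  functionals, so that the Hahn-Banach theorem is not needed.\<close>

lemma no_c0_imp_finite_large:
  fixes e :: "'i \<Rightarrow> 'e::banach"
  assumes "\<not> isomorphic_to_subspace_of c0 TYPE('e)" and e: "bounded_multiples C e" and \<epsilon>: "\<epsilon> > 0"
  shows "finite {i. norm (e i) \<ge> \<epsilon>}"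
proof (rule ccontr)
  assume "infinite {i. norm (e i) \<ge> \<epsilon>}"
  from infinite_countable_subset[OF this] obtain h :: "nat \<Rightarrow> 'i"
    where h: "inj h" "range h \<subseteq> {i. norm (e i) \<ge> \<epsilon>}" by (elim exE conjE)
  have eh: "bounded_multiples C (e \<circ> h)" using e h(1) by (rule bounded_multiples_comp)
  have large: "norm ((e \<circ> h) i) \<ge> \<epsilon>" for i
    using h(2) rangeI[of h i] by auto
  obtain j where j: "strict_mono (j :: nat \<Rightarrow> nat)"
    "\<forall>a k F. finite F \<longrightarrow> k \<in> F \<longrightarrow> (\<forall>i\<in>F. \<bar>a i\<bar> \<le> 1) \<longrightarrow> a k = 1 \<longrightarrow>
       norm (\<Sum>i\<in>F. a i *\<^sub>R (e \<circ> h) (j i)) \<ge> \<epsilon> / 16"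
    by (rule bounded_multiples_c0_subsequence[OF eh \<epsilon> large])
  have "bounded_multiples C (e \<circ> h \<circ> j)"
    using eh strict_mono_imp_inj_on[OF j(1)] by (rule bounded_multiples_comp)
  then have "isomorphic_to_subspace_of c0 TYPE('e)"
    using \<epsilon> j(2) by (intro c0_embeds_if_equivalent[of C "e \<circ> h \<circ> j" "\<epsilon> / 16"]) auto
  then show False using assms(1) by blast
qed

text \<open>Rademacher functions are admissible coefficients, so the right-hand side of the cotype
  inequality is at most \<open>K * C\<close>, while \<open>n\<close> large terms make the left-hand
  side at least \<open>n powr (1 / q) * \<epsilon>\<close>. The resulting bound on \<open>n\<close>
  does not depend on \<open>e\<close>.\<close>

lemma nontrivial_cotype_imp_bounded_large:
  assumes "nontrivial_cotype TYPE('e::real_normed_vector)" and "\<epsilon> > 0"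
  shows "\<exists>n. \<forall>e :: 'i \<Rightarrow> 'e. bounded_multiples C e \<longrightarrow> finite {i. norm (e i) \<ge> \<epsilon>} \<and> card {i. norm (e i) \<ge> \<epsilon>} \<le> n"
proof -
  obtain q K :: real where qK: "q \<ge> 2" "K > 0"
      "\<And>(n::nat) (e :: nat \<Rightarrow> 'e). (\<Sum>i=1..n. norm (e i) powr q) powr (1 / q)
             \<le> K * sqrt (integral {0..1} (\<lambda>t. (norm (\<Sum>i=1..n. rademacher i t *\<^sub>R e i))\<^sup>2))"
    using assms(1) unfolding nontrivial_cotype_def by blast
  define B where "B = (K * C / \<epsilon>) powr q"
  have bound: "real (card F) \<le> B" if e: "bounded_multiples C e" and F: "finite F" "F \<subseteq> {i. norm (e i) \<ge> \<epsilon>}"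
    for e :: "'i \<Rightarrow> 'e" and F
  proof -
    let ?n = "card F"
    have C: "C \<ge> 0" using e by (rule bounded_multiples_nonneg)
    obtain h where h: "bij_betw h {1..?n} F"
      using ex_bij_betw_nat_finite_1[OF F(1)] by blast
    have int: "integral {0..1} (\<lambda>t. (norm (\<Sum>i=1..?n. rademacher i t *\<^sub>R e (h i)))\<^sup>2) \<le> C\<^sup>2"
    proof (cases "(\<lambda>t. (norm (\<Sum>i=1..?n. rademacher i t *\<^sub>R e (h i)))\<^sup>2) integrable_on {0..1}")
      case True
      have "(norm (\<Sum>i=1..?n. rademacher i t *\<^sub>R e (h i)))\<^sup>2 \<le> C\<^sup>2" for t
      proof -
        have "(\<Sum>k\<in>F. rademacher (the_inv_into {1..?n} h k) t *\<^sub>R e k) =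
            (\<Sum>i=1..?n. rademacher (the_inv_into {1..?n} h (h i)) t *\<^sub>R e (h i))"
          by (rule sum.reindex_bij_betw[OF h, symmetric])
        also have "\<dots> = (\<Sum>i=1..?n. rademacher i t *\<^sub>R e (h i))"
          using h by (intro sum.cong) (auto simp: the_inv_into_f_f bij_betw_def)
        finally have "(\<Sum>i=1..?n. rademacher i t *\<^sub>R e (h i)) =
            (\<Sum>k\<in>F. rademacher (the_inv_into {1..?n} h k) t *\<^sub>R e k)" by (rule sym)
        also have "norm \<dots> \<le> C"
          using F(1) by (intro bounded_multiplesD[OF e]) (auto simp: rademacher_def abs_sgn_eq)
        finally show ?thesis by (intro power_mono) auto
      qed
      then have "integral {0..1} (\<lambda>t. (norm (\<Sum>i=1..?n. rademacher i t *\<^sub>R e (h i)))\<^sup>2) \<le>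
          integral {0..1 :: real} (\<lambda>t. C\<^sup>2)"
        using True by (intro integral_le) auto
      then show ?thesis by simp
    next
      \<comment> \<open>A non-integrable function has integral 0 by convention, and this satisfies
        the bound too.\<close>
      case False
      then show ?thesis by (simp add: not_integrable_integral)
    qed
    have "(real ?n * \<epsilon> powr q) powr (1 / q) \<le> (\<Sum>i=1..?n. norm (e (h i)) powr q) powr (1 / q)"
    proof (rule powr_mono2)
      have "(\<Sum>i=1..?n. \<epsilon> powr q) \<le> (\<Sum>i=1..?n. norm (e (h i)) powr q)"
        using h F(2) assms(2) qK(1) by (intro sum_mono powr_mono2) (auto simp: bij_betw_def)
      then show "real ?n * \<epsilon> powr q \<le> (\<Sum>i=1..?n. norm (e (h i)) powr q)" by simp
    qed (use qK(1) in auto)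
    also have "\<dots> \<le> K * sqrt (integral {0..1} (\<lambda>t. (norm (\<Sum>i=1..?n. rademacher i t *\<^sub>R e (h i)))\<^sup>2))"
      by (rule qK(3))
    also have "\<dots> \<le> K * C"
      using int qK(2) C by (intro mult_left_mono real_le_lsqrt) auto
    finally have le: "(real ?n * \<epsilon> powr q) powr (1 / q) \<le> K * C" .
    have "real ?n * \<epsilon> powr q = ((real ?n * \<epsilon> powr q) powr (1 / q)) powr q"
      using qK(1) by (simp add: powr_powr)
    also have "\<dots> \<le> (K * C) powr q"
      using le qK(1) by (intro powr_mono2) auto
    finally show ?thesis
      unfolding B_def using assms(2) qK(2) C by (simp add: powr_divide field_simps)
  qed
  show ?thesis
  proof (intro exI[of _ "nat \<lceil>B\<rceil>"] allI impI conjI)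
    fix e :: "'i \<Rightarrow> 'e" assume e: "bounded_multiples C e"
    have le: "card F \<le> nat \<lceil>B\<rceil>" if "finite F" "F \<subseteq> {i. norm (e i) \<ge> \<epsilon>}" for F
      using bound[OF e that] by linarith
    show fin: "finite {i. norm (e i) \<ge> \<epsilon>}"
    proof (rule ccontr)
      assume "infinite {i. norm (e i) \<ge> \<epsilon>}"
      then obtain F where "F \<subseteq> {i. norm (e i) \<ge> \<epsilon>}" "finite F" "card F = Suc (nat \<lceil>B\<rceil>)"
        using infinite_arbitrarily_large by metis
      then show False using le[of F] by simp
    qed
    show "card {i. norm (e i) \<ge> \<epsilon>} \<le> nat \<lceil>B\<rceil>"
      using le[OF fin] by simp
  qed
qed

section \<open>Plateau functions\<close>

text \<open>The set \<open>V\<close> is open and meets \<open>P\<close> so that the next function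
  can be placed inside it; \<open>t\<close> is the height of the stack so far.\<close>

definition plateau :: "real \<Rightarrow> 'a::topological_space set \<Rightarrow> 'a set \<Rightarrow> ('a \<Rightarrow>\<^sub>C real) \<Rightarrow> bool" where
  "plateau t U P g \<longleftrightarrow> (\<forall>x. 0 \<le> g x \<and> g x \<le> t) \<and> (\<forall>x. x \<notin> U \<longrightarrow> g x = 0) \<and>
     (\<exists>V\<subseteq>U. open V \<and> V \<inter> P \<noteq> {} \<and> (\<forall>x\<in>V. g x = t))"

lemma plateau_mono: "plateau t V P g \<Longrightarrow> V \<subseteq> U \<Longrightarrow> P \<subseteq> Q \<Longrightarrow> plateau t U Q g"
  unfolding plateau_def by blast

lemma plateau_norm_le: "plateau t U P g \<Longrightarrow> norm g \<le> t"
  by (rule norm_bound) (auto simp: plateau_def)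

lemma plateau_norm_ge:
  assumes "plateau t U P g"
  shows "t \<le> norm g"
proof -
  obtain x where "g x = t" using assms unfolding plateau_def by blast
  then show ?thesis using norm_bounded[of g x] by simp
qed

lemma plateau_scale:
  assumes g: "plateau t U P g" and s: "s \<ge> 0"
  shows "plateau (s * t) U P (s *\<^sub>R g)"
proof -
  obtain V where V: "V \<subseteq> U" "open V" "V \<inter> P \<noteq> {}" "\<forall>x\<in>V. g x = t"
    using g unfolding plateau_def by blast
  have at: "(s *\<^sub>R g) x = s * g x" for x by (simp add: scaleR_bcontfun.rep_eq)
  have "\<forall>x\<in>V. (s *\<^sub>R g) x = s * t" using V(4) unfolding at by simp
  then have "\<exists>V\<subseteq>U. open V \<and> V \<inter> P \<noteq> {} \<and> (\<forall>x\<in>V. (s *\<^sub>R g) x = s * t)"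
    using V(1-3) by blast
  moreover have "0 \<le> s * g x \<and> s * g x \<le> s * t" "x \<notin> U \<Longrightarrow> s * g x = 0" for x
    using g s unfolding plateau_def by (simp_all add: mult_left_mono)
  ultimately show ?thesis
    unfolding plateau_def at by blast
qed

lemma plateau_exists:
  fixes U :: "'a::t2_space set"
  assumes "compact (UNIV :: 'a set)" "open U" "U \<inter> P \<noteq> {}"
  shows "\<exists>g. plateau 1 U P g"
proof -
  obtain x where x: "x \<in> U" "x \<in> P" using assms(3) by blast
  have "compact_space (euclidean :: 'a topology)"
    using assms(1) by (simp add: compact_space_def)
  moreover have "Hausdorff_space (euclidean :: 'a topology)"
    unfolding Hausdorff_space_def using hausdorff by (fastforce simp: disjnt_def)
  ultimately have "normal_space (euclidean :: 'a topology)"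
    by (intro compact_Hausdorff_or_regular_imp_normal_space) auto
  then obtain h where h: "continuous_map (euclidean :: 'a topology) (top_of_set {0..1::real}) h"
      "h ` (- U) \<subseteq> {0}" "h ` {x} \<subseteq> {1}"
    using assms(2) x by (rule_tac Urysohn_lemma[of euclidean "- U" "{x}" 0 1]) (auto simp: closed_Compl disjnt_def)
  have cont: "continuous_on UNIV h" and rng: "\<And>y. 0 \<le> h y \<and> h y \<le> 1"
    using h(1) by (auto simp: continuous_map_in_subtopology image_subset_iff)
  \<comment> \<open>The Urysohn function is only known to be 1 at \<open>x\<close>. Doubling and
    truncating spreads the value 1 over the open set where it exceeds 1/2.\<close>
  define g where "g = (\<lambda>y. min 1 (2 * h y))"
  have "g \<in> bcontfun"
  proof (rule bcontfun_normI)
    show "continuous_on UNIV g"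
      unfolding g_def by (intro continuous_intros cont)
    show "norm (g y) \<le> 1" for y
      using rng[of y] by (simp add: g_def)
  qed
  then have ap: "apply_bcontfun (Bcontfun g) = g" by (rule Bcontfun_inverse)
  have "open {y. h y > 1 / 2}"
    using cont by (intro open_Collect_less) (auto intro: continuous_intros)
  moreover have "{y. h y > 1 / 2} \<subseteq> U" using h(2) by force
  moreover have "x \<in> {y. h y > 1 / 2} \<inter> P" using h(3) x by auto
  moreover have "\<forall>y\<in>{y. h y > 1 / 2}. g y = 1" by (auto simp: g_def)
  ultimately have "\<exists>V\<subseteq>U. open V \<and> V \<inter> P \<noteq> {} \<and> (\<forall>x\<in>V. g x = 1)" by blast
  moreover have "\<forall>y. 0 \<le> g y \<and> g y \<le> 1" using rng by (auto simp: g_def)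
  moreover have "\<forall>y. y \<notin> U \<longrightarrow> g y = 0" using h(2) by (auto simp: g_def)
  ultimately have "plateau 1 U P (Bcontfun g)"
    unfolding plateau_def ap by blast
  then show ?thesis ..
qed

lemma plateau_add:
  assumes S: "plateau s U Q S" and V: "V \<subseteq> U" "\<forall>x\<in>V. S x = s" and f: "plateau 1 V P f"
  shows "plateau (s + 1) U P (S + f)"
proof -
  obtain W where W: "W \<subseteq> V" "open W" "W \<inter> P \<noteq> {}" "\<forall>x\<in>W. f x = 1"
    using f unfolding plateau_def by blast
  have "W \<subseteq> U" "\<forall>x\<in>W. (S + f) x = s + 1"
    using W V by (auto simp: plus_bcontfun.rep_eq)
  moreover have "0 \<le> (S + f) x \<and> (S + f) x \<le> s + 1" for x
    using S f unfolding plateau_def by (simp add: plus_bcontfun.rep_eq add_mono)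
  moreover have "(S + f) x = 0" if "x \<notin> U" for x
  proof -
    have "x \<notin> V" using that V(1) by blast
    then show ?thesis
      using S f that unfolding plateau_def by (simp add: plus_bcontfun.rep_eq)
  qed
  ultimately show ?thesis
    using W(2,3) unfolding plateau_def by blast
qed

section \<open>Embeddings of spaces of continuous functions\<close>

text \<open>\<open>finite_large_seq\<close> is the common consequence of the two hypotheses on
  \<open>E\<close>. Sequences suffice, since an infinite index set contains one.\<close>

locale function_space_embedding =
  fixes T :: "('k1::t2_space \<Rightarrow>\<^sub>C real) \<Rightarrow> ('k2::t2_space \<Rightarrow>\<^sub>C 'e::banach)"
    and c M :: real
  assumes compact1: "compact (UNIV :: 'k1 set)" and compact2: "compact (UNIV :: 'k2 set)"
    and linear_T: "linear T"
    and c_pos: "c > 0"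
    and T_lower: "\<And>f. c * norm f \<le> norm (T f)"
    and T_upper: "\<And>f. norm (T f) \<le> M * norm f"
    and finite_large_seq: "\<And>C (e :: nat \<Rightarrow> 'e) \<epsilon>. bounded_multiples C e \<Longrightarrow> \<epsilon> > 0 \<Longrightarrow> finite {i. norm (e i) \<ge> \<epsilon>}"
begin

lemma T_at_le: "norm (T f y) \<le> M * norm f"
  using norm_bounded[of "T f" y] T_upper[of f] by linarith

lemma M_nonneg: "M \<ge> 0"
proof -
  define f :: "'k1 \<Rightarrow>\<^sub>C real" where "f = const_bcontfun 1"
  have "f undefined = 1" by (simp add: f_def)
  then have "f \<noteq> 0" by auto
  then have "norm f > 0" by simp
  moreover have "0 \<le> M * norm f" using T_upper[of f] norm_ge_zero order_trans by blast
  ultimately show ?thesis by (simp add: zero_le_mult_iff)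
qed

lemma T_add_at: "T (f + g) y = T f y + T g y"
  by (simp add: linear_add[OF linear_T] plus_bcontfun.rep_eq)

lemma T_scale_at: "T (a *\<^sub>R f) y = a *\<^sub>R T f y"
  by (simp add: linear_scale[OF linear_T] scaleR_bcontfun.rep_eq)

lemma T_sum_at: "finite F \<Longrightarrow> T (\<Sum>i\<in>F. a i *\<^sub>R f i) y = (\<Sum>i\<in>F. a i *\<^sub>R T (f i) y)"
  by (induction F rule: finite_induct)
    (auto simp: linear_0[OF linear_T] T_add_at T_scale_at)

lemma finite_large:
  fixes e :: "'i \<Rightarrow> 'e"
  assumes e: "bounded_multiples C e" and "\<epsilon> > 0"
  shows "finite {i. norm (e i) \<ge> \<epsilon>}"
proof (rule ccontr)
  assume "infinite {i. norm (e i) \<ge> \<epsilon>}"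
  from infinite_countable_subset[OF this] obtain h :: "nat \<Rightarrow> 'i"
    where h: "inj h" "range h \<subseteq> {i. norm (e i) \<ge> \<epsilon>}" by (elim exE conjE)
  have "finite {i. norm ((e \<circ> h) i) \<ge> \<epsilon>}"
    using bounded_multiples_comp[OF e h(1)] assms(2) by (rule finite_large_seq)
  moreover have "{i. norm ((e \<circ> h) i) \<ge> \<epsilon>} = UNIV" using h(2) by auto
  ultimately show False by simp
qed

text \<open>At each point at most \<open>k\<close> terms survive, so an admissible combination of
  the \<open>f i\<close> has norm at most \<open>k\<close>; \<open>T\<close> enlarges it by a factor
  of at most \<open>M\<close>.\<close>

lemma bounded_multiples_T:
  fixes f :: "'i \<Rightarrow> ('k1 \<Rightarrow>\<^sub>C real)"
  assumes f: "\<And>i x. \<bar>f i x\<bar> \<le> 1" and k: "\<And>x F. finite F \<Longrightarrow> card {i\<in>F. f i x \<noteq> 0} \<le> k"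
  shows "bounded_multiples (M * real k) (\<lambda>i. T (f i) y)"
  unfolding bounded_multiples_def
proof (intro allI impI)
  fix a :: "'i \<Rightarrow> real" and F assume F: "finite F" "\<forall>i\<in>F. \<bar>a i\<bar> \<le> 1"
  have at: "(\<Sum>i\<in>F. a i *\<^sub>R f i) x = (\<Sum>i\<in>F. a i * f i x)" for x
    using F(1) by (induction F rule: finite_induct) (auto simp: plus_bcontfun.rep_eq scaleR_bcontfun.rep_eq)
  have "norm (\<Sum>i\<in>F. a i *\<^sub>R f i) \<le> real k"
  proof (rule norm_bound)
    fix x
    have "norm ((\<Sum>i\<in>F. a i *\<^sub>R f i) x) \<le> (\<Sum>i\<in>F. \<bar>a i * f i x\<bar>)"
      unfolding at by (simp add: sum_abs)
    also have "\<dots> = (\<Sum>i\<in>{i\<in>F. f i x \<noteq> 0}. \<bar>a i * f i x\<bar>)"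
      using F(1) by (intro sum.mono_neutral_right) auto
    also have "\<dots> \<le> (\<Sum>i\<in>{i\<in>F. f i x \<noteq> 0}. 1)"
      using F(2) f by (intro sum_mono) (auto simp: abs_mult intro!: mult_le_one)
    also have "\<dots> \<le> real k" using k[OF F(1), of x] by simp
    finally show "norm ((\<Sum>i\<in>F. a i *\<^sub>R f i) x) \<le> real k" .
  qed
  then have "M * norm (\<Sum>i\<in>F. a i *\<^sub>R f i) \<le> M * real k"
    using M_nonneg by (intro mult_left_mono) auto
  then show "norm (\<Sum>i\<in>F. a i *\<^sub>R T (f i) y) \<le> M * real k"
    using T_at_le[of "\<Sum>i\<in>F. a i *\<^sub>R f i" y] T_sum_at[OF F(1), of a f y] by simp
qed

text \<open>Stack plateau functions on top of each other, each one small where its predecessors are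
  large. At every point of \<open>A\<close> at most one summand is large.\<close>

lemma plateau_stack:
  assumes A: "closed A" and \<epsilon>: "\<epsilon> > 0"
    and step: "\<And>C P U. closed C \<Longrightarrow> C \<subseteq> A \<Longrightarrow> C \<inter> B = {} \<Longrightarrow> open U \<Longrightarrow> U \<subseteq> U0 \<Longrightarrow> U \<inter> R P \<noteq> {} \<Longrightarrow>
       \<exists>g. plateau 1 U P g \<and> (\<forall>y\<in>C \<union> B. norm (T g y) < \<epsilon>)"
    and U: "open U" "U \<subseteq> U0" "U \<inter> (R ^^ N) P \<noteq> {}"
  shows "\<exists>S C. plateau (real N) U P S \<and> closed C \<and> C \<subseteq> A \<and> C \<inter> B = {} \<and>
           (\<forall>y\<in>A. norm (T S y) \<le> M + real N * \<epsilon>) \<and> (\<forall>y\<in>A - C. norm (T S y) \<le> real N * \<epsilon>)"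
  using U(3)
proof (induction N arbitrary: P)
  case 0
  have "plateau 0 U P 0" using U 0 by (auto simp: plateau_def)
  then show ?case
    using M_nonneg linear_0[OF linear_T] by (intro exI[of _ 0] exI[of _ "{}"]) auto
next
  case (Suc N)
  \<comment> \<open>One application of \<open>R\<close> is kept back: the plateau of the stack must
    meet \<open>R P\<close> for \<open>step\<close> to place a plateau meeting \<open>P\<close>
    inside it.\<close>
  then have "U \<inter> (R ^^ N) (R P) \<noteq> {}" by (simp add: funpow_swap1)
  from Suc.IH[OF this] obtain S C where S: "plateau (real N) U (R P) S" and C: "closed C" "C \<subseteq> A" "C \<inter> B = {}"
    and SA: "\<And>y. y \<in> A \<Longrightarrow> norm (T S y) \<le> M + real N * \<epsilon>" and SC: "\<And>y. y \<in> A - C \<Longrightarrow> norm (T S y) \<le> real N * \<epsilon>"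
    by blast
  obtain V where V: "V \<subseteq> U" "open V" "V \<inter> R P \<noteq> {}" "\<forall>x\<in>V. S x = real N"
    using S unfolding plateau_def by blast
  obtain g where g: "plateau 1 V P g" and gs: "\<And>y. y \<in> C \<union> B \<Longrightarrow> norm (T g y) < \<epsilon>"
    using step[OF C V(2) _ V(3)] V(1) U(2) by blast
  have gM: "norm (T g y) \<le> M" for y
    using T_at_le[of g y] plateau_norm_le[OF g] M_nonneg mult_left_le order_trans by blast
  \<comment> \<open>\<open>C\<close> collects the points of \<open>A\<close> where some image has
    been large. Smallness on \<open>B\<close> keeps it disjoint from \<open>B\<close>, as the next
    use of \<open>step\<close> requires.\<close>
  let ?D = "{y \<in> A. \<epsilon> \<le> norm (T g y)}"
  have "closed {y. \<epsilon> \<le> norm (T g y)}"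
    by (intro closed_Collect_le continuous_intros) auto
  moreover have "?D = A \<inter> {y. \<epsilon> \<le> norm (T g y)}" by auto
  ultimately have "closed ?D" using A by (simp only: closed_Int)
  then have CD: "closed (C \<union> ?D)" "C \<union> ?D \<subseteq> A" "(C \<union> ?D) \<inter> B = {}"
    using C gs by (auto simp: not_le[symmetric])
  have tri: "norm (T (S + g) y) \<le> norm (T S y) + norm (T g y)" for y
    unfolding T_add_at by (rule norm_triangle_ineq)
  \<comment> \<open>\<open>M\<close> is paid only once: on \<open>C\<close> the new image is below
    \<open>\<epsilon>\<close>, and off \<open>C\<close> the old stack contributes at most
    \<open>N * \<epsilon>\<close>.\<close>
  have "norm (T (S + g) y) \<le> M + real (Suc N) * \<epsilon>" if y: "y \<in> A" for y
  proof (cases "y \<in> C")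
    case True
    then show ?thesis using tri[of y] SA[OF y] gs[of y] by (simp add: algebra_simps)
  next
    case False
    then show ?thesis using tri[of y] SC[of y] y gM[of y] \<epsilon> by (simp add: algebra_simps)
  qed
  moreover have "norm (T (S + g) y) \<le> real (Suc N) * \<epsilon>" if y: "y \<in> A - (C \<union> ?D)" for y
    using tri[of y] SC[of y] y by (auto simp: algebra_simps)
  moreover have "plateau (real (Suc N)) U P (S + g)"
    using plateau_add[OF S V(1,4) g] by (simp add: add.commute)
  ultimately show ?case using CD by blast
qed

text \<open>Near an accumulation point of \<open>P\<close> there are infinitely many disjointly
  supported plateau functions. At each of the finitely many \<open>y\<close> only finitely many
  images are large, so some function is small on all of \<open>A\<close>.\<close>

lemma plateau_small_on_finite:
  assumes A: "finite A" and \<epsilon>: "\<epsilon> > 0" and U: "open U" "U \<inter> derived_set P \<noteq> {}"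
  shows "\<exists>g. plateau 1 U P g \<and> (\<forall>y\<in>A. norm (T g y) < \<epsilon>)"
proof (rule ccontr)
  assume neg: "\<not> ?thesis"
  obtain x where x: "x \<in> U" "x islimpt P" using U(2) by (auto simp: derived_set_def)
  \<comment> \<open>\<open>W\<close> is the neighbourhood of the accumulation point that remains for
    later functions once \<open>V\<close> has been separated from it.\<close>
  define I where "I = (\<lambda>(V, W, g). open W \<and> x \<in> W \<and> W \<subseteq> U \<and> V \<subseteq> U \<and> V \<inter> W = {} \<and> plateau 1 V P g)"
  define J where "J = (\<lambda>(V :: 'k1 set, W, g :: 'k1 \<Rightarrow>\<^sub>C real) (V', W', g' :: 'k1 \<Rightarrow>\<^sub>C real). V' \<subseteq> W \<and> W' \<subseteq> (W :: 'k1 set))"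
  have ex: "\<exists>V W' g. I (V, W', g) \<and> V \<subseteq> W \<and> W' \<subseteq> W" if W: "open W" "x \<in> W" "W \<subseteq> U" for W
  proof -
    obtain p where p: "p \<in> P" "p \<in> W" "p \<noteq> x"
      using x(2) W(2,1) by (rule islimptE)
    obtain G H where GH: "open G" "open H" "p \<in> G" "x \<in> H" "G \<inter> H = {}"
      using hausdorff[OF p(3)] by blast
    obtain g where "plateau 1 (G \<inter> W) P g"
      using plateau_exists[OF compact1, of "G \<inter> W" P] GH W p by blast
    then have "I (G \<inter> W, H \<inter> W, g)"
      unfolding I_def using GH W by auto
    then show ?thesis by blast
  qed
  have "\<exists>f. \<forall>n :: nat. I (f n) \<and> J (f n) (f (Suc n))"
  proof (rule dependent_nat_choice)
    show "\<exists>s. I s" using ex[OF U(1) x(1)] by blast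
    fix s and n :: nat assume s: "I s"
    obtain V W g where sV: "s = (V, W, g)" by (cases s)
    have "\<exists>V' W' g'. I (V', W', g') \<and> V' \<subseteq> W \<and> W' \<subseteq> W"
      using s by (intro ex) (auto simp: sV I_def)
    then show "\<exists>t. I t \<and> J s t" by (auto simp: sV J_def)
  qed
  then obtain f where f: "\<And>n. I (f n)" "\<And>n. J (f n) (f (Suc n))" by auto
  define V where "V = (\<lambda>n. fst (f n))"
  define W where "W = (\<lambda>n. fst (snd (f n)))"
  define g where "g = (\<lambda>n. snd (snd (f n)))"
  have fn: "f n = (V n, W n, g n)" for n by (simp add: V_def W_def g_def)
  have VU: "V n \<subseteq> U" and VW: "V n \<inter> W n = {}" and pl: "plateau 1 (V n) P (g n)" for n
    using f(1)[of n] unfolding fn I_def by auto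
  have SV: "V (Suc n) \<subseteq> W n" and SW: "W (Suc n) \<subseteq> W n" for n
    using f(2)[of n] unfolding fn J_def by auto
  have Wanti: "W n \<subseteq> W m" if "m \<le> n" for m n
    using lift_Suc_antimono_le[of W, OF SW that] .
  have disj: "V m \<inter> V n = {}" if mn: "m < n" for m n
  proof -
    obtain n' where n': "n = Suc n'" "m \<le> n'" using mn by (cases n) auto
    then have "V n \<subseteq> W m" using SV[of n'] Wanti[of m n'] by auto
    then show ?thesis using VW[of m] by blast
  qed
  have "card {i\<in>F. g i z \<noteq> 0} \<le> 1" if "finite F" for z F
  proof -
    have "i = i'" if "g i z \<noteq> 0" "g i' z \<noteq> 0" for i i'
    proof -
      have "z \<in> V i" "z \<in> V i'" using that pl unfolding plateau_def by metis+
      then show ?thesis using disj[of i i'] disj[of i' i] by (metis disjoint_iff linorder_neqE_nat)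
    qed
    then show ?thesis using that by (auto simp: card_le_Suc0_iff_eq)
  qed
  moreover have "\<bar>g i z\<bar> \<le> 1" for i z
    using pl[of i] unfolding plateau_def by simp
  ultimately have bm: "bounded_multiples (M * real 1) (\<lambda>i. T (g i) y)" for y
    by (intro bounded_multiples_T)
  have "\<exists>y\<in>A. norm (T (g n) y) \<ge> \<epsilon>" for n
    using neg plateau_mono[OF pl[of n] VU subset_refl] by (meson not_le)
  then have "UNIV \<subseteq> (\<Union>y\<in>A. {n. norm (T (g n) y) \<ge> \<epsilon>})" by auto
  moreover have "finite (\<Union>y\<in>A. {n. norm (T (g n) y) \<ge> \<epsilon>})"
    using A finite_large[OF bm \<epsilon>] by auto
  ultimately show False
    using finite_subset infinite_UNIV_nat by blast
qed

text \<open>With the threshold \<open>c / 2\<close>, stacking \<open>N\<close> undetected functions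
  would give \<open>c * N \<le> M + N * (c / 2)\<close>, which fails for large
  \<open>N\<close>.\<close>

definition detected :: "'k1 set \<Rightarrow> 'k2 set \<Rightarrow> ('k1 \<Rightarrow>\<^sub>C real) \<Rightarrow> bool" where
  "detected U B g \<longleftrightarrow> (\<forall>x. \<bar>g x\<bar> \<le> 1) \<and> (\<forall>x. x \<notin> U \<longrightarrow> g x = 0) \<and> (\<exists>y\<in>B. norm (T g y) \<ge> c / 2)"

section \<open>Smallness on closed sets of small height\<close>

context
  fixes r :: "'o rel"
  assumes wo: "Well_order r"
begin

abbreviation D1 :: "'o \<Rightarrow> 'k1 set \<Rightarrow> 'k1 set" where "D1 \<equiv> omega_derivative r"
abbreviation D2 :: "'o \<Rightarrow> 'k2 set \<Rightarrow> 'k2 set" where "D2 \<equiv> omega_derivative r"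

text \<open>\<open>n\<close> measures \<open>A\<close> and \<open>m\<close> measures the room
  available in \<open>U\<close>, both in units of \<omega>^z. The point is that one \<open>m\<close>
  serves all \<open>A\<close>, \<open>P\<close> and \<open>U\<close>.\<close>

definition plateau_small_property :: "'o \<Rightarrow> nat \<Rightarrow> nat \<Rightarrow> real \<Rightarrow> bool" where
  "plateau_small_property z n m \<epsilon> \<longleftrightarrow>
     (\<forall>A P U. closed A \<longrightarrow> (D2 z ^^ n) A = {} \<longrightarrow> open U \<longrightarrow> U \<inter> (D1 z ^^ m) P \<noteq> {} \<longrightarrow>
        (\<exists>g. plateau 1 U P g \<and> (\<forall>y\<in>A. norm (T g y) < \<epsilon>)))"

text \<open>Outer induction on \<open>z\<close>, inner induction on \<open>n\<close>. From
  \<open>n\<close> to \<open>n + 1\<close>, the \<open>n\<close>-th derivative of \<open>A\<close>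
  is protected at every stage of the stacking, and dividing the stack by its height \<open>N\<close>
  makes its image small on the rest of \<open>A\<close>.\<close>

lemma plateau_small_on_small_height:
  assumes "z \<in> Field r" "\<epsilon> > 0"
  shows "\<exists>m. plateau_small_property z n m \<epsilon>"
  using assms
proof (induction z arbitrary: n \<epsilon> rule: wf_induct_rule[OF linear_facts(5)[OF wo]])
  case (1 z)
  note z = 1(2)
  \<comment> \<open>The \<open>w\<close> and \<open>k\<close> found by compactness vary with
    \<open>A\<close>, but one derivative of order \<omega>^z in K1 lies in all iterates for smaller
    exponents. So \<open>m = 1\<close> is uniform.\<close>
  have one: "plateau_small_property z 1 1 \<epsilon>" if \<epsilon>: "\<epsilon> > 0" for \<epsilon>
    unfolding plateau_small_property_def
  proof (intro allI impI)
    fix A P U assume A: "closed A" "(D2 z ^^ 1) A = {}" and U: "open U" "U \<inter> (D1 z ^^ 1) P \<noteq> {}"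
    have compA: "compact A" using compact2 A(1) closed_Int_compact[of A UNIV] by simp
    show "\<exists>g. plateau 1 U P g \<and> (\<forall>y\<in>A. norm (T g y) < \<epsilon>)"
    proof (cases "\<exists>w. (w, z) \<in> r \<and> w \<noteq> z")
      case True
      then obtain w0 where w0: "(w0, z) \<in> r" "w0 \<noteq> z" by blast
      obtain w k where w: "(w, z) \<in> r" "w \<noteq> z" "(D2 w ^^ k) A = {}"
        using omega_derivative_empty_compact[OF wo compA z w0] A(2) by auto
      have wF: "w \<in> Field r" using w(1) by (auto simp: Field_def)
      obtain m where m: "plateau_small_property w k m \<epsilon>"
        using 1(1)[of w \<epsilon> k] w wF \<epsilon> by auto
      have "U \<inter> (D1 w ^^ m) P \<noteq> {}"
        using U(2) omega_derivative_subset_funpow[OF wo z w(1,2), of P m] by auto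
      then show ?thesis
        using m A(1) w(3) U(1) unfolding plateau_small_property_def by blast
    next
      case False
      then have least: "\<And>w. (w, z) \<in> r \<Longrightarrow> w = z" by blast
      have dA: "derived_set A = {}" using A(2) omega_derivative_least[OF wo z least, of A] by simp
      have "finite A"
      proof (rule ccontr)
        assume "infinite A"
        then obtain y where "y \<in> A" "y islimpt A"
          using Heine_Borel_imp_Bolzano_Weierstrass[OF compA, of A] by auto
        then show False using dA by (auto simp: derived_set_def)
      qed
      moreover have "U \<inter> derived_set P \<noteq> {}"
        using U(2) omega_derivative_least[OF wo z least, of P] by simp
      ultimately show ?thesis using \<epsilon> U(1) by (intro plateau_small_on_finite)
    qed
  qed
  show ?case
    using 1(3)
  proof (induction n arbitrary: \<epsilon>)
    case 0
    have "plateau_small_property z 0 0 \<epsilon>"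
      unfolding plateau_small_property_def using plateau_exists[OF compact1] by auto
    then show ?case ..
  next
    case (Suc n)
    show ?case
    proof (cases "n = 0")
      case True
      then show ?thesis using one[OF Suc.prems] by auto
    next
      case n0: False
      obtain m where m: "plateau_small_property z n m (\<epsilon> / 2)"
        using Suc.IH[of "\<epsilon> / 2"] Suc.prems by auto
      \<comment> \<open>Half of \<open>\<epsilon>\<close> is spent on the stacking error; the
        averaged single large image, \<open>M / N\<close>, must stay below the other half.\<close>
      obtain N :: nat where N: "real N > 2 * M / \<epsilon>" using reals_Archimedean2 by blast
      have "0 \<le> 2 * M / \<epsilon>" using M_nonneg Suc.prems by simp
      with N have N0: "real N > 0" by linarith
      have "plateau_small_property z (Suc n) (m * N) \<epsilon>"
        unfolding plateau_small_property_def
      proof (intro allI impI)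
        fix A P U assume A: "closed A" "(D2 z ^^ Suc n) A = {}" and U: "open U" "U \<inter> (D1 z ^^ (m * N)) P \<noteq> {}"
        let ?B = "(D2 z ^^ n) A"
        have B: "closed ?B" "D2 z ?B = {}"
          using closed_omega_derivative_funpow[OF wo A(1)] A(2) by auto
        \<comment> \<open>One derivative already empties \<open>?B\<close>, and \<open>n > 0\<close>
          turns this into height at most \<open>n\<close>.\<close>
        have BB: "(D2 z ^^ n) ?B = {}"
        proof -
          obtain n' where "n = Suc n'" using n0 by (cases n) auto
          then have "(D2 z ^^ n) ?B = (D2 z ^^ n') (D2 z ?B)" by (simp only: funpow_Suc_right comp_apply)
          then show ?thesis
            using omega_derivative_funpow_subset[OF wo, of n' z "{}"] unfolding B(2) by auto
        qed
        have step: "\<exists>g. plateau 1 U' P' g \<and> (\<forall>y\<in>C \<union> ?B. norm (T g y) < \<epsilon> / 2)"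
          if C: "closed C" "C \<subseteq> A" "C \<inter> ?B = {}" and U': "open U'" "U' \<subseteq> U" "U' \<inter> (D1 z ^^ m) P' \<noteq> {}" for C P' U'
        proof -
          \<comment> \<open>\<open>C\<close> avoids the \<open>n\<close>-th derivative of
            \<open>A\<close>, so its own is empty, and \<open>C \<union> ?B\<close> falls under the
            induction hypothesis.\<close>
          have "(D2 z ^^ n) C \<subseteq> C \<inter> ?B"
            using omega_derivative_funpow_subset[OF wo] omega_derivative_funpow_mono[OF wo C(2)] by auto
          then have "(D2 z ^^ n) (C \<union> ?B) = {}"
            using omega_derivative_funpow_Un[OF wo C(1) B(1), of n z] C(3) BB by auto
          then show ?thesis
            using m C(1) B(1) U'(1,3) unfolding plateau_small_property_def by blast
        qed
        have "U \<inter> ((D1 z ^^ m) ^^ N) P \<noteq> {}" using U(2) by (simp add: funpow_mult)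
        moreover have "\<epsilon> / 2 > 0" using Suc.prems by simp
        ultimately obtain S where S: "plateau (real N) U P S" "\<forall>y\<in>A. norm (T S y) \<le> M + real N * (\<epsilon> / 2)"
          using plateau_stack[OF A(1) _ step U(1) subset_refl] by blast
        have "plateau 1 U P ((1 / real N) *\<^sub>R S)"
          using plateau_scale[OF S(1), of "1 / real N"] N0 by simp
        moreover have "norm (T ((1 / real N) *\<^sub>R S) y) < \<epsilon>" if "y \<in> A" for y
        proof -
          have "M < real N * (\<epsilon> / 2)" using N Suc.prems by (simp add: field_simps)
          then have "norm (T S y) < real N * \<epsilon>" using S(2) that by fastforce
          then show ?thesis
            unfolding T_scale_at using N0 by (simp add: field_simps)
        qed
        ultimately show "\<exists>g. plateau 1 U P g \<and> (\<forall>y\<in>A. norm (T g y) < \<epsilon>)" by blast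
      qed
      then show ?thesis ..
    qed
  qed
qed

text \<open>If nothing supported in \<open>U\<close> is detected, plateau functions in
  \<open>U\<close> have small images on the \<open>n\<close>-th derivative, and
  \<open>plateau_small_property\<close> handles the closed sets avoiding it. Stacking over all of K2
  then gives a function of norm at least \<open>N\<close> whose image contradicts
  \<open>T_lower\<close>.\<close>

lemma large_on_omega_derivative:
  assumes z: "z \<in> Field r"
  obtains m where "\<And>U. open U \<Longrightarrow> U \<inter> (D1 z ^^ m) UNIV \<noteq> {} \<Longrightarrow>
     \<exists>g. detected U ((D2 z ^^ n) UNIV) g"
proof -
  obtain m where m: "plateau_small_property z n m (c / 2)"
    using plateau_small_on_small_height[OF z, of "c / 2" n] c_pos by auto
  obtain N :: nat where N: "real N > 2 * M / c" using reals_Archimedean2 by blast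
  let ?B = "(D2 z ^^ n) UNIV"
  show thesis
  proof (rule that[of "m * N"], rule ccontr)
    fix U assume U: "open U" "U \<inter> (D1 z ^^ (m * N)) UNIV \<noteq> {}"
      and nd: "\<not> (\<exists>g. detected U ?B g)"
    have neg: "norm (T g y) < c / 2" if g: "plateau 1 U' P g" "U' \<subseteq> U" and y: "y \<in> ?B" for g U' P y
    proof (rule ccontr)
      assume "\<not> norm (T g y) < c / 2"
      moreover have "\<bar>g x\<bar> \<le> 1" "x \<notin> U \<Longrightarrow> g x = 0" for x
        using g unfolding plateau_def by auto
      ultimately have "detected U ?B g"
        unfolding detected_def using y not_less by blast
      then show False using nd by blast
    qed
    have step: "\<exists>g. plateau 1 U' P g \<and> (\<forall>y\<in>C \<union> ?B. norm (T g y) < c / 2)"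
      if C: "closed C" "C \<subseteq> UNIV" "C \<inter> ?B = {}" and U': "open U'" "U' \<subseteq> U" "U' \<inter> (D1 z ^^ m) P \<noteq> {}" for C P U'
    proof -
      have "(D2 z ^^ n) C \<subseteq> C \<inter> ?B"
        using omega_derivative_funpow_subset[OF wo] omega_derivative_funpow_mono[OF wo C(2)] by auto
      then obtain g where g: "plateau 1 U' P g" "\<forall>y\<in>C. norm (T g y) < c / 2"
        using m C(1,3) U'(1,3) unfolding plateau_small_property_def by blast
      have "norm (T g y) < c / 2" if "y \<in> ?B" for y
        using g(1) U'(2) that by (rule neg)
      then show ?thesis using g by blast
    qed
    have "U \<inter> ((D1 z ^^ m) ^^ N) UNIV \<noteq> {}" using U(2) by (simp add: funpow_mult)
    moreover have "c / 2 > 0" using c_pos by simp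
    ultimately obtain S where S: "plateau (real N) U UNIV S" "\<forall>y\<in>UNIV. norm (T S y) \<le> M + real N * (c / 2)"
      using plateau_stack[OF closed_UNIV _ step U(1) subset_refl] by blast
    have "c * real N \<le> c * norm S"
      using plateau_norm_ge[OF S(1)] c_pos by (intro mult_left_mono) auto
    also have "\<dots> \<le> norm (T S)" by (rule T_lower)
    also have "\<dots> \<le> M + real N * (c / 2)" using S(2) by (intro norm_bound) blast
    finally show False using N c_pos by (simp add: field_simps)
  qed
qed

end

lemma large_somewhere:
  assumes "open U" "U \<noteq> {}"
  shows "\<exists>g. detected U UNIV g"
proof -
  obtain g where g: "plateau 1 U UNIV g"
    using plateau_exists[OF compact1 assms(1), of UNIV] assms(2) by auto
  have "\<exists>y. norm (T g y) \<ge> c / 2"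
  proof (rule ccontr)
    assume "\<not> ?thesis"
    then have "norm (T g) \<le> c / 2" by (intro norm_bound) (auto simp: not_le less_imp_le)
    moreover have "c * 1 \<le> c * norm g"
      using plateau_norm_ge[OF g] c_pos by (intro mult_left_mono) auto
    ultimately show False using T_lower[of g] c_pos by simp
  qed
  then show ?thesis using g unfolding detected_def plateau_def by (intro exI[of _ g]) auto
qed

end

section \<open>Families of open sets and cellularity\<close>

lemma card_min_mono:
  assumes "R \<noteq> {}" "\<forall>s\<in>R. Well_order s" "\<forall>r\<in>Q. Well_order r"
    and "\<And>s. s \<in> R \<Longrightarrow> \<exists>r\<in>Q. r \<le>o s"
  shows "card_min Q \<le>o card_min R"
proof -
  have "card_min R \<in> R" using assms(1,2) by (rule card_min_props)
  from assms(4)[OF this] obtain r where r: "r \<in> Q" "r \<le>o card_min R" by blast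
  have "Q \<noteq> {}" using r by blast
  from card_min_props(2)[OF this assms(3) r(1)] show ?thesis
    using r(2) by (rule ordLeq_transitive)
qed

lemma Well_order_card_sup: "Well_order (card_sup F)"
  using card_sup_Card_order card_order_on_well_order_on by blast

lemma has_order_1_disjoint: "disjoint \<U> \<Longrightarrow> has_order \<U> 1"
  unfolding has_order_def
proof
  fix x assume d: "disjoint \<U>"
  have "U = V" if "U \<in> \<U>" "V \<in> \<U>" "x \<in> U" "x \<in> V" for U V
    using d that by (auto simp: pairwise_def disjnt_def)
  then have sub: "{U \<in> \<U>. x \<in> U} \<subseteq> {THE U. U \<in> \<U> \<and> x \<in> U}"
    by (auto intro!: the_equality[symmetric])
  show "finite {U \<in> \<U>. x \<in> U} \<and> card {U \<in> \<U>. x \<in> U} \<le> 1"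
    using finite_subset[OF sub] card_mono[OF _ sub] by simp
qed

lemma point_bounded_imp_point_finite: "point_bounded \<U> \<Longrightarrow> point_finite \<U>"
  by (auto simp: point_bounded_def point_finite_def has_order_def)

lemma finite_imp_point_bounded: "finite \<U> \<Longrightarrow> point_bounded \<U>"
  unfolding point_bounded_def has_order_def
  by (intro exI[of _ "card \<U>"] allI conjI card_mono) auto

lemma cellularity_le_c_pb:
  "cellularity TYPE('a::topological_space) \<le>o c_pb (UNIV :: 'a set)"
  unfolding cellularity_def
proof (rule card_sup_least)
  show "Card_order (c_pb (UNIV :: 'a set))"
    unfolding c_pb_def by (rule card_sup_Card_order)
  fix \<U> :: "'a set set" assume "\<U> \<in> {\<U>. open_family \<U> \<and> disjoint \<U>}"
  then have "\<U> \<in> {\<U>. open_family \<U> \<and> point_bounded \<U> \<and> meeting \<U> UNIV}"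
    using has_order_1_disjoint by (auto simp: point_bounded_def meeting_def open_family_def)
  then show "|\<U>| \<le>o c_pb (UNIV :: 'a set)"
    unfolding c_pb_def by (rule card_sup_upper)
qed

text \<open>Complements of points, all containing one fixed point of \<open>B\<close>. A finite
  family is point-bounded however much it overlaps, so these make \<open>c_pb B\<close> and
  \<open>c_pf B\<close> infinite.\<close>

lemma large_finite_open_families:
  fixes B :: "'a::t1_space set"
  assumes "infinite (UNIV :: 'a set)" "B \<noteq> {}"
  shows "\<exists>\<U>. finite \<U> \<and> card \<U> = n \<and> open_family \<U> \<and> meeting \<U> B"
proof -
  obtain y where y: "y \<in> B" using assms(2) by blast
  have "infinite (UNIV - {y})" using assms(1) by simp
  then obtain X where X: "finite X" "card X = n" "X \<subseteq> UNIV - {y}"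
    using infinite_arbitrarily_large by metis
  have inj: "inj_on (\<lambda>x. - {x}) X" by (auto simp: inj_on_def)
  have mem: "y \<in> V" if "V \<in> (\<lambda>x. - {x}) ` X" for V
    using that X(3) by auto
  have op: "open V" if "V \<in> (\<lambda>x. - {x}) ` X" for V
    using that by (auto simp: open_Compl)
  have "open_family ((\<lambda>x. - {x}) ` X)" "meeting ((\<lambda>x. - {x}) ` X) B"
    unfolding open_family_def meeting_def using mem op y by blast+
  then show ?thesis
    using X(1,2) card_image[OF inj] by (intro exI[of _ "(\<lambda>x. - {x}) ` X"]) auto
qed

lemma infinite_Field_c_pb:
  fixes B :: "'a::t1_space set"
  assumes "infinite (UNIV :: 'a set)" "B \<noteq> {}"
  shows "\<not> finite (Field (c_pb B))" and "\<not> finite (Field (c_pf B))"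
proof -
  have *: "\<exists>\<U> :: 'a set set. finite \<U> \<and> card \<U> = n \<and> ( |\<U>| \<le>o c_pb B) \<and> ( |\<U>| \<le>o c_pf B)" for n
  proof -
    obtain \<U> :: "'a set set" where \<U>: "finite \<U>" "card \<U> = n" "open_family \<U>" "meeting \<U> B"
      using large_finite_open_families[OF assms] by blast
    have "point_bounded \<U>" "point_finite \<U>"
      using finite_imp_point_bounded[OF \<U>(1)] point_bounded_imp_point_finite by auto
    then have "|\<U>| \<le>o c_pb B" "|\<U>| \<le>o c_pf B"
      unfolding c_pb_def c_pf_def using \<U> by (auto intro!: card_sup_upper)
    then show ?thesis using \<U> by blast
  qed
  have co: "Card_order (c_pb B)" "Card_order (c_pf B)"
    unfolding c_pf_def c_pb_def by (rule card_sup_Card_order)+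
  show "\<not> finite (Field (c_pb B))"
    using co(1) by (rule infinite_Field_if_large_finite) (use * in blast)
  show "\<not> finite (Field (c_pf B))"
    using co(2) by (rule infinite_Field_if_large_finite) (use * in blast)
qed

lemma large_finite_disjoint_families:
  fixes W :: "'a::t2_space set"
  assumes "open W" "infinite W"
  shows "\<exists>\<U>. finite \<U> \<and> card \<U> = n \<and> open_family \<U> \<and> disjoint \<U> \<and> \<Union>\<U> \<subseteq> W"
  using assms
proof (induction n arbitrary: W)
  case 0
  show ?case by (intro exI[of _ "{}"]) (auto simp: open_family_def)
next
  case (Suc n)
  obtain x where x: "x \<in> W" using Suc.prems(2) by fastforce
  have "W - {x} \<noteq> {}" using infinite_remove[OF Suc.prems(2), of x] infinite_imp_nonempty by blast
  then obtain y where y: "y \<in> W" "y \<noteq> x" by blast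
  obtain G H where GH: "open G" "open H" "x \<in> G" "y \<in> H" "G \<inter> H = {}"
    using hausdorff[of x y] y by blast
  have "\<exists>V W'. open V \<and> V \<noteq> {} \<and> V \<subseteq> W \<and> open W' \<and> infinite W' \<and> W' \<subseteq> W \<and> V \<inter> W' = {}"
  proof (cases "finite (H \<inter> W)")
    case False
    then show ?thesis
      using GH x y Suc.prems(1) by (intro exI[of _ "G \<inter> W"] exI[of _ "H \<inter> W"]) auto
  next
    case True
    \<comment> \<open>In a Hausdorff space the points of a finite open set are isolated, so
      \<open>{y}\<close> can be split off.\<close>
    have "closed (H \<inter> W - {y})" using True by (intro finite_imp_closed) auto
    then have "open (H \<inter> W - (H \<inter> W - {y}))"
      using GH(2) Suc.prems(1) by (intro open_Diff open_Int)
    also have "H \<inter> W - (H \<inter> W - {y}) = {y}" using GH y by auto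
    finally have "open {y}" .
    moreover have "open (W - {y})" "infinite (W - {y})" using Suc.prems by auto
    ultimately show ?thesis
      using y by (intro exI[of _ "{y}"] exI[of _ "W - {y}"]) auto
  qed
  then obtain V W' where V: "open V" "V \<noteq> {}" "V \<subseteq> W" and W': "open W'" "infinite W'" "W' \<subseteq> W" "V \<inter> W' = {}"
    by blast
  from Suc.IH[OF W'(1,2)] obtain \<U>
    where \<U>: "finite \<U>" "card \<U> = n" "open_family \<U>" "disjoint \<U>" "\<Union>\<U> \<subseteq> W'"
    by (elim exE conjE)
  have "V \<notin> \<U>" using \<U>(5) V(2) W'(4) by blast
  moreover have "disjoint (insert V \<U>)"
    using \<U>(4,5) W'(4) by (auto simp: pairwise_insert disjnt_def)
  ultimately show ?case
    using \<U> V W'(3) by (intro exI[of _ "insert V \<U>"]) (auto simp: open_family_def)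
qed

text \<open>By the Baire property, every member of a point-finite family contains a nonempty open set on
  which the finite subfamily of the members through a point is constant. The open sets obtained for
  different subfamilies are disjoint.\<close>

lemma c_pf_le_cellularity:
  assumes comp: "compact (UNIV :: 'a::t2_space set)" and inf: "infinite (UNIV :: 'a set)"
  shows "c_pf (UNIV :: 'a set) \<le>o cellularity TYPE('a)"
proof -
  let ?r = "cellularity TYPE('a)"
  have r: "Card_order ?r" unfolding cellularity_def by (rule card_sup_Card_order)
  have up: "|\<U>| \<le>o ?r" if "open_family \<U>" "disjoint \<U>" for \<U> :: "'a set set"
    unfolding cellularity_def using that by (intro card_sup_upper) auto
  have infr: "\<not> finite (Field ?r)"
  proof (rule infinite_Field_if_large_finite[OF r])
    fix n
    from large_finite_disjoint_families[OF open_UNIV inf, of n] obtain \<U> :: "'a set set"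
      where "finite \<U>" "card \<U> = n" "open_family \<U>" "disjoint \<U>" by (elim exE conjE)
    then show "\<exists>\<U> :: 'a set set. finite \<U> \<and> card \<U> = n \<and> ( |\<U>| \<le>o ?r)"
      using up by blast
  qed
  show ?thesis
    unfolding c_pf_def
  proof (rule card_sup_least[OF r])
    fix \<V> :: "'a set set" assume "\<V> \<in> {\<U>. open_family \<U> \<and> point_finite \<U> \<and> meeting \<U> UNIV}"
    then have op: "\<And>V. V \<in> \<V> \<Longrightarrow> open V" "\<And>V. V \<in> \<V> \<Longrightarrow> V \<noteq> {}"
      and pf: "\<And>x. finite {V \<in> \<V>. x \<in> V}" by (auto simp: open_family_def point_finite_def)
    let ?S = "\<lambda>x. {V \<in> \<V>. x \<in> V}"
    let ?G = "\<lambda>S. interior {x. ?S x = S}"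
    define \<G> where "\<G> = {S. finite S \<and> S \<subseteq> \<V> \<and> ?G S \<noteq> {}}"
    have nbhd: "open (\<Inter>(?S x))" "x \<in> \<Inter>(?S x)" for x
      using op(1) by (auto intro: open_Inter pf)
    have sub: "?S x \<subseteq> ?S y" if "y \<in> \<Inter>(?S x)" for x y
      using that by blast
    have G_sub: "?G S \<subseteq> {x. ?S x = S}" for S by (rule interior_subset)
    have inj: "inj_on ?G \<G>"
    proof (rule inj_onI)
      fix S S' assume S: "S \<in> \<G>" "S' \<in> \<G>" "?G S = ?G S'"
      then obtain x where "x \<in> ?G S" "x \<in> ?G S'" unfolding \<G>_def by blast
      then show "S = S'" using G_sub by blast
    qed
    have "disjoint (?G ` \<G>)"
    proof (rule pairwiseI)
      fix A B assume "A \<in> ?G ` \<G>" "B \<in> ?G ` \<G>" "A \<noteq> B"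
      then show "disjnt A B" using G_sub unfolding disjnt_def by blast
    qed
    moreover have "open_family (?G ` \<G>)"
      unfolding open_family_def \<G>_def by auto
    ultimately have "|?G ` \<G>| \<le>o ?r" by (intro up)
    moreover have "|\<G>| =o |?G ` \<G>|"
      using inj_on_imp_bij_betw[OF inj] card_of_ordIso by blast
    ultimately have G_le: "|\<G>| \<le>o ?r" by (rule ordIso_ordLeq_trans[rotated])
    have "\<V> \<subseteq> \<Union>\<G>"
    proof
      fix V assume V: "V \<in> \<V>"
      \<comment> \<open>Points near \<open>x\<close> lie in every member through \<open>x\<close>,
        so multiplicity cannot drop nearby and \<open>F n\<close> is closed. By point-finiteness
        these sets cover the space.\<close>
      define F where "F = (\<lambda>n. {x. card (?S x) \<le> n})"
      have clF: "closed (F n)" for n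
      proof -
        have "open (- F n)"
        proof (subst open_subopen, intro ballI)
          fix x assume x: "x \<in> - F n"
          have "\<Inter>(?S x) \<subseteq> - F n"
          proof
            fix y assume "y \<in> \<Inter>(?S x)"
            from card_mono[OF pf sub[OF this]] show "y \<in> - F n" using x by (auto simp: F_def)
          qed
          then show "\<exists>T. open T \<and> x \<in> T \<and> T \<subseteq> - F n" using nbhd[of x] by blast
        qed
        then show ?thesis by (simp add: closed_def)
      qed
      have "\<exists>n. interior (F n) \<inter> V \<noteq> {}"
      proof (rule ccontr)
        assume neg: "\<not> ?thesis"
        \<comment> \<open>Intersecting with \<open>closure V\<close> localizes the Baire argument:
          the sets \<open>?T n\<close> cover \<open>V\<close>, and a nonempty interior within
          \<open>closure V\<close> would meet \<open>V\<close>.\<close>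
        let ?T = "\<lambda>n. F n \<inter> closure V"
        have "interior (?T n) = {}" for n
        proof (rule ccontr)
          assume "interior (?T n) \<noteq> {}"
          moreover have "interior (?T n) \<subseteq> closure V" using interior_subset by blast
          ultimately have "interior (?T n) \<inter> V \<noteq> {}"
            using open_Int_closure_eq_empty[OF open_interior, of "?T n" V] by blast
          moreover have "interior (?T n) \<subseteq> interior (F n)" by (intro interior_mono) auto
          ultimately show False using neg by blast
        qed
        have "(euclidean :: 'a topology) interior_of \<Union>(range ?T) = {}"
        proof (rule Baire_category_alt)
          have c: "compact_space (euclidean :: 'a topology)"
            using comp by (simp add: compact_space_def)
          moreover have "Hausdorff_space (euclidean :: 'a topology)"
            unfolding Hausdorff_space_def using hausdorff by (fastforce simp: disjnt_def)
          ultimately have "regular_space (euclidean :: 'a topology)"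
            by (intro compact_Hausdorff_imp_regular_space)
          then show "completely_metrizable_space (euclidean :: 'a topology) \<or>
              locally_compact_space (euclidean :: 'a topology) \<and> regular_space (euclidean :: 'a topology)"
            using c by (simp add: compact_imp_locally_compact_space)
          fix T assume "T \<in> range ?T"
          then show "closedin euclidean T \<and> euclidean interior_of T = {}"
            using clF \<open>\<And>n. interior (?T n) = {}\<close> by (auto intro: closed_Int)
        qed auto
        then have "interior (\<Union>(range ?T)) = {}" by simp
        moreover have "V \<subseteq> \<Union>(range ?T)"
          using closure_subset[of V] by (auto simp: F_def)
        ultimately show False
          using interior_maximal[OF _ op(1)[OF V]] op(2)[OF V] by blast
      qed
      then obtain n where n: "interior (F n) \<inter> V \<noteq> {}" by blast
      let ?O = "interior (F n) \<inter> V"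
      have "card (?S x) \<le> n" if "x \<in> ?O" for x
        using that interior_subset[of "F n"] by (auto simp: F_def)
      then have bd: "\<forall>x. x \<in> ?O \<longrightarrow> card (?S x) < Suc n" by (auto simp: less_Suc_eq_le)
      obtain x0 where "x0 \<in> ?O" using n by blast
      \<comment> \<open>At a point of maximal multiplicity no further member can appear nearby, so
        the subfamily is locally constant.\<close>
      then obtain x where x: "x \<in> ?O" "\<And>y. y \<in> ?O \<Longrightarrow> card (?S y) \<le> card (?S x)"
        using ex_has_greatest_nat[of "\<lambda>x. x \<in> ?O" x0 "\<lambda>x. card (?S x)" "Suc n"] bd by blast
      have "interior (F n) \<inter> \<Inter>(?S x) \<subseteq> {y. ?S y = ?S x}"
      proof
        fix y assume y: "y \<in> interior (F n) \<inter> \<Inter>(?S x)"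
        then have "y \<in> ?O" using x(1) V by blast
        from card_seteq[OF pf sub x(2)[OF this]] show "y \<in> {y. ?S y = ?S x}" using y by blast
      qed
      then have "interior (F n) \<inter> \<Inter>(?S x) \<subseteq> ?G (?S x)"
        using nbhd[of x] by (intro interior_maximal) auto
      then have "?G (?S x) \<noteq> {}" using x(1) nbhd(2)[of x] by blast
      then have "?S x \<in> \<G>" unfolding \<G>_def using pf by auto
      then show "V \<in> \<Union>\<G>" using x(1) V by blast
    qed
    then have "|\<V>| \<le>o |\<Union>\<G>|" by (rule card_of_mono1)
    also have "|\<Union>S\<in>\<G>. S| \<le>o ?r"
    proof (rule card_of_UNION_ordLeq_infinite_Field[OF infr r G_le], rule ballI)
      fix S assume "S \<in> \<G>"
      then have "|S| <o |Field ?r|"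
        using finite_ordLess_infinite[OF card_of_Well_order card_of_Well_order, of S "Field ?r"] infr
        by (simp add: Field_card_of \<G>_def)
      then show "|S| \<le>o ?r"
        by (rule ordLeq_ordIso_trans[OF ordLess_imp_ordLeq card_of_Field_ordIso[OF r]])
    qed
    then have "|\<Union>\<G>| \<le>o ?r" by simp
    finally show "|\<V>| \<le>o ?r" .
  qed
qed

section \<open>Carrying families of open sets from K1 to K2\<close>

context function_space_embedding
begin

lemma transfer_family:
  assumes det: "\<And>U. open U \<Longrightarrow> U \<inter> P \<noteq> {} \<Longrightarrow> \<exists>g. detected U B g"
    and \<U>: "open_family \<U>" "point_bounded \<U>" "meeting \<U> P"
  obtains F where "\<And>U. U \<in> \<U> \<Longrightarrow> open (F U) \<and> B \<inter> F U \<noteq> {}" "\<And>y. finite {U \<in> \<U>. y \<in> F U}"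
    "nontrivial_cotype TYPE('e) \<Longrightarrow> \<exists>n. \<forall>y. card {U \<in> \<U>. y \<in> F U} \<le> n"
proof -
  obtain k where k: "has_order \<U> k" using \<U>(2) by (auto simp: point_bounded_def)
  have "\<forall>U\<in>\<U>. \<exists>g. detected U B g"
    using det \<U>(1,3) by (auto simp: open_family_def meeting_def Int_commute)
  then obtain g where g: "\<And>U. U \<in> \<U> \<Longrightarrow> detected U B (g U)" unfolding bchoice_iff by blast
  \<comment> \<open>Extended by 0, since \<open>bounded_multiples\<close> runs over all indices of
    the type.\<close>
  define f where "f = (\<lambda>U. if U \<in> \<U> then g U else 0)"
  have f1: "\<bar>f U x\<bar> \<le> 1" for U x
    using g[of U] by (simp add: f_def detected_def)
  have "card {U \<in> \<F>. f U x \<noteq> 0} \<le> k" for x \<F>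
  proof -
    have "{U \<in> \<F>. f U x \<noteq> 0} \<subseteq> {U \<in> \<U>. x \<in> U}"
      using g unfolding f_def detected_def by (auto split: if_splits)
    then show ?thesis
      using k unfolding has_order_def by (meson card_mono order_trans)
  qed
  then have bm: "bounded_multiples (M * real k) (\<lambda>U. T (f U) y)" for y
    by (intro bounded_multiples_T f1)
  \<comment> \<open>A level strictly below \<open>c / 2\<close>, so that a strict inequality, hence
    an open set, still contains the detected point of \<open>B\<close>.\<close>
  define F where "F = (\<lambda>U. {y. norm (T (f U) y) > c / 4})"
  have sub: "{U \<in> \<U>. y \<in> F U} \<subseteq> {U. norm (T (f U) y) \<ge> c / 4}" for y by (auto simp: F_def)
  have c4: "c / 4 > 0" using c_pos by simp
  show thesis
  proof (rule that)
    show "open (F U) \<and> B \<inter> F U \<noteq> {}" if U: "U \<in> \<U>" for U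
    proof
      show "open (F U)" unfolding F_def by (intro open_Collect_less continuous_intros) auto
      obtain y where y: "y \<in> B" "norm (T (f U) y) \<ge> c / 2"
        using g[OF U] U by (auto simp: detected_def f_def)
      then have "y \<in> F U" unfolding F_def using c_pos by simp
      then show "B \<inter> F U \<noteq> {}" using y(1) by blast
    qed
    show "finite {U \<in> \<U>. y \<in> F U}" for y
      using finite_subset[OF sub finite_large[OF bm c4]] .
    assume cot: "nontrivial_cotype TYPE('e)"
    obtain n where n: "\<And>e :: 'k1 set \<Rightarrow> 'e. bounded_multiples (M * real k) e \<Longrightarrow>
        finite {i. norm (e i) \<ge> c / 4} \<and> card {i. norm (e i) \<ge> c / 4} \<le> n"
      using nontrivial_cotype_imp_bounded_large[OF cot c4] by blast
    have "card {U \<in> \<U>. y \<in> F U} \<le> n" for y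
      using n[OF bm[of y]] card_mono[OF _ sub[of y]] order_trans by blast
    then show "\<exists>n. \<forall>y. card {U \<in> \<U>. y \<in> F U} \<le> n" by blast
  qed
qed

lemma c_pb_transfer:
  assumes det: "\<And>U. open U \<Longrightarrow> U \<inter> P \<noteq> {} \<Longrightarrow> \<exists>g. detected U B g"
    and inf: "infinite (UNIV :: 'k2 set)"
  shows "c_pb P \<le>o c_pf B" and "nontrivial_cotype TYPE('e) \<Longrightarrow> c_pb P \<le>o c_pb B"
proof -
  have co: "Card_order (c_pf B)" "Card_order (c_pb B)"
    unfolding c_pf_def c_pb_def by (rule card_sup_Card_order)+
  have main: "|\<U>| \<le>o c_pf B \<and> (nontrivial_cotype TYPE('e) \<longrightarrow> |\<U>| \<le>o c_pb B)"
    if \<U>: "open_family \<U>" "point_bounded \<U>" "meeting \<U> P" for \<U>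
  proof (cases "\<U> = {}")
    \<comment> \<open>An empty family says nothing about \<open>B\<close>, which could then be
      empty; otherwise \<open>B\<close> is nonempty and the target cardinals are infinite.\<close>
    case True
    then show ?thesis
      using card_of_empty1 co card_order_on_well_order_on by blast
  next
    case False
    obtain F where F: "\<And>U. U \<in> \<U> \<Longrightarrow> open (F U) \<and> B \<inter> F U \<noteq> {}" "\<And>y. finite {U \<in> \<U>. y \<in> F U}"
        "nontrivial_cotype TYPE('e) \<Longrightarrow> \<exists>n. \<forall>y. card {U \<in> \<U>. y \<in> F U} \<le> n"
      by (rule transfer_family[OF det \<U>]) blast+
    have B: "B \<noteq> {}" using False F(1) by blast
    have img: "{V \<in> F ` \<U>. y \<in> V} = F ` {U \<in> \<U>. y \<in> F U}" for y by auto
    have FU: "open_family (F ` \<U>)" "meeting (F ` \<U>) B"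
      using F(1) by (auto simp: open_family_def meeting_def)
    \<comment> \<open>All indices with the same value \<open>V\<close> are counted at any one point
      of \<open>V\<close>.\<close>
    have fib: "finite {U \<in> \<U>. F U = V}" if V: "V \<in> F ` \<U>" for V
    proof -
      obtain y where "y \<in> V" using V F(1) by blast
      then have "{U \<in> \<U>. F U = V} \<subseteq> {U \<in> \<U>. y \<in> F U}" by auto
      then show ?thesis using F(2) by (rule finite_subset)
    qed
    have "point_finite (F ` \<U>)"
      unfolding point_finite_def img using F(2) by blast
    then have "|F ` \<U>| \<le>o c_pf B"
      unfolding c_pf_def using FU by (intro card_sup_upper) auto
    from card_of_finite_to_one[OF co(1) infinite_Field_c_pb(2)[OF inf B] this subset_refl fib]
    have 1: "|\<U>| \<le>o c_pf B" .
    have 2: "|\<U>| \<le>o c_pb B" if cot: "nontrivial_cotype TYPE('e)"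
    proof -
      obtain n where n: "\<And>y. card {U \<in> \<U>. y \<in> F U} \<le> n" using F(3)[OF cot] by blast
      have "has_order (F ` \<U>) n"
        unfolding has_order_def img using F(2) n card_image_le order_trans by blast
      then have "|F ` \<U>| \<le>o c_pb B"
        unfolding c_pb_def using FU by (intro card_sup_upper) (auto simp: point_bounded_def)
      from card_of_finite_to_one[OF co(2) infinite_Field_c_pb(1)[OF inf B] this subset_refl fib]
      show ?thesis .
    qed
    show ?thesis using 1 2 by blast
  qed
  show "c_pb P \<le>o c_pf B"
    by (subst c_pb_def, rule card_sup_least[OF co(1)]) (use main in blast)
  show "c_pb P \<le>o c_pb B" if "nontrivial_cotype TYPE('e)"
    by (subst c_pb_def, rule card_sup_least[OF co(2)]) (use main that in blast)
qed

end

section \<open>The perfect kernel\<close>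

text \<open>Otherwise each \<open>S z\<close> has a point outside its derived set. These points are
  distinct, because later sets lie in the earlier derived sets, and so the power set of
  \<open>'a\<close> would inject into \<open>'a\<close>.\<close>

lemma decreasing_stabilizes:
  fixes S :: "'a::topological_space set \<Rightarrow> 'a set" and r :: "'a set rel"
  assumes "Well_order r" "Field r = UNIV"
    and dec: "\<And>z z'. (z, z') \<in> r \<Longrightarrow> z \<noteq> z' \<Longrightarrow> S z' \<subseteq> derived_set (S z)"
  shows "\<exists>z. S z \<subseteq> derived_set (S z)"
proof (rule ccontr)
  assume "\<not> ?thesis"
  then have "\<forall>z. \<exists>x. x \<in> S z - derived_set (S z)" by blast
  then obtain p where p: "\<And>z. p z \<in> S z - derived_set (S z)" unfolding choice_iff by blast
  have ne: "p z \<noteq> p z'" if "(z, z') \<in> r" "z \<noteq> z'" for z z'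
    using p[of z] p[of z'] dec[OF that] by auto
  have "inj p"
  proof (rule injI, rule ccontr)
    fix z z' assume zz: "p z = p z'" "z \<noteq> z'"
    have "Total r" using assms(1) by (auto simp: order_on_defs)
    then have "(z, z') \<in> r \<or> (z', z) \<in> r"
      using zz(2) assms(2) by (auto simp: total_on_def)
    then show False using ne[of z z'] ne[of z' z] zz by auto
  qed
  then have "inv p ` UNIV = Pow UNIV" using inj_imp_surj_inv by auto
  then show False using Cantors_theorem[of "UNIV :: 'a set"] by blast
qed

text \<open>Along a well-order of the power set some derivative lies in its own derived set, and
  from there on nothing changes. Two eventual values agree, since the later of their stages has
  both, so \<open>THE\<close> is justified.\<close>

lemma
  fixes X :: "'a::topological_space set"
  shows perfect_kernel_perfect: "perfect_kernel X \<subseteq> derived_set (perfect_kernel X)"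
    and perfect_kernel_greatest: "S \<subseteq> derived_set S \<Longrightarrow> S \<subseteq> X \<Longrightarrow> S \<subseteq> perfect_kernel X"
proof -
  let ?r = "|UNIV :: 'a set set|"
  have wo: "Well_order ?r" by (rule card_of_Well_order)
  have "\<exists>z. cb_derivative X (seg ?r z) \<subseteq> derived_set (cb_derivative X (seg ?r z))"
  proof (rule decreasing_stabilizes[OF wo])
    show "Field ?r = UNIV" by (rule Field_card_of)
    show "cb_derivative X (seg ?r z') \<subseteq> derived_set (cb_derivative X (seg ?r z))"
      if "(z, z') \<in> ?r" "z \<noteq> z'" for z z'
      by (rule cb_derivative_less[OF seg_less_seg[OF wo that]])
  qed
  then obtain z where z: "cb_derivative X (seg ?r z) \<subseteq> derived_set (cb_derivative X (seg ?r z))" ..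
  define r0 where "r0 = seg ?r z"
  define K where "K = cb_derivative X r0"
  have r0: "Well_order r0" unfolding r0_def by (rule Well_order_Restr[OF wo])
  have perf: "K \<subseteq> derived_set K" using z by (simp add: K_def r0_def)
  have KX: "K \<subseteq> X" unfolding K_def by (rule cb_derivative_subset[OF r0])
  have stable: "cb_derivative X s = K" if s: "r0 <o s" for s :: "'a set rel"
  proof (rule equalityI)
    have "Well_order s" using s by (auto simp: ordLess_def)
    then show "K \<subseteq> cb_derivative X s" using perf KX by (rule perfect_subset_cb_derivative)
    show "cb_derivative X s \<subseteq> K"
      unfolding K_def by (rule cb_derivative_anti[OF ordLess_imp_ordLeq[OF s]])
  qed
  have "perfect_kernel X = K"
    unfolding perfect_kernel_def
  proof (rule the_equality)
    show "\<exists>r :: 'a set rel. Well_order r \<and> cb_derivative X r = K \<and>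
        (\<forall>s :: 'a set rel. r <o s \<longrightarrow> cb_derivative X s = K)"
      using r0 stable unfolding K_def by blast
    fix S assume "\<exists>r :: 'a set rel. Well_order r \<and> cb_derivative X r = S \<and>
        (\<forall>s :: 'a set rel. r <o s \<longrightarrow> cb_derivative X s = S)"
    then obtain r :: "'a set rel" where r: "Well_order r" "cb_derivative X r = S"
        "\<And>s :: 'a set rel. r <o s \<Longrightarrow> cb_derivative X s = S" by blast
    from ordLess_or_ordLeq[OF r(1) r0] show "S = K"
    proof
      assume "r <o r0"
      from r(3)[OF this] show ?thesis by (simp add: K_def)
    next
      assume "r0 \<le>o r"
      then consider "r0 <o r" | "r0 =o r"
        using ordLeq_iff_ordLess_or_ordIso by blast
      then show ?thesis
      proof cases
        case 1
        from stable[OF this] show ?thesis using r(2) by simp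
      next
        case 2
        from cb_derivative_cong[OF this, of X] show ?thesis using r(2) by (simp add: K_def)
      qed
    qed
  qed
  moreover have "S \<subseteq> K" if "S \<subseteq> derived_set S" "S \<subseteq> X"
    unfolding K_def by (rule perfect_subset_cb_derivative[OF r0 that])
  ultimately show "perfect_kernel X \<subseteq> derived_set (perfect_kernel X)"
    "S \<subseteq> derived_set S \<Longrightarrow> S \<subseteq> X \<Longrightarrow> S \<subseteq> perfect_kernel X"
    using perf by simp_all
qed

section \<open>Detection on perfect kernels and on derivatives\<close>

context function_space_embedding
begin

lemma detected_mono: "detected U B g \<Longrightarrow> B \<subseteq> B' \<Longrightarrow> detected U B' g"
  unfolding detected_def by blast

text \<open>For a suitable \<open>z\<close>, the derivative of K2 of order \<omega>^z lies in its
  own derived set, hence in the perfect kernel. The kernel of K1 survives every derivative, so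
  \<open>large_on_omega_derivative\<close> with \<open>n = 1\<close> applies.\<close>

lemma detected_perfect_kernel:
  assumes "open U" "U \<inter> perfect_kernel UNIV \<noteq> {}"
  shows "\<exists>g. detected U (perfect_kernel UNIV) g"
proof -
  let ?r = "|UNIV :: 'k2 set set|"
  let ?D = "\<lambda>z. omega_derivative ?r z (UNIV :: 'k2 set)"
  have wo: "Well_order ?r" by (rule card_of_Well_order)
  have F: "Field ?r = UNIV" by (rule Field_card_of)
  have "\<exists>z. ?D z \<subseteq> derived_set (?D z)"
  proof (rule decreasing_stabilizes[OF wo F])
    fix z z' :: "'k2 set" assume zz: "(z, z') \<in> ?r" "z \<noteq> z'"
    \<comment> \<open>Two derivatives of order \<omega>^z fit below the larger exponent; the second
      one supplies the derived set.\<close>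
    have "?D z' \<subseteq> (omega_derivative ?r z ^^ 2) UNIV"
      by (rule omega_derivative_subset_funpow[OF wo _ zz]) (simp add: F)
    also have "(omega_derivative ?r z ^^ 2) UNIV = omega_derivative ?r z (?D z)"
      by (simp add: numeral_2_eq_2)
    also have "\<dots> \<subseteq> derived_set (?D z)"
      by (rule omega_derivative_subset_derived[OF wo]) (simp add: F)
    finally show "?D z' \<subseteq> derived_set (?D z)" .
  qed
  then obtain z where z: "?D z \<subseteq> derived_set (?D z)" ..
  have zF: "z \<in> Field ?r" by (simp add: F)
  have sub: "(omega_derivative ?r z ^^ 1) (UNIV :: 'k2 set) \<subseteq> perfect_kernel UNIV"
    using perfect_kernel_greatest[OF z subset_UNIV] by simp
  obtain m where m: "\<And>U. open U \<Longrightarrow> U \<inter> (omega_derivative ?r z ^^ m) UNIV \<noteq> {} \<Longrightarrow>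
      \<exists>g. detected U ((omega_derivative ?r z ^^ 1) UNIV) g"
    using large_on_omega_derivative[OF wo zF] by blast
  have "perfect_kernel (UNIV :: 'k1 set) \<subseteq> (omega_derivative ?r z ^^ m) UNIV"
    by (rule perfect_subset_omega_derivative[OF wo perfect_kernel_perfect subset_UNIV])
  then have "U \<inter> (omega_derivative ?r z ^^ m) UNIV \<noteq> {}" using assms(2) by blast
  from m[OF assms(1) this] show ?thesis using detected_mono[OF _ sub] by blast
qed

text \<open>The order \<beta> for K1 depends on \<beta>' but stays below the same power of \<omega>.
  This is what makes the minima over all smaller orders comparable.\<close>

lemma detected_cb_derivative:
  fixes r :: "'o rel" and \<beta>' :: "('o \<Rightarrow> nat) rel"
  assumes wo: "Well_order r" and \<beta>': "\<beta>' <o omega_pow r"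
  shows "\<exists>\<beta> :: ('o \<Rightarrow> nat) rel. \<beta> <o omega_pow r \<and>
    (\<forall>U. open U \<longrightarrow> U \<inter> cb_derivative UNIV \<beta> \<noteq> {} \<longrightarrow> (\<exists>g. detected U (cb_derivative UNIV \<beta>') g))"
proof (rule cb_derivative_below_omega_pow[OF wo \<beta>', where 'a = 'k2])
  assume "\<And>X :: 'k2 set. cb_derivative X \<beta>' = X"
  then have "cb_derivative (UNIV :: 'k2 set) \<beta>' = UNIV" .
  moreover obtain \<beta> :: "('o \<Rightarrow> nat) rel" where "\<beta> <o omega_pow r"
    by (rule cb_derivative_zero_below_omega_pow[OF wo])
  ultimately show ?thesis using large_somewhere by auto
next
  fix z n assume z: "z \<in> Field r" and sub: "\<And>X :: 'k2 set. (omega_derivative r z ^^ n) X \<subseteq> cb_derivative X \<beta>'"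
  obtain m where m: "\<And>U. open U \<Longrightarrow> U \<inter> (omega_derivative r z ^^ m) UNIV \<noteq> {} \<Longrightarrow>
      \<exists>g. detected U ((omega_derivative r z ^^ n) UNIV) g"
    using large_on_omega_derivative[OF wo z] by blast
  obtain \<beta> :: "('o \<Rightarrow> nat) rel" where \<beta>: "\<beta> <o omega_pow r"
      "\<And>X :: 'k1 set. cb_derivative X \<beta> = (omega_derivative r z ^^ m) X"
    by (rule omega_derivative_funpow_eq_cb_derivative[OF wo z, where 'a = 'k1 and n = m]) blast
  show ?thesis
  proof (intro exI[of _ \<beta>] conjI allI impI \<beta>(1))
    fix U :: "'k1 set" assume "open U" "U \<inter> cb_derivative UNIV \<beta> \<noteq> {}"
    then obtain g where "detected U ((omega_derivative r z ^^ n) UNIV) g"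
      using m unfolding \<beta>(2) by blast
    then show "\<exists>g. detected U (cb_derivative UNIV \<beta>') g"
      using detected_mono sub by blast
  qed
qed

end

section \<open>Isomorphic embeddings of normed spaces\<close>

text \<open>The inverse of the embedding is controlled only on the image, so the bound is relative
  to a subspace.\<close>

lemma homogeneous_continuous_bounded:
  fixes f :: "'x::real_normed_vector \<Rightarrow> 'y::real_normed_vector"
  assumes S: "subspace S" and hom: "\<And>c x. x \<in> S \<Longrightarrow> f (c *\<^sub>R x) = c *\<^sub>R f x" and cont: "continuous_on S f"
  obtains K where "K > 0" "\<And>x. x \<in> S \<Longrightarrow> norm (f x) \<le> K * norm x"
proof -
  have zero: "0 \<in> S" "f 0 = 0" using subspace_0[OF S] hom[of 0 0] by auto
  obtain d where d: "d > 0" "\<And>x. x \<in> S \<Longrightarrow> norm x < d \<Longrightarrow> norm (f x) < 1"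
    using cont zero unfolding continuous_on_iff by (metis dist_0_norm dist_commute zero_less_one)
  show thesis
  proof (rule that)
    show "2 / d > 0" using d(1) by simp
    fix x assume x: "x \<in> S"
    show "norm (f x) \<le> 2 / d * norm x"
    proof (cases "x = 0")
      case False
      define t where "t = d / (2 * norm x)"
      have t: "t > 0" using d(1) False by (simp add: t_def)
      have "norm (t *\<^sub>R x) < d" using d(1) False by (simp add: t_def)
      then have "norm (f (t *\<^sub>R x)) < 1" using d(2) subspace_scale[OF S x] by blast
      then have "t * norm (f x) < 1" using hom[OF x, of t] t by simp
      then show ?thesis using d(1) False by (simp add: t_def field_simps)
    qed (use zero in simp)
  qed
qed

lemma isomorphic_to_subspace_imp_embedding:
  assumes "isomorphic_to_subspace_of (UNIV :: 'x::real_normed_vector set) TYPE('y::real_normed_vector)"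
  obtains T :: "'x::real_normed_vector \<Rightarrow> 'y::real_normed_vector" and c M where "linear T" "c > 0"
    "\<And>x. c * norm x \<le> norm (T x)" "\<And>x. norm (T x) \<le> M * norm x"
proof -
  obtain S :: "'y set" and f g where S: "subspace S" and add: "\<And>x y. f (x + y) = f x + f y"
    and scale: "\<And>c x. f (c *\<^sub>R x) = c *\<^sub>R f x" and hom: "homeomorphism (UNIV :: 'x set) S f g"
    using assms unfolding isomorphic_to_subspace_of_def linearly_homeomorphic_def by auto
  have lin: "linear f" using add scale by (rule linearI)
  have gf: "g (f x) = x" for x using hom by (simp add: homeomorphism_def)
  have fS: "f x \<in> S" for x using hom by (auto simp: homeomorphism_def)
  obtain M where M: "\<And>x. norm (f x) \<le> M * norm x"
    using homogeneous_continuous_bounded[OF subspace_UNIV, of f] scale homeomorphism_cont1[OF hom]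
    by (metis UNIV_I)
  have "g (c *\<^sub>R y) = c *\<^sub>R g y" if "y \<in> S" for c y
  proof -
    obtain x where "y = f x" using \<open>y \<in> S\<close> hom by (auto simp: homeomorphism_def)
    then show ?thesis using gf scale by metis
  qed
  then obtain K where K: "K > 0" "\<And>y. y \<in> S \<Longrightarrow> norm (g y) \<le> K * norm y"
    using homogeneous_continuous_bounded[OF S, of g] homeomorphism_cont2[OF hom] by metis
  have "1 / K * norm x \<le> norm (f x)" for x
    using K(2)[OF fS[of x]] K(1) gf[of x] by (simp add: field_simps)
  then show thesis using that[OF lin, of "1 / K" M] K(1) M by auto
qed

theorem theorem1p3:
  fixes \<alpha> :: "'o rel"
  assumes "compact (UNIV :: 'k1::t2_space set)" and "infinite (UNIV :: 'k1 set)"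
    and "compact (UNIV :: 'k2::t2_space set)" and "infinite (UNIV :: 'k2 set)"
    and "isomorphic_to_subspace_of (UNIV :: ('k1 \<Rightarrow>\<^sub>C real) set) TYPE('k2 \<Rightarrow>\<^sub>C 'e::banach)"
    and "Well_order \<alpha>"
  shows
    "(nontrivial_cotype TYPE('e) \<longrightarrow>
        card_min {c_pb (cb_derivative (UNIV :: 'k1 set) \<beta>) | \<beta> :: ('o \<Rightarrow> nat) rel. \<beta> <o omega_pow \<alpha>}
          \<le>o card_min {c_pb (cb_derivative (UNIV :: 'k2 set) \<beta>) | \<beta> :: ('o \<Rightarrow> nat) rel. \<beta> <o omega_pow \<alpha>}
      \<and> cellularity TYPE('k1) \<le>o cellularity TYPE('k2)
      \<and> c_pb (perfect_kernel (UNIV :: 'k1 set)) \<le>o c_pb (perfect_kernel (UNIV :: 'k2 set)))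
   \<and> (\<not> isomorphic_to_subspace_of c0 TYPE('e) \<longrightarrow>
        card_min {c_pb (cb_derivative (UNIV :: 'k1 set) \<beta>) | \<beta> :: ('o \<Rightarrow> nat) rel. \<beta> <o omega_pow \<alpha>}
          \<le>o card_min {c_pf (cb_derivative (UNIV :: 'k2 set) \<beta>) | \<beta> :: ('o \<Rightarrow> nat) rel. \<beta> <o omega_pow \<alpha>}
      \<and> cellularity TYPE('k1) \<le>o cellularity TYPE('k2)
      \<and> c_pb (perfect_kernel (UNIV :: 'k1 set)) \<le>o c_pf (perfect_kernel (UNIV :: 'k2 set)))"
proof -
  obtain T :: "('k1 \<Rightarrow>\<^sub>C real) \<Rightarrow> ('k2 \<Rightarrow>\<^sub>C 'e)" and c M where T: "linear T" "c > 0"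
      "\<And>x. c * norm x \<le> norm (T x)" "\<And>x. norm (T x) \<le> M * norm x"
    by (rule isomorphic_to_subspace_imp_embedding[OF assms(5)]) blast
  have emb: "function_space_embedding T c M"
    if "\<And>C (e :: nat \<Rightarrow> 'e) \<epsilon>. bounded_multiples C e \<Longrightarrow> \<epsilon> > 0 \<Longrightarrow> finite {i. norm (e i) \<ge> \<epsilon>}"
    using assms(1,3) T that by (rule function_space_embedding.intro)
  let ?cb1 = "\<lambda>\<beta> :: ('o \<Rightarrow> nat) rel. cb_derivative (UNIV :: 'k1 set) \<beta>"
  let ?cb2 = "\<lambda>\<beta> :: ('o \<Rightarrow> nat) rel. cb_derivative (UNIV :: 'k2 set) \<beta>"
  have c_wo: "Well_order (c_pb A)" "Well_order (c_pf B)" for A :: "'x::topological_space set" and B :: "'y::topological_space set"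
    unfolding c_pb_def c_pf_def by (rule Well_order_card_sup)+
  obtain \<beta>0 :: "('o \<Rightarrow> nat) rel" where \<beta>0: "\<beta>0 <o omega_pow \<alpha>"
    by (rule cb_derivative_zero_below_omega_pow[OF assms(6)])
  \<comment> \<open>\<open>h\<close> stands for \<open>c_pb\<close> or \<open>c_pf\<close>; the two
    parts differ only in the transfer inequality \<open>le\<close>.\<close>
  have ge: "card_min {c_pb (?cb1 \<beta>) | \<beta>. \<beta> <o omega_pow \<alpha>} \<le>o card_min {h (?cb2 \<beta>) | \<beta>. \<beta> <o omega_pow \<alpha>}"
    if h: "\<And>A. Well_order (h A)"
      and le: "\<And>P B. (\<And>U. open U \<Longrightarrow> U \<inter> P \<noteq> {} \<Longrightarrow> \<exists>g. function_space_embedding.detected T c U B g) \<Longrightarrow> c_pb P \<le>o h B"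
      and e: "function_space_embedding T c M" for h :: "'k2 set \<Rightarrow> 'k2 set rel"
  proof (rule card_min_mono)
    show "{h (?cb2 \<beta>) | \<beta>. \<beta> <o omega_pow \<alpha>} \<noteq> {}" using \<beta>0 by blast
    fix s assume "s \<in> {h (?cb2 \<beta>) | \<beta>. \<beta> <o omega_pow \<alpha>}"
    then obtain \<beta>' where \<beta>': "\<beta>' <o omega_pow \<alpha>" "s = h (?cb2 \<beta>')" by blast
    obtain \<beta> where \<beta>: "\<beta> <o omega_pow \<alpha>" "\<And>U. open U \<Longrightarrow> U \<inter> ?cb1 \<beta> \<noteq> {} \<Longrightarrow>
        \<exists>g. function_space_embedding.detected T c U (?cb2 \<beta>') g"
      using function_space_embedding.detected_cb_derivative[OF e assms(6) \<beta>'(1)] by blast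
    from le[OF \<beta>(2)] show "\<exists>r\<in>{c_pb (?cb1 \<beta>) | \<beta>. \<beta> <o omega_pow \<alpha>}. r \<le>o s"
      using \<beta>(1) \<beta>'(2) by blast
  qed (use h c_wo in auto)
  \<comment> \<open>Both parts use the chain c(K1) \<le> c_pb(K1) \<le> c_pf(K2) \<le> c(K2), whose
    last link rests on the Baire property.\<close>
  have cell: "cellularity TYPE('k1) \<le>o cellularity TYPE('k2)" if e: "function_space_embedding T c M"
  proof -
    have "c_pb (UNIV :: 'k1 set) \<le>o c_pf (UNIV :: 'k2 set)"
      by (rule function_space_embedding.c_pb_transfer(1)[OF e _ assms(4)])
        (use function_space_embedding.large_somewhere[OF e] in auto)
    from ordLeq_transitive[OF cellularity_le_c_pb this] show ?thesis
      using c_pf_le_cellularity[OF assms(3,4)] by (rule ordLeq_transitive)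
  qed
  show ?thesis
  proof (intro conjI impI)
    assume cot: "nontrivial_cotype TYPE('e)"
    have e: "function_space_embedding T c M"
      using nontrivial_cotype_imp_bounded_large[OF cot] by (intro emb) blast
    show "card_min {c_pb (?cb1 \<beta>) | \<beta>. \<beta> <o omega_pow \<alpha>} \<le>o card_min {c_pb (?cb2 \<beta>) | \<beta>. \<beta> <o omega_pow \<alpha>}"
      by (rule ge[OF c_wo(1) _ e]) (rule function_space_embedding.c_pb_transfer(2)[OF e _ assms(4) cot])
    show "cellularity TYPE('k1) \<le>o cellularity TYPE('k2)" by (rule cell[OF e])
    show "c_pb (perfect_kernel (UNIV :: 'k1 set)) \<le>o c_pb (perfect_kernel (UNIV :: 'k2 set))"
      by (rule function_space_embedding.c_pb_transfer(2)[OF e _ assms(4) cot])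
        (rule function_space_embedding.detected_perfect_kernel[OF e])
  next
    assume c0: "\<not> isomorphic_to_subspace_of c0 TYPE('e)"
    have e: "function_space_embedding T c M"
      using no_c0_imp_finite_large[OF c0] by (intro emb) blast
    show "card_min {c_pb (?cb1 \<beta>) | \<beta>. \<beta> <o omega_pow \<alpha>} \<le>o card_min {c_pf (?cb2 \<beta>) | \<beta>. \<beta> <o omega_pow \<alpha>}"
      by (rule ge[OF c_wo(2) _ e]) (rule function_space_embedding.c_pb_transfer(1)[OF e _ assms(4)])
    show "cellularity TYPE('k1) \<le>o cellularity TYPE('k2)" by (rule cell[OF e])
    show "c_pb (perfect_kernel (UNIV :: 'k1 set)) \<le>o c_pf (perfect_kernel (UNIV :: 'k2 set))"
      by (rule function_space_embedding.c_pb_transfer(1)[OF e _ assms(4)])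
        (rule function_space_embedding.detected_perfect_kernel[OF e])
  qed
qed

end
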